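(* Let $N\ge 1$, $0<s<1$, $2<p<\infty$, let $\Omega\subset\mathbb{R}^N$ be a bounded domain with smooth boundary, and let $d(x)=\operatorname{dist}(x,\partial\Omega)$. Let $F$ be the unique positive solution of $\mathcal{L}_{p,s}F=\frac{1}{p-2}F$ in $\Omega$, $F=0$ in $\mathbb{R}^N\setminus\Omega$, and let $U(x,t)=t^{-1/(p-2)}F(x)$. Consider the problem $$\text{(DP)}\qquad\partial_t u+\mathcal{L}_{p,s}u=0 \ \text{ in } \Omega\times(0,\infty),\qquad u(\cdot,0)=u_0 \ \text{ in } \Omega,\qquad u(x,t)=0 \ \text{ for } x\in\mathbb{R}^N\setminus\Omega,\ t>0,$$ with $u_0\in L^1(\Omega)$, $u_0\ge0$. Assume the following boundary behaviour hypothesis: for every nonnegative solution $u$ of (DP) with nontrivial data and every $t>0$, $u(x,t)\sim d(x)^s$, i.e. there are constants $0<c\le C<\infty$ (depending on $u$ and $t$) such that $c\,d(x)^s\le u(x,t)\le C\,d(x)^s$ for all $x\in\Omega$. Let $u$ be a nonnegative solution of (DP) with nontrivial data. Then there is a constant $T>0$ that depends on the data such that $$U(x,t+T)\le u(x,t)\le U(x,t)$$ holds for $x\in\Omega$ if $t$ is large. This means that as $t\to\infty$ $$t^{1/(p-2)}u(x,t)=F(x)+O(1/t).$$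
   Context: Functions on $\Omega$ are extended by zero to $\mathbb{R}^N\setminus\Omega$. Let $$J_{p,s}(u)=\frac1p\int_{\mathbb{R}^N}\int_{\mathbb{R}^N}\frac{|u(x)-u(y)|^p}{|x-y|^{N+sp}}\,dx\,dy ,$$ and let $W^{s,p}_0(\Omega)$ be the closure of $C_c^\infty(\Omega)$ in the norm given by $\|u\|^p=J_{p,s}(u)+\int_{\mathbb{R}^N}|u|^p\,dx$. The fractional $p$-Laplacian is $$\mathcal{L}_{p,s}u(x)=2\,\mathrm{p.v.}\int_{\mathbb{R}^N}\frac{|u(x)-u(y)|^{p-2}(u(x)-u(y))}{|x-y|^{N+sp}}\,dy,\qquad x\in\Omega,$$ understood on $\Omega$ as the sub-differential in $L^2(\Omega)$ of $J_{p,s}$ (defined on $W^{s,p}_0(\Omega)$, and $+\infty$ elsewhere): $\mathcal{L}_{p,s}u=w\in L^2(\Omega)$ means $u\in W^{s,p}_0(\Omega)$ and $$\int_{\mathbb{R}^N}\int_{\mathbb{R}^N}\frac{|u(x)-u(y)|^{p-2}(u(x)-u(y))(\phi(x)-\phi(y))}{|x-y|^{N+sp}}\,dx\,dy=\int_\Omega w\,\phi\,dx\quad\text{for all }\phi\in W^{s,p}_0(\Omega).$$ For $u_0\in L^2(\Omega)$ the solution is the unique strong solution $u\in C([0,\infty);L^2(\Omega))$ given by the semigroup generated by this maximal monotone operator ($\mathcal{L}_{p,s}u(t)\in L^2(\Omega)$ for all $t>0$ and $du/dt=-\mathcal{L}_{p,s}u$ for a.e. $t>0$). This semigroup is order preserving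 and contractive in the $L^1(\Omega)$ norm; for $u_0\in L^1(\Omega)$ the solution is defined by extending the semigroup to $L^1(\Omega)$ by $L^1$-contractivity. For $t>0$, $u(\cdot,t)$ is identified with its (Hölder) continuous representative in $x$. The function $F$ exists and is unique, is positive in $\Omega$, Hölder continuous, vanishes on $\partial\Omega$, and satisfies $F(x)=O(d(x)^s)$ near $\partial\Omega$. *)

theory Defs
  imports "HOL-Analysis.Analysis"
begin

section \<open>Smooth functions and smooth domains\<close>

text \<open>The partial derivatives are taken in the directions of the orthonormal basis. The
  definitions are meant for open \<open>S\<close>.\<close>

fun Ck_on :: "nat \<Rightarrow> 'a::euclidean_space set \<Rightarrow> ('a \<Rightarrow> real) \<Rightarrow> bool" where
  "Ck_on 0 S f \<longleftrightarrow> continuous_on S f"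
| "Ck_on (Suc k) S f \<longleftrightarrow>
     (\<forall>x\<in>S. f differentiable (at x)) \<and>
     (\<forall>i\<in>Basis. Ck_on k S (\<lambda>x. frechet_derivative f (at x) i))"

definition smooth_on :: "'a::euclidean_space set \<Rightarrow> ('a \<Rightarrow> real) \<Rightarrow> bool" where
  "smooth_on S f \<longleftrightarrow> (\<forall>k. Ck_on k S f)"

text \<open>Near each boundary point, after choosing a unit vector \<open>e\<close> as the last coordinate axis,
  \<open>\<Omega>\<close> is the strict epigraph of a smooth function \<open>g\<close> of the remaining coordinates; these are
  encoded as the projection of \<open>x\<close> to the hyperplane orthogonal to \<open>e\<close>.\<close>

definition smooth_boundary :: "'a::euclidean_space set \<Rightarrow> bool" where
  "smooth_boundary \<Omega> \<longleftrightarrow>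
     (\<forall>x0\<in>frontier \<Omega>. \<exists>r>0. \<exists>e g. norm e = 1 \<and> smooth_on UNIV g \<and>
        \<Omega> \<inter> ball x0 r = {x \<in> ball x0 r. g (x - (x \<bullet> e) *\<^sub>R e) < x \<bullet> e})"

definition smooth_bounded_domain :: "'a::euclidean_space set \<Rightarrow> bool" where
  "smooth_bounded_domain \<Omega> \<longleftrightarrow>
     open \<Omega> \<and> connected \<Omega> \<and> \<Omega> \<noteq> {} \<and> bounded \<Omega> \<and> smooth_boundary \<Omega>"

definition bdist :: "'a::euclidean_space set \<Rightarrow> 'a \<Rightarrow> real" where
  "bdist \<Omega> x = infdist x (frontier \<Omega>)"

section \<open>Function spaces\<close>

text \<open>Elements of the function spaces are represented by functions on the whole space that vanish
  outside \<open>\<Omega>\<close>; functions that agree almost everywhere represent the same element.\<close>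

definition Lspace :: "real \<Rightarrow> 'a::euclidean_space set \<Rightarrow> ('a \<Rightarrow> real) set" where
  "Lspace q \<Omega> = {f. f \<in> borel_measurable lebesgue \<and> (\<forall>x. x \<notin> \<Omega> \<longrightarrow> f x = 0) \<and>
                     integrable lebesgue (\<lambda>x. \<bar>f x\<bar> powr q)}"

definition Lnorm :: "real \<Rightarrow> ('a::euclidean_space \<Rightarrow> real) \<Rightarrow> real" where
  "Lnorm q f = (LINT x|lebesgue. \<bar>f x\<bar> powr q) powr (1 / q)"

definition test_functions :: "'a::euclidean_space set \<Rightarrow> ('a \<Rightarrow> real) set" where
  "test_functions \<Omega> =
     {f. smooth_on UNIV f \<and> compact (closure {x. f x \<noteq> 0}) \<and> closure {x. f x \<noteq> 0} \<subseteq> \<Omega>}"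

text \<open>The integrand is 0 on the diagonal, because \<open>0 / 0 = 0\<close>.\<close>

definition J_energy :: "real \<Rightarrow> real \<Rightarrow> ('a::euclidean_space \<Rightarrow> real) \<Rightarrow> ennreal" where
  "J_energy p s u = ennreal (1 / p) *
     (\<integral>\<^sup>+ x. \<integral>\<^sup>+ y. ennreal (\<bar>u x - u y\<bar> powr p / norm (x - y) powr (real DIM('a) + s * p))
        \<partial>lebesgue \<partial>lebesgue)"

text \<open>The \<open>p\<close>-th power of the norm; it is \<open>\<infinity>\<close> outside the fractional Sobolev space.\<close>

definition W_norm_pow :: "real \<Rightarrow> real \<Rightarrow> ('a::euclidean_space \<Rightarrow> real) \<Rightarrow> ennreal" where
  "W_norm_pow p s u = J_energy p s u + (\<integral>\<^sup>+ x. ennreal (\<bar>u x\<bar> powr p) \<partial>lebesgue)"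

definition W0 :: "real \<Rightarrow> real \<Rightarrow> 'a::euclidean_space set \<Rightarrow> ('a \<Rightarrow> real) set" where
  "W0 p s \<Omega> = {u. u \<in> borel_measurable lebesgue \<and> (\<forall>x. x \<notin> \<Omega> \<longrightarrow> u x = 0) \<and>
     (\<exists>\<phi>. (\<forall>n. \<phi> n \<in> test_functions \<Omega>) \<and>
          (\<lambda>n::nat. W_norm_pow p s (\<lambda>x. u x - \<phi> n x)) \<longlonglongrightarrow> 0)}"

section \<open>The fractional p-Laplacian\<close>

definition pLap_form ::
  "real \<Rightarrow> real \<Rightarrow> ('a::euclidean_space \<Rightarrow> real) \<Rightarrow> ('a \<Rightarrow> real) \<Rightarrow> real" where
  "pLap_form p s u \<phi> = (LINT (x, y)|(lebesgue \<Otimes>\<^sub>M lebesgue).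
     \<bar>u x - u y\<bar> powr (p - 2) * (u x - u y) * (\<phi> x - \<phi> y) / norm (x - y) powr (real DIM('a) + s * p))"

text \<open>\<open>pLap p s \<Omega> u w\<close> states that \<open>u\<close> is in the domain of the operator on \<open>L\<^sup>2(\<Omega>)\<close> and that
  \<open>w\<close> represents its value at \<open>u\<close>.\<close>

definition pLap ::
  "real \<Rightarrow> real \<Rightarrow> 'a::euclidean_space set \<Rightarrow> ('a \<Rightarrow> real) \<Rightarrow> ('a \<Rightarrow> real) \<Rightarrow> bool" where
  "pLap p s \<Omega> u w \<longleftrightarrow> u \<in> W0 p s \<Omega> \<and> w \<in> Lspace 2 \<Omega> \<and>
     (\<forall>\<phi>\<in>W0 p s \<Omega>. pLap_form p s u \<phi> = (LINT x:\<Omega>|lebesgue. w x * \<phi> x))"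

section \<open>Solutions of the Dirichlet problem\<close>

definition L2_continuous :: "(real \<Rightarrow> 'a::euclidean_space \<Rightarrow> real) \<Rightarrow> bool" where
  "L2_continuous u \<longleftrightarrow>
     (\<forall>t\<ge>0. ((\<lambda>r. Lnorm 2 (\<lambda>x. u r x - u t x)) \<longlongrightarrow> 0) (at t within {0..}))"

definition L2_abs_continuous_on :: "real \<Rightarrow> real \<Rightarrow> (real \<Rightarrow> 'a::euclidean_space \<Rightarrow> real) \<Rightarrow> bool"
where
  "L2_abs_continuous_on a b u \<longleftrightarrow>
     (\<forall>\<epsilon>>0. \<exists>\<delta>>0. \<forall>P. finite P \<and> (\<forall>(l, r)\<in>P. a \<le> l \<and> l \<le> r \<and> r \<le> b) \<and>
        disjoint_family_on (\<lambda>(l, r). {l<..<r}) P \<and> (\<Sum>(l, r)\<in>P. r - l) < \<delta> \<longrightarrow>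
        (\<Sum>(l, r)\<in>P. Lnorm 2 (\<lambda>x. u r x - u l x)) < \<epsilon>)"

definition L2_has_time_derivative ::
  "(real \<Rightarrow> 'a::euclidean_space \<Rightarrow> real) \<Rightarrow> ('a \<Rightarrow> real) \<Rightarrow> real \<Rightarrow> bool" where
  "L2_has_time_derivative u v t \<longleftrightarrow>
     ((\<lambda>h. Lnorm 2 (\<lambda>x. (u (t + h) x - u t x) / h - v x)) \<longlongrightarrow> 0) (at 0)"

text \<open>As usual for evolution equations governed by a maximal monotone operator, a strong solution
  is absolutely continuous on the compact subintervals of \<open>(0,\<infinity>)\<close>; this is not implied by
  differentiability almost everywhere.\<close>

definition strong_solution ::
  "real \<Rightarrow> real \<Rightarrow> 'a::euclidean_space set \<Rightarrow> (real \<Rightarrow> 'a \<Rightarrow> real) \<Rightarrow> bool" where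
  "strong_solution p s \<Omega> u \<longleftrightarrow>
     (\<forall>t\<ge>0. u t \<in> Lspace 2 \<Omega>) \<and> L2_continuous u \<and>
     (\<forall>a b. 0 < a \<and> a < b \<longrightarrow> L2_abs_continuous_on a b u) \<and>
     (\<forall>t>0. \<exists>w. pLap p s \<Omega> (u t) w) \<and>
     (AE t in lebesgue. 0 < t \<longrightarrow>
        (\<exists>w. pLap p s \<Omega> (u t) w \<and> L2_has_time_derivative u (\<lambda>x. - w x) t))"

text \<open>The semigroup extended to \<open>L\<^sup>1(\<Omega>)\<close>: the orbit of \<open>u0\<close> is the limit in \<open>L\<^sup>1(\<Omega>)\<close> of orbits of
  data in \<open>L\<^sup>2(\<Omega>)\<close> (time 0 included, so these data approximate \<open>u0\<close>). Continuity on \<open>\<Omega>\<close>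
  selects the continuous representative of \<open>u t\<close>.\<close>

definition DP_solution ::
  "real \<Rightarrow> real \<Rightarrow> 'a::euclidean_space set \<Rightarrow> ('a \<Rightarrow> real) \<Rightarrow> (real \<Rightarrow> 'a \<Rightarrow> real) \<Rightarrow> bool" where
  "DP_solution p s \<Omega> u0 u \<longleftrightarrow>
     u 0 = u0 \<and> (\<forall>t\<ge>0. u t \<in> Lspace 1 \<Omega>) \<and>
     (\<exists>v. (\<forall>n::nat. strong_solution p s \<Omega> (v n)) \<and>
          (\<forall>t\<ge>0. (\<lambda>n. Lnorm 1 (\<lambda>x. v n t x - u t x)) \<longlonglongrightarrow> 0)) \<and>
     (\<forall>t>0. continuous_on \<Omega> (u t))"

definition nonneg_nontrivial_DP_solution ::
  "real \<Rightarrow> real \<Rightarrow> 'a::euclidean_space set \<Rightarrow> ('a \<Rightarrow> real) \<Rightarrow> (real \<Rightarrow> 'a \<Rightarrow> real) \<Rightarrow> bool" where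
  "nonneg_nontrivial_DP_solution p s \<Omega> u0 u \<longleftrightarrow>
     DP_solution p s \<Omega> u0 u \<and>
     (AE x in lebesgue. 0 \<le> u0 x) \<and> \<not> (AE x in lebesgue. u0 x = 0) \<and>
     (\<forall>t>0. \<forall>x. 0 \<le> u t x)"

definition boundary_behaviour :: "real \<Rightarrow> real \<Rightarrow> 'a::euclidean_space set \<Rightarrow> bool" where
  "boundary_behaviour p s \<Omega> \<longleftrightarrow>
     (\<forall>u0 u. nonneg_nontrivial_DP_solution p s \<Omega> u0 u \<longrightarrow>
        (\<forall>t>0. \<exists>c C. 0 < c \<and> c \<le> C \<and>
           (\<forall>x\<in>\<Omega>. c * bdist \<Omega> x powr s \<le> u t x \<and> u t x \<le> C * bdist \<Omega> x powr s)))"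

definition positive_profile ::
  "real \<Rightarrow> real \<Rightarrow> 'a::euclidean_space set \<Rightarrow> ('a \<Rightarrow> real) \<Rightarrow> bool" where
  "positive_profile p s \<Omega> F \<longleftrightarrow>
     pLap p s \<Omega> F (\<lambda>x. F x / (p - 2)) \<and>
     (\<forall>x\<in>\<Omega>. 0 < F x) \<and> (\<forall>x. x \<notin> \<Omega> \<longrightarrow> F x = 0) \<and> continuous_on \<Omega> F"

definition friendly_giant :: "real \<Rightarrow> ('a \<Rightarrow> real) \<Rightarrow> 'a \<Rightarrow> real \<Rightarrow> real" where
  "friendly_giant p F x t = t powr (- 1 / (p - 2)) * F x"

end

theory Submission
  imports Defs
begin

text \<open>
  The orbits contract the positive part of a difference in \<open>L\<^sup>2\<close>: testing the equations of two strong
  solutions with \<open>(u - v)\<^sub>+\<close>, which lies in \<open>W0\<close>, gives \<open>d/dt \<parallel>(u - v)\<^sub>+\<parallel>\<^sup>2 \<le> 0\<close> for a.e. \<open>t\<close>.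
  The friendly giant shifted in time, \<open>U(t + \<epsilon>)\<close>, is a strong solution, and its value at time \<open>0\<close> blows
  up in \<open>\<Omega>\<close> as \<open>\<epsilon> \<rightarrow> 0\<close>, so by comparison every strong solution lies between \<open>-U\<close> and \<open>U\<close>, whatever
  its data. This bound passes to the \<open>L\<^sup>1\<close> limits; it also dominates the approximations, which therefore
  converge in \<open>L\<^sup>2\<close> at each positive time, so that comparison from below survives the limit too. By the
  boundary behaviour of \<open>U\<close> and of \<open>u\<close> at time \<open>1\<close>, both are comparable with \<open>d\<^sup>s\<close>, hence
  \<open>U(1 + T) \<le> u(1)\<close> for large \<open>T\<close>, and this persists.
\<close>

section \<open>Absolutely continuous functions and the space of square integrable functions\<close>

text \<open>\<open>W0\<close> is a closure of smooth functions, so that it contains positive parts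
  is not obvious: truncating a test function destroys smoothness, and membership has to be shown in
  norm. This calls for a smooth truncation that fixes 0 and does not enlarge increments, and for
  finite energy of test functions, where \<open>0 < s < 1\<close> enters. The same finiteness keeps
  the integrals of the form from being mere default values.

  A derivative that exists only almost everywhere does not control increments, hence the opening
  lemma on absolutely continuous functions.

  The boundary hypothesis concerns solutions, not \<open>F\<close>. The bound
  \<open>F \<le> C d^s\<close> comes from applying it to the friendly giant delayed by one unit of
  time, which is itself a solution with admissible data. If \<open>u(1) \<ge> c d^s\<close>, any
  \<open>T\<close> with \<open>(1 + T)^(-1/(p-2)) C \<le> c\<close> starts the lower comparison. For
  the rate, \<open>t^(1/(p-2)) U(t + T)\<close> is \<open>F\<close> times
  \<open>(1 - T/(t+T))^(1/(p-2))\<close>, so the error is \<open>F\<close> times a quantity of order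
  \<open>T/t\<close>, and \<open>F\<close> is bounded because \<open>d\<close> is.\<close>

text \<open>A Cousin argument: the gauge is chosen by differentiability off the null set, and on the null set
  so that the intervals with tags there lie in an open set of small measure.\<close>

lemma abs_continuous_deriv_nonpos_imp_le:
  fixes g :: "real \<Rightarrow> real"
  assumes "a \<le> b"
    and ac: "\<And>\<epsilon>. 0 < \<epsilon> \<Longrightarrow> \<exists>\<delta>>0. \<forall>P. finite P \<and> (\<forall>(l, r)\<in>P. a \<le> l \<and> l \<le> r \<and> r \<le> b) \<and>
        disjoint_family_on (\<lambda>(l, r). {l<..<r}) P \<and> (\<Sum>(l, r)\<in>P. r - l) < \<delta> \<longrightarrow>
        (\<Sum>(l, r)\<in>P. \<bar>g r - g l\<bar>) < \<epsilon>"
    and N: "N \<in> null_sets lebesgue"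
    and deriv: "\<And>t. t \<in> {a..b} \<Longrightarrow> t \<notin> N \<Longrightarrow> \<exists>D\<le>0. (g has_real_derivative D) (at t)"
  shows "g b \<le> g a"
proof (rule field_le_epsilon)
  fix e :: real assume "0 < e"
  \<comment> \<open>The summand 1 keeps the denominator positive when \<open>a = b\<close>. The
    intervals with tags off the null set contribute at most
    \<open>\<epsilon> * (b - a) \<le> e / 2\<close>.\<close>
  define \<epsilon> where "\<epsilon> = e / (2 * (b - a + 1))"
  have "\<epsilon> > 0" using \<open>0 < e\<close> \<open>a \<le> b\<close> by (auto simp: \<epsilon>_def)
  have small: "\<epsilon> * (b - a) \<le> e / 2"
    using \<open>0 < e\<close> \<open>a \<le> b\<close> by (simp add: \<epsilon>_def field_simps)
  obtain \<delta> where "\<delta> > 0" and \<delta>: "\<And>P. finite P \<Longrightarrow> (\<forall>(l, r)\<in>P. a \<le> l \<and> l \<le> r \<and> r \<le> b) \<Longrightarrow>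
        disjoint_family_on (\<lambda>(l, r). {l<..<r}) P \<Longrightarrow> (\<Sum>(l, r)\<in>P. r - l) < \<delta> \<Longrightarrow>
        (\<Sum>(l, r)\<in>P. \<bar>g r - g l\<bar>) < e / 2"
    using ac[of "e / 2"] \<open>0 < e\<close> by auto
  obtain U where U: "open U" "N \<subseteq> U" "U - N \<in> lmeasurable" "emeasure lebesgue (U - N) < ennreal \<delta>"
    using sets_lebesgue_outer_open[of N \<delta>] N \<open>\<delta> > 0\<close> by auto
  have Um [measurable]: "U \<in> sets lebesgue" using U(1) by auto
  have emU: "emeasure lebesgue U < ennreal \<delta>"
    using emeasure_Diff_null_set[OF N Um] U(4) by simp
  then have Ulm: "U \<in> lmeasurable" by (auto simp: fmeasurable_def intro: order.strict_trans)
  have mU: "measure lebesgue U < \<delta>"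
    using emU Ulm \<open>\<delta> > 0\<close> by (simp add: emeasure_eq_measure2 ennreal_less_iff)
  have Uint: "U \<inter> {x..y} \<in> lmeasurable" for x y
    using Ulm by (intro fmeasurable_Int_fmeasurable) auto
  \<comment> \<open>The increments of \<open>m\<close> add up over a division. On an interval
    contained in \<open>U\<close> the increment is the length, so the lengths of the bad intervals
    together are at most the measure of \<open>U\<close>.\<close>
  define m where "m r = measure lebesgue (U \<inter> {a..r})" for r
  have m_diff: "m r - m l = measure lebesgue (U \<inter> {l<..r})" if "a \<le> l" "l \<le> r" for l r
  proof -
    have *: "U \<inter> {a..r} = (U \<inter> {a..l}) \<union> (U \<inter> {l<..r})" using that by auto
    have "U \<inter> {l<..r} \<in> lmeasurable"
      using fmeasurable_Int_fmeasurable[OF Ulm, of "{l<..r}"] by auto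
    then have "m r = m l + measure lebesgue (U \<inter> {l<..r})"
      unfolding m_def * using Uint[of a l]
      by (intro measure_Union) (auto dest: fmeasurableD fmeasurableD2 simp del: emeasure_completion)
    then show ?thesis by simp
  qed
  have "\<exists>d>0. \<forall>l r. l \<le> t \<and> t \<le> r \<and> t - l < d \<and> r - t < d \<longrightarrow>
      (t \<notin> N \<longrightarrow> g r - g l \<le> \<epsilon> * (r - l)) \<and> (t \<in> N \<longrightarrow> {l..r} \<subseteq> U)" if t: "t \<in> {a..b}" for t
  proof (cases "t \<in> N")
    case True
    then obtain d where "d > 0" "ball t d \<subseteq> U" using U(1,2) openE by blast
    then show ?thesis
      using True by (intro exI[of _ d]) (fastforce simp: dist_real_def subset_iff)
  next
    case False
    then obtain D where D: "D \<le> 0" "(g has_real_derivative D) (at t)" using deriv t by blast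
    then obtain d where "d > 0" and d: "\<And>y. \<bar>y - t\<bar> < d \<Longrightarrow> \<bar>g y - g t - D * (y - t)\<bar> \<le> \<epsilon> * \<bar>y - t\<bar>"
      using \<open>\<epsilon> > 0\<close> unfolding has_field_derivative_def has_derivative_within_alt by auto
    \<comment> \<open>Straddling: as \<open>t\<close> lies between \<open>l\<close> and
      \<open>r\<close>, the error bounds of the linear approximation on the two halves add up to
      exactly \<open>\<epsilon> * (r - l)\<close>.\<close>
    have "g r - g l \<le> \<epsilon> * (r - l)" if lr: "l \<le> t" "t \<le> r" "t - l < d" "r - t < d" for l r
    proof -
      have "D * (r - t) \<le> 0" "D * (t - l) \<le> 0"
        using D(1) lr by (auto simp: mult_nonpos_nonneg)
      moreover have "g r - g t \<le> D * (r - t) + \<epsilon> * (r - t)" using d[of r] lr by (auto simp: abs_le_iff)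
      moreover have "g t - g l \<le> D * (t - l) + \<epsilon> * (t - l)"
        using d[of l] lr by (auto simp: abs_le_iff algebra_simps)
      ultimately show ?thesis by (simp add: algebra_simps)
    qed
    then show ?thesis using False \<open>d > 0\<close> by blast
  qed
  then obtain d where d: "\<And>t. t \<in> {a..b} \<Longrightarrow> 0 < d t"
    "\<And>t l r. t \<in> {a..b} \<Longrightarrow> l \<le> t \<Longrightarrow> t \<le> r \<Longrightarrow> t - l < d t \<Longrightarrow> r - t < d t \<Longrightarrow>
      (t \<notin> N \<longrightarrow> g r - g l \<le> \<epsilon> * (r - l)) \<and> (t \<in> N \<longrightarrow> {l..r} \<subseteq> U)"
    by metis
  define \<gamma> where "\<gamma> t = (if t \<in> {a..b} then ball t (d t) else ball t 1)" for t
  have "gauge \<gamma>" unfolding gauge_def \<gamma>_def using d(1) by auto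
  then obtain p where p: "p tagged_division_of {a..b}" "\<gamma> fine p"
    using fine_division_exists_real by blast
  have pK: "t \<in> {a..b} \<and> a \<le> Inf K \<and> Inf K \<le> t \<and> t \<le> Sup K \<and> Sup K \<le> b \<and> K = {Inf K..Sup K} \<and>
      (t \<notin> N \<longrightarrow> g (Sup K) - g (Inf K) \<le> \<epsilon> * (Sup K - Inf K)) \<and> (t \<in> N \<longrightarrow> K \<subseteq> U)"
    if tK: "(t, K) \<in> p" for t K
  proof -
    obtain l r where K: "K = {l..r}" using tagged_division_ofD(4)[OF p(1) tK] by auto
    have tin: "t \<in> K" "K \<subseteq> {a..b}" using tagged_division_ofD(2,3)[OF p(1) tK] by auto
    with K have lr: "l \<le> t" "t \<le> r" "a \<le> l" "r \<le> b" and tab: "t \<in> {a..b}" by auto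
    have "K \<subseteq> \<gamma> t" using p(2) tK unfolding fine_def by blast
    then have "K \<subseteq> ball t (d t)" using tab by (simp add: \<gamma>_def)
    moreover have "l \<in> K" "r \<in> K" using K lr by auto
    ultimately have "t - l < d t" "r - t < d t" using lr by (auto simp: dist_real_def subset_iff)
    then show ?thesis using d(2)[OF tab lr(1,2)] lr tab K by auto
  qed
  define q where "q = {(t, K) \<in> p. t \<in> N}"
  have finp: "finite p" using p(1) by blast
  have qp: "q \<subseteq> p" by (auto simp: q_def)
  have finq: "finite q" using finp qp finite_subset by blast
  \<comment> \<open>Absolute continuity speaks of a finite set of endpoint pairs. Distinct tagged
    intervals must not collapse to the same pair, or the sums could not be reindexed.\<close>
  define E where "E = (\<lambda>(t::real, K::real set). (Inf K, Sup K))"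
  have pb: "a \<le> Inf K" "Inf K \<le> t" "t \<le> Sup K" "Inf K \<le> Sup K" "Sup K \<le> b"
    and pint: "interior K = {Inf K<..<Sup K}"
    and pgood: "t \<notin> N \<Longrightarrow> g (Sup K) - g (Inf K) \<le> \<epsilon> * (Sup K - Inf K)"
    and pbad: "t \<in> N \<Longrightarrow> {Inf K..Sup K} \<subseteq> U"
    if "(t, K) \<in> p" for t K
    using pK[OF that] interior_atLeastAtMost_real[of "Inf K" "Sup K"] by simp_all
  have disj: "{Inf K<..<Sup K} \<inter> {Inf K'<..<Sup K'} = {}"
    if "(t, K) \<in> p" "(t', K') \<in> p" "(t, K) \<noteq> (t', K')" for t K t' K'
    using tagged_division_ofD(5)[OF p(1) that] pint[OF that(1)] pint[OF that(2)] by simp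
  have inj: "inj_on E q"
  proof (rule inj_onI, clarsimp simp: E_def)
    fix t K t' K'
    assume *: "(t, K) \<in> q" "(t', K') \<in> q" "Inf K = Inf K'" "Sup K = Sup K'"
    then have inp: "(t, K) \<in> p" "(t', K') \<in> p" using qp by auto
    have "K = {Inf K..Sup K}" "K' = {Inf K'..Sup K'}" using pK[OF inp(1)] pK[OF inp(2)] by simp_all
    then have "K = K'" using *(3,4) by simp
    \<comment> \<open>A common interval of two different tags would have empty interior, hence be a
      single point, and it contains both tags.\<close>
    moreover have "t = t'"
    proof (rule ccontr)
      assume "t \<noteq> t'"
      then have "{Inf K<..<Sup K} = {}" using disj[OF inp] \<open>K = K'\<close> by simp
      then have "Sup K \<le> Inf K" by (metis greaterThanLessThan_empty_iff)
      then show False using pb(2,3)[OF inp(1)] pb(2,3)[OF inp(2)] \<open>K = K'\<close> \<open>t \<noteq> t'\<close> by simp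
    qed
    ultimately show "t = t' \<and> K = K'" by simp
  qed
  have "(\<Sum>(t, K)\<in>q. Sup K - Inf K) = (\<Sum>(t, K)\<in>q. m (Sup K) - m (Inf K))"
  proof (intro sum.cong refl, clarsimp)
    fix t K assume "(t, K) \<in> q"
    then have *: "(t, K) \<in> p" "t \<in> N" by (auto simp: q_def)
    have **: "{Inf K..Sup K} \<subseteq> U" "Inf K \<le> Sup K" "a \<le> Inf K"
      using pb[OF *(1)] pbad[OF *] by simp_all
    have "U \<inter> {Inf K<..Sup K} = {Inf K<..Sup K}" using **(1) by auto
    then have "m (Sup K) - m (Inf K) = measure lebesgue {Inf K<..Sup K}"
      using m_diff[of "Inf K" "Sup K"] ** by simp
    also have "\<dots> = Sup K - Inf K" using **(2) by simp
    finally show "Sup K - Inf K = m (Sup K) - m (Inf K)" by simp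
  qed
  also have "\<dots> \<le> (\<Sum>(t, K)\<in>p. m (Sup K) - m (Inf K))"
    by (rule sum_mono2[OF finp qp]) (use pb m_diff in auto)
  also have "\<dots> = m b - m a" by (rule additive_tagged_division_1[OF \<open>a \<le> b\<close> p(1)])
  also have "\<dots> \<le> measure lebesgue U"
  proof -
    have "m b \<le> measure lebesgue U" unfolding m_def
      by (intro measure_mono_fmeasurable Ulm) auto
    moreover have "m a \<ge> 0" by (auto simp: m_def)
    ultimately show ?thesis by simp
  qed
  also have "\<dots> < \<delta>" by (rule mU)
  finally have len: "(\<Sum>(t, K)\<in>q. Sup K - Inf K) < \<delta>" .
  have "(\<Sum>(l, r)\<in>E ` q. \<bar>g r - g l\<bar>) < e / 2"
  proof (rule \<delta>)
    show "finite (E ` q)" using finq by simp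
    show "\<forall>(l, r)\<in>E ` q. a \<le> l \<and> l \<le> r \<and> r \<le> b"
      using pb qp by (auto simp: E_def)
    show "disjoint_family_on (\<lambda>(l, r). {l<..<r}) (E ` q)"
      unfolding disjoint_family_on_def
    proof (intro ballI impI)
      fix x y assume "x \<in> E ` q" "y \<in> E ` q" "x \<noteq> y"
      then obtain t K t' K' where *: "(t, K) \<in> p" "(t', K') \<in> p" "(t, K) \<noteq> (t', K')"
        "x = (Inf K, Sup K)" "y = (Inf K', Sup K')"
        using qp by (fastforce simp: E_def)
      then show "(case x of (l, r) \<Rightarrow> {l<..<r}) \<inter> (case y of (l, r) \<Rightarrow> {l<..<r}) = {}"
        using disj[OF *(1-3)] *(4,5) by simp
    qed
    show "(\<Sum>(l, r)\<in>E ` q. r - l) < \<delta>"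
      using len by (subst sum.reindex[OF inj]) (simp add: E_def case_prod_unfold)
  qed
  then have "(\<Sum>(t, K)\<in>q. \<bar>g (Sup K) - g (Inf K)\<bar>) < e / 2"
    by (subst (asm) sum.reindex[OF inj]) (simp add: E_def case_prod_unfold)
  moreover have "(\<Sum>(t, K)\<in>q. g (Sup K) - g (Inf K)) \<le> (\<Sum>(t, K)\<in>q. \<bar>g (Sup K) - g (Inf K)\<bar>)"
    by (intro sum_mono) auto
  ultimately have bad: "(\<Sum>(t, K)\<in>q. g (Sup K) - g (Inf K)) \<le> e / 2" by linarith
  have "(\<Sum>(t, K)\<in>p - q. g (Sup K) - g (Inf K)) \<le> (\<Sum>(t, K)\<in>p - q. \<epsilon> * (Sup K - Inf K))"
    by (intro sum_mono) (use pgood in \<open>auto simp: q_def\<close>)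
  also have "\<dots> \<le> (\<Sum>(t, K)\<in>p. \<epsilon> * (Sup K - Inf K))"
    by (intro sum_mono2 finp) (use pb \<open>\<epsilon> > 0\<close> qp in auto)+
  also have "\<dots> = \<epsilon> * (\<Sum>(t, K)\<in>p. Sup K - Inf K)"
    by (simp add: sum_distrib_left case_prod_unfold)
  also have "(\<Sum>(t, K)\<in>p. Sup K - Inf K) = b - a"
    using additive_tagged_division_1[OF \<open>a \<le> b\<close> p(1), of "\<lambda>x. x"] .
  finally have good: "(\<Sum>(t, K)\<in>p - q. g (Sup K) - g (Inf K)) \<le> e / 2" using small by simp
  have "g b - g a = (\<Sum>(t, K)\<in>p. g (Sup K) - g (Inf K))"
    by (rule additive_tagged_division_1[OF \<open>a \<le> b\<close> p(1), symmetric])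
  also have "\<dots> = (\<Sum>(t, K)\<in>p - q. g (Sup K) - g (Inf K)) + (\<Sum>(t, K)\<in>q. g (Sup K) - g (Inf K))"
    by (rule sum.subset_diff[OF qp finp])
  finally show "g b \<le> g a + e" using good bad by simp
qed

text \<open>The content of \<open>Lspace 2\<close> for an arbitrary measure, with a square in place
  of \<open>powr 2\<close>; vanishing outside the domain is tracked separately.\<close>

definition L2_on :: "'a measure \<Rightarrow> ('a \<Rightarrow> real) \<Rightarrow> bool" where
  "L2_on M f \<longleftrightarrow> f \<in> borel_measurable M \<and> integrable M (\<lambda>x. (f x)\<^sup>2)"

definition L2norm :: "'a measure \<Rightarrow> ('a \<Rightarrow> real) \<Rightarrow> real" where
  "L2norm M f = sqrt (LINT x|M. (f x)\<^sup>2)"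

lemma L2_onD [measurable_dest]: "L2_on M f \<Longrightarrow> f \<in> borel_measurable M"
  by (simp add: L2_on_def)

lemma L2_on_integrable_square: "L2_on M f \<Longrightarrow> integrable M (\<lambda>x. (f x)\<^sup>2)"
  by (simp add: L2_on_def)

lemma L2norm_nonneg [simp]: "0 \<le> L2norm M f"
  by (simp add: L2norm_def)

lemma L2norm_square: "(L2norm M f)\<^sup>2 = (LINT x|M. (f x)\<^sup>2)"
  by (simp add: L2norm_def)

lemma L2_on_bound:
  assumes "L2_on M g" "f \<in> borel_measurable M" "AE x in M. \<bar>f x\<bar> \<le> \<bar>g x\<bar>"
  shows "L2_on M f"
  unfolding L2_on_def
  using assms
  by (auto simp: L2_on_def abs_le_square_iff intro!: Bochner_Integration.integrable_bound[of M "\<lambda>x. (g x)\<^sup>2"])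

lemma L2norm_mono:
  assumes "L2_on M g" "f \<in> borel_measurable M" "AE x in M. \<bar>f x\<bar> \<le> \<bar>g x\<bar>"
  shows "L2norm M f \<le> L2norm M g"
  unfolding L2norm_def
  using assms L2_on_bound[OF assms]
  by (auto simp: L2_on_def abs_le_square_iff intro!: integral_mono_AE)

lemma L2_on_mult_integrable:
  assumes "L2_on M f" "L2_on M g"
  shows "integrable M (\<lambda>x. f x * g x)"
proof (rule Bochner_Integration.integrable_bound[of M "\<lambda>x. (f x)\<^sup>2 + (g x)\<^sup>2"])
  show "AE x in M. norm (f x * g x) \<le> norm ((f x)\<^sup>2 + (g x)\<^sup>2)"
  proof (rule AE_I2)
    fix x
    have "0 \<le> (\<bar>f x\<bar> - \<bar>g x\<bar>)\<^sup>2 + \<bar>f x\<bar> * \<bar>g x\<bar>" by simp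
    then have "\<bar>f x\<bar> * \<bar>g x\<bar> \<le> (f x)\<^sup>2 + (g x)\<^sup>2" by (simp add: power2_diff)
    then show "norm (f x * g x) \<le> norm ((f x)\<^sup>2 + (g x)\<^sup>2)" by (simp add: abs_mult)
  qed
qed (use assms in \<open>auto simp: L2_on_def\<close>)

lemma L2_on_add:
  assumes "L2_on M f" "L2_on M g"
  shows "L2_on M (\<lambda>x. f x + g x)"
  unfolding L2_on_def power2_sum
  using assms L2_on_mult_integrable[OF assms] by (auto simp: L2_on_def mult.assoc)

lemma L2_on_cmult: "L2_on M f \<Longrightarrow> L2_on M (\<lambda>x. c * f x)"
  by (auto simp: L2_on_def power_mult_distrib)

lemma L2_on_diff: "L2_on M f \<Longrightarrow> L2_on M g \<Longrightarrow> L2_on M (\<lambda>x. f x - g x)"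
  using L2_on_add[of M f "\<lambda>x. -1 * g x"] L2_on_cmult[of M g "-1"] by simp

text \<open>Reduced to the inequality for nonnegative extended integrals, applied to the absolute
  values.\<close>

lemma Cauchy_Schwarz_integral:
  assumes f: "L2_on M f" and g: "L2_on M g"
  shows "\<bar>LINT x|M. f x * g x\<bar> \<le> L2norm M f * L2norm M g"
proof -
  let ?A = "LINT x|M. (f x)\<^sup>2" and ?B = "LINT x|M. (g x)\<^sup>2" and ?C = "LINT x|M. f x * g x"
  note [measurable] = f[THEN L2_onD] g[THEN L2_onD]
  have nn: "(\<integral>\<^sup>+x. ennreal \<bar>h x\<bar> ^ 2 \<partial>M) = ennreal (LINT x|M. (h x)\<^sup>2)" if "L2_on M h" for h
    using that by (simp add: L2_on_def nn_integral_eq_integral[symmetric] ennreal_power)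
  have "ennreal \<bar>?C\<bar> \<le> ennreal (LINT x|M. \<bar>f x * g x\<bar>)"
    by (intro ennreal_leI integral_abs_bound)
  also have "\<dots> = (\<integral>\<^sup>+x. ennreal \<bar>f x * g x\<bar> \<partial>M)"
    using L2_on_mult_integrable[OF f g] by (intro nn_integral_eq_integral[symmetric]) auto
  also have "\<dots> = (\<integral>\<^sup>+x. ennreal \<bar>f x\<bar> * ennreal \<bar>g x\<bar> \<partial>M)"
    by (simp add: abs_mult ennreal_mult)
  finally have "(ennreal \<bar>?C\<bar>)\<^sup>2 \<le> (\<integral>\<^sup>+x. ennreal \<bar>f x\<bar> * ennreal \<bar>g x\<bar> \<partial>M)\<^sup>2"
    by (intro power_mono) auto
  also have "\<dots> \<le> ennreal ?A * ennreal ?B"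
    using Cauchy_Schwarz_nn_integral[of "\<lambda>x. ennreal \<bar>f x\<bar>" M "\<lambda>x. ennreal \<bar>g x\<bar>"] nn f g by simp
  finally have "?C\<^sup>2 \<le> ?A * ?B"
    by (simp add: ennreal_power ennreal_mult[symmetric])
  then have "\<bar>?C\<bar> \<le> sqrt (?A * ?B)" by (simp add: real_le_rsqrt)
  then show ?thesis by (simp add: L2norm_def real_sqrt_mult)
qed

lemma L2norm_triangle:
  assumes f: "L2_on M f" and g: "L2_on M g"
  shows "L2norm M (\<lambda>x. f x + g x) \<le> L2norm M f + L2norm M g"
proof (rule power2_le_imp_le)
  have "(L2norm M (\<lambda>x. f x + g x))\<^sup>2 = (LINT x|M. (f x)\<^sup>2 + (g x)\<^sup>2 + 2 * (f x * g x))"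
    by (simp add: L2norm_square power2_sum mult.assoc)
  also have "\<dots> = (L2norm M f)\<^sup>2 + (L2norm M g)\<^sup>2 + 2 * (LINT x|M. f x * g x)"
    using assms L2_on_mult_integrable[OF assms] by (simp add: L2norm_square L2_on_def)
  also have "\<dots> \<le> (L2norm M f + L2norm M g)\<^sup>2"
    using Cauchy_Schwarz_integral[OF assms] by (simp add: power2_sum)
  finally show "(L2norm M (\<lambda>x. f x + g x))\<^sup>2 \<le> (L2norm M f + L2norm M g)\<^sup>2" .
qed simp

lemma L2norm_cmult: "L2norm M (\<lambda>x. c * f x) = \<bar>c\<bar> * L2norm M f"
  by (simp add: L2norm_def power_mult_distrib real_sqrt_mult)

lemma L2norm_triangle_diff:
  assumes "L2_on M f" "L2_on M g"
  shows "L2norm M (\<lambda>x. f x - g x) \<le> L2norm M f + L2norm M g"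
  using L2norm_triangle[OF assms(1) L2_on_cmult[OF assms(2), of "-1"]] L2norm_cmult[of M "-1" g] by simp

lemma L2_on_lebesgue_iff_Lspace:
  "f \<in> Lspace 2 \<Omega> \<longleftrightarrow> L2_on lebesgue f \<and> (\<forall>x. x \<notin> \<Omega> \<longrightarrow> f x = 0)"
  by (auto simp: Lspace_def L2_on_def)

lemma Lnorm_2_eq_L2norm: "Lnorm 2 f = L2norm lebesgue f"
  by (simp add: Lnorm_def L2norm_def powr_half_sqrt)

section \<open>Smooth test functions\<close>

lemma Ck_on_Suc_imp_Ck_on: "Ck_on (Suc k) UNIV f \<Longrightarrow> Ck_on k UNIV f"
proof (induction k arbitrary: f)
  case 0
  then show ?case
    by (auto intro!: differentiable_imp_continuous_on simp: differentiable_on_def)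
next
  case (Suc k)
  then show ?case by (metis Ck_on.simps(2))
qed

text \<open>\<open>Ck_on\<close> refers to the derivative picked by
  \<open>frechet_derivative\<close>. Uniqueness of the derivative lets the closure proofs work with
  explicit formulas instead.\<close>

lemma Ck_on_SucI:
  assumes "\<And>x. (f has_derivative f' x) (at x)"
    and "\<And>i. i \<in> Basis \<Longrightarrow> Ck_on k UNIV (\<lambda>x. f' x i)"
  shows "Ck_on (Suc k) UNIV f"
proof -
  have "frechet_derivative f (at x) = f' x" for x
    using frechet_derivative_at[OF assms(1)] by simp
  then show ?thesis using assms by (auto simp: differentiable_def)
qed

lemma Ck_on_Suc_has_derivative:
  "Ck_on (Suc k) UNIV f \<Longrightarrow> (f has_derivative frechet_derivative f (at x)) (at x)"
  by (simp add: frechet_derivative_works)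

lemma Ck_on_const: "Ck_on k UNIV (\<lambda>x. c)"
  by (induction k arbitrary: c) (auto intro: Ck_on_SucI[where f' = "\<lambda>_ _. 0"])

lemma Ck_on_add: "Ck_on k UNIV f \<Longrightarrow> Ck_on k UNIV g \<Longrightarrow> Ck_on k UNIV (\<lambda>x. f x + g x)"
proof (induction k arbitrary: f g)
  case 0
  then show ?case by (auto intro: continuous_intros)
next
  case (Suc k)
  show ?case
  proof (rule Ck_on_SucI)
    show "((\<lambda>x. f x + g x) has_derivative
        (\<lambda>h. frechet_derivative f (at x) h + frechet_derivative g (at x) h)) (at x)" for x
      by (intro has_derivative_add Ck_on_Suc_has_derivative[OF Suc.prems(1)] Ck_on_Suc_has_derivative[OF Suc.prems(2)])
  qed (use Suc in auto)
qed

lemma Ck_on_mult: "Ck_on k UNIV f \<Longrightarrow> Ck_on k UNIV g \<Longrightarrow> Ck_on k UNIV (\<lambda>x. f x * g x)"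
proof (induction k arbitrary: f g)
  case 0
  then show ?case by (auto intro: continuous_intros)
next
  case (Suc k)
  show ?case
  proof (rule Ck_on_SucI)
    show "((\<lambda>x. f x * g x) has_derivative
        (\<lambda>h. f x * frechet_derivative g (at x) h + frechet_derivative f (at x) h * g x)) (at x)" for x
      by (intro has_derivative_mult Ck_on_Suc_has_derivative[OF Suc.prems(1)] Ck_on_Suc_has_derivative[OF Suc.prems(2)])
    \<comment> \<open>The product rule leaves \<open>f\<close> and \<open>g\<close>
      undifferentiated; the induction takes them at the lower order.\<close>
    show "Ck_on k UNIV (\<lambda>x. f x * frechet_derivative g (at x) i + frechet_derivative f (at x) i * g x)"
      if "i \<in> Basis" for i
      using Suc.prems that by (intro Ck_on_add Suc.IH) (auto intro: Ck_on_Suc_imp_Ck_on)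
  qed
qed

text \<open>Induction closes because \<open>q(y) = 1 / sqrt (y^2 + e^2)\<close> satisfies
  \<open>q' = - q^3 y\<close>: the derivative is a polynomial in \<open>q\<close> and
  \<open>y\<close>, so no further functions appear.\<close>

lemma Ck_on_inverse_sqrt:
  assumes "0 < e" and f: "smooth_on UNIV f"
  shows "Ck_on k UNIV (\<lambda>x. inverse (sqrt ((f x)\<^sup>2 + e\<^sup>2)))"
proof (induction k)
  case 0
  have "continuous_on UNIV f" using f by (metis Ck_on.simps(1) smooth_on_def)
  moreover have "sqrt ((f x)\<^sup>2 + e\<^sup>2) \<noteq> 0" for x using \<open>0 < e\<close> by (simp add: sum_power2_eq_zero_iff)
  ultimately show ?case
    by (simp only: Ck_on.simps) (intro continuous_on_inverse continuous_on_real_sqrt continuous_on_add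
        continuous_on_power continuous_on_const ballI)
next
  case (Suc k)
  let ?q = "\<lambda>y. inverse (sqrt (y\<^sup>2 + e\<^sup>2))"
  have pos: "y\<^sup>2 + e\<^sup>2 > 0" for y :: real using \<open>0 < e\<close> by (simp add: add_nonneg_pos)
  have *: "(?q has_real_derivative - 1 * (?q y * ?q y * ?q y * y)) (at y)" for y
  proof -
    have nz: "sqrt (y\<^sup>2 + e\<^sup>2) \<noteq> 0" using \<open>0 < e\<close> by simp
    have "((\<lambda>y. y\<^sup>2 + e\<^sup>2) has_real_derivative 2 * y) (at y)"
      by (auto intro!: derivative_eq_intros)
    from DERIV_chain2[OF DERIV_real_sqrt[OF pos] this]
    have dv: "((\<lambda>y. sqrt (y\<^sup>2 + e\<^sup>2)) has_real_derivative y * ?q y) (at y)"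
      by (rule DERIV_cong) simp
    have "(?q has_real_derivative - (?q y * (y * ?q y) * ?q y)) (at y)"
      by (rule DERIV_inverse'[OF dv nz])
    then show ?thesis by (rule DERIV_cong) (simp only: mult_minus1 mult_ac)
  qed
  have "Ck_on (Suc k) UNIV f" "Ck_on k UNIV f" using f by (auto simp: smooth_on_def)
  show ?case
  proof (rule Ck_on_SucI)
    show "((\<lambda>x. ?q (f x)) has_derivative (\<lambda>h. frechet_derivative f (at x) h *
        (- 1 * (?q (f x) * ?q (f x) * ?q (f x) * f x)))) (at x)" for x
      by (rule DERIV_compose_FDERIV[OF * Ck_on_Suc_has_derivative[OF \<open>Ck_on (Suc k) UNIV f\<close>]])
    show "Ck_on k UNIV (\<lambda>x. frechet_derivative f (at x) i *
        (- 1 * (?q (f x) * ?q (f x) * ?q (f x) * f x)))" if "i \<in> Basis" for i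
      using \<open>Ck_on (Suc k) UNIV f\<close> that
      by (intro Ck_on_mult Ck_on_const Suc.IH \<open>Ck_on k UNIV f\<close>) auto
  qed
qed

lemma smooth_on_const: "smooth_on UNIV (\<lambda>x. c)"
  and smooth_on_add: "smooth_on UNIV f \<Longrightarrow> smooth_on UNIV g \<Longrightarrow> smooth_on UNIV (\<lambda>x. f x + g x)"
  and smooth_on_mult: "smooth_on UNIV f \<Longrightarrow> smooth_on UNIV g \<Longrightarrow> smooth_on UNIV (\<lambda>x. f x * g x)"
  by (auto simp: smooth_on_def intro: Ck_on_const Ck_on_add Ck_on_mult)

text \<open>A smooth version of the positive part, half of \<open>y\<close> plus a smoothed
  \<open>|y|\<close>. Subtracting \<open>e\<close> makes it vanish at 0, so that composition does
  not enlarge supports.\<close>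

definition soft_pos :: "real \<Rightarrow> real \<Rightarrow> real" where
  "soft_pos e y = (y + sqrt (y\<^sup>2 + e\<^sup>2) - e) / 2"

lemma soft_pos_0 [simp]: "0 \<le> e \<Longrightarrow> soft_pos e 0 = 0"
  by (simp add: soft_pos_def)

text \<open>\<open>sqrt (y^2 + e^2)\<close> is the Euclidean norm of \<open>(y, e)\<close>, hence
  1-Lipschitz in \<open>y\<close>, and its average with \<open>y\<close> is so too. The constant is
  uniform in \<open>e\<close>, which is what controls the energy of the approximations.\<close>

lemma soft_pos_lipschitz: "\<bar>soft_pos e y - soft_pos e z\<bar> \<le> \<bar>y - z\<bar>"
proof -
  have "sqrt (y\<^sup>2 + e\<^sup>2) \<le> sqrt (z\<^sup>2 + e\<^sup>2) + \<bar>y - z\<bar>" for y z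
    using real_sqrt_sum_squares_triangle_ineq[of z "y - z" e 0] by simp
  from this[of y z] this[of z y] show ?thesis
    unfolding soft_pos_def abs_le_iff by (simp add: field_simps abs_if split: if_splits)
qed

text \<open>The error is \<open>(q - |y| - e) / 2\<close> with \<open>q\<close> the square root, and
  \<open>q\<close> lies between \<open>|y|\<close> and \<open>|y| + e\<close>.\<close>

lemma soft_pos_approx:
  assumes "0 \<le> e"
  shows "\<bar>soft_pos e y - max y 0\<bar> \<le> e"
proof -
  define q where "q = sqrt (y\<^sup>2 + e\<^sup>2)"
  have "\<bar>y\<bar> \<le> q" by (simp add: q_def)
  moreover have "q \<le> \<bar>y\<bar> + e"
    using real_sqrt_sum_squares_triangle_ineq[of y 0 0 e] assms by (simp add: q_def)
  ultimately show ?thesis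
    using assms unfolding soft_pos_def q_def[symmetric] max_def abs_le_iff by (simp add: field_simps) linarith
qed

lemma smooth_on_soft_pos:
  assumes "0 < e" "smooth_on UNIV f"
  shows "smooth_on UNIV (\<lambda>x. soft_pos e (f x))"
proof -
  \<comment> \<open>Writing the root as its square times its inverse reduces smoothness to closure
    under sums and products.\<close>
  have "((f x)\<^sup>2 + e\<^sup>2) * inverse (sqrt ((f x)\<^sup>2 + e\<^sup>2)) = sqrt ((f x)\<^sup>2 + e\<^sup>2)" for x
    using assms(1) by (simp add: divide_inverse[symmetric] real_div_sqrt)
  then have "soft_pos e (f x) = (1 / 2) * (f x + (f x * f x + e\<^sup>2) * inverse (sqrt ((f x)\<^sup>2 + e\<^sup>2)) + - e)" for x
    by (simp add: soft_pos_def power2_eq_square)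
  moreover have "smooth_on UNIV (\<lambda>x. inverse (sqrt ((f x)\<^sup>2 + e\<^sup>2)))"
    using Ck_on_inverse_sqrt[OF assms] by (simp add: smooth_on_def)
  ultimately show ?thesis
    by (simp only:) (intro smooth_on_mult smooth_on_add smooth_on_const assms)
qed

section \<open>Algebra and uniform bounds of test functions\<close>

lemma test_functions_subset_support:
  assumes "smooth_on UNIV f" "compact K" "K \<subseteq> \<Omega>" "{x. f x \<noteq> 0} \<subseteq> K"
  shows "f \<in> test_functions \<Omega>"
proof -
  have "closure {x. f x \<noteq> 0} \<subseteq> K"
    using assms by (intro closure_minimal compact_imp_closed)
  moreover have "compact (closure {x. f x \<noteq> 0})"
    using calculation assms(2) by (meson compact_imp_bounded bounded_subset compact_closure closure_subset)
  ultimately show ?thesis using assms by (auto simp: test_functions_def)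
qed

lemma test_functions_add:
  assumes "f \<in> test_functions \<Omega>" "g \<in> test_functions \<Omega>"
  shows "(\<lambda>x. f x + g x) \<in> test_functions \<Omega>"
proof (rule test_functions_subset_support)
  show "{x. f x + g x \<noteq> 0} \<subseteq> closure {x. f x \<noteq> 0} \<union> closure {x. g x \<noteq> 0}"
  proof
    fix x assume "x \<in> {x. f x + g x \<noteq> 0}"
    then have "f x \<noteq> 0 \<or> g x \<noteq> 0" by auto
    then show "x \<in> closure {x. f x \<noteq> 0} \<union> closure {x. g x \<noteq> 0}"
      using closure_subset[of "{x. f x \<noteq> 0}"] closure_subset[of "{x. g x \<noteq> 0}"] by blast
  qed
qed (use assms in \<open>auto simp: test_functions_def intro: smooth_on_add\<close>)

lemma test_functions_cmult:
  assumes "f \<in> test_functions \<Omega>"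
  shows "(\<lambda>x. c * f x) \<in> test_functions \<Omega>"
  using assms closure_subset[of "{x. f x \<noteq> 0}"]
  by (intro test_functions_subset_support[of _ "closure {x. f x \<noteq> 0}"]
      smooth_on_mult smooth_on_const) (auto simp: test_functions_def)

lemma test_functions_soft_pos:
  assumes "f \<in> test_functions \<Omega>" "0 < e"
  shows "(\<lambda>x. soft_pos e (f x)) \<in> test_functions \<Omega>"
  using assms closure_subset[of "{x. f x \<noteq> 0}"]
  by (intro test_functions_subset_support[of _ "closure {x. f x \<noteq> 0}"] smooth_on_soft_pos)
    (auto simp: test_functions_def)

lemma test_functions_continuous: "f \<in> test_functions \<Omega> \<Longrightarrow> continuous_on UNIV f"
  by (metis (mono_tags, lifting) Ck_on.simps(1) mem_Collect_eq smooth_on_def test_functions_def)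

lemma continuous_compact_support_bounded:
  fixes f :: "'a::euclidean_space \<Rightarrow> real"
  assumes "continuous_on UNIV f" "compact K" "\<And>x. x \<notin> K \<Longrightarrow> f x = 0"
  obtains M where "0 \<le> M" "\<And>x. \<bar>f x\<bar> \<le> M"
proof -
  have "compact (f ` K)"
    using assms by (intro compact_continuous_image) (auto intro: continuous_on_subset)
  then obtain M where M: "\<And>y. y \<in> f ` K \<Longrightarrow> norm y \<le> M"
    using compact_imp_bounded bounded_iff by metis
  have "\<bar>f x\<bar> \<le> max M 0" for x
    using M[of "f x"] assms(3)[of x] by (cases "x \<in> K") auto
  then show ?thesis using that[of "max M 0"] by simp
qed

lemma test_functions_bounded:
  assumes "f \<in> test_functions \<Omega>"
  obtains M where "0 \<le> M" "\<And>x. \<bar>f x\<bar> \<le> M"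
proof (rule continuous_compact_support_bounded[of f "closure {x. f x \<noteq> 0}"])
  show "f x = 0" if "x \<notin> closure {x. f x \<noteq> 0}" for x
    using that closure_subset[of "{x. f x \<noteq> 0}"] by auto
qed (use assms test_functions_continuous that in \<open>auto simp: test_functions_def\<close>)

text \<open>The partial derivatives are continuous and vanish off the compact support, so they are
  bounded. Their bounds add up to a bound for the operator norm, and the mean value inequality
  applies.\<close>

lemma test_functions_lipschitz:
  fixes f :: "'a::euclidean_space \<Rightarrow> real"
  assumes "f \<in> test_functions \<Omega>"
  obtains L where "0 \<le> L" "\<And>x y. \<bar>f x - f y\<bar> \<le> L * norm (x - y)"
proof -
  let ?K = "closure {x. f x \<noteq> 0}"
  have C1: "Ck_on (Suc 0) UNIV f" and K: "compact ?K"
    using assms by (auto simp: test_functions_def smooth_on_def simp del: Ck_on.simps)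
  have diff: "f differentiable (at x)" for x using C1 by simp
  have "\<exists>M\<ge>0. \<forall>x. \<bar>frechet_derivative f (at x) i\<bar> \<le> M" if i: "i \<in> Basis" for i
  proof (rule continuous_compact_support_bounded[of "\<lambda>x. frechet_derivative f (at x) i" ?K])
    show "continuous_on UNIV (\<lambda>x. frechet_derivative f (at x) i)" using C1 i by simp
    show "frechet_derivative f (at x) i = 0" if x: "x \<notin> ?K" for x
    proof -
      have "f y = 0" if "y \<in> - ?K" for y
        using that closure_subset[of "{x. f x \<noteq> 0}"] by auto
      then have "frechet_derivative f (at x) = frechet_derivative (\<lambda>y. 0) (at x)"
        using x diff by (intro frechet_derivative_transform_within_open[of f x "- ?K"]) (simp_all only: Compl_iff open_Compl closed_closure not_False_eq_True)
      then show ?thesis by simp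
    qed
  qed (use K in auto)
  then obtain M where M: "\<And>i. i \<in> Basis \<Longrightarrow> 0 \<le> M i"
    "\<And>i x. i \<in> Basis \<Longrightarrow> \<bar>frechet_derivative f (at x) i\<bar> \<le> M i" by metis
  define L where "L = (\<Sum>i\<in>Basis. M i)"
  have "norm (frechet_derivative f (at x) h) \<le> L * norm h" for x h
  proof -
    interpret linear "frechet_derivative f (at x)"
      using C1 by (intro linear_frechet_derivative) auto
    have "frechet_derivative f (at x) h = frechet_derivative f (at x) (\<Sum>i\<in>Basis. (h \<bullet> i) *\<^sub>R i)"
      by (simp add: euclidean_representation)
    also have "\<dots> = (\<Sum>i\<in>Basis. (h \<bullet> i) * frechet_derivative f (at x) i)"
      by (simp add: sum scale)
    also have "norm \<dots> \<le> (\<Sum>i\<in>Basis. norm h * M i)"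
      by (rule order.trans[OF norm_sum sum_mono])
        (auto simp: abs_mult intro!: mult_mono M Basis_le_norm)
    finally show ?thesis by (simp add: L_def sum_distrib_left mult.commute)
  qed
  then have "onorm (frechet_derivative f (at x)) \<le> L" for x by (intro onorm_le)
  then have "norm (f x - f y) \<le> L * norm (x - y)" for x y
    by (intro differentiable_bound[of UNIV f "\<lambda>x. frechet_derivative f (at x)"]
        Ck_on_Suc_has_derivative[OF C1]) auto
  moreover have "0 \<le> L" unfolding L_def by (intro sum_nonneg M)
  ultimately show ?thesis using that[of L] by simp
qed

text \<open>Takes the place of integration in polar coordinates. One ball per point, with a bound
  valid at that point, is enough, since the other terms of the dominating series are
  nonnegative.\<close>

lemma nn_integral_dyadic_finite:
  fixes f :: "'a::euclidean_space \<Rightarrow> ennreal"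
  assumes cover: "\<And>z. f z \<noteq> 0 \<Longrightarrow> \<exists>k::nat. z \<in> ball 0 (r k) \<and> f z \<le> ennreal (c k)"
    and nonneg: "\<And>k. 0 \<le> c k" "\<And>k. 0 \<le> r k"
    and sums: "summable (\<lambda>k. c k * r k ^ DIM('a))"
  shows "(\<integral>\<^sup>+z. f z \<partial>lborel) < \<infinity>"
proof -
  have "f z \<le> (\<Sum>k. ennreal (c k) * indicator (ball 0 (r k)) z)" for z
  proof (cases "f z = 0")
    case False
    then obtain k where k: "z \<in> ball 0 (r k)" "f z \<le> ennreal (c k)" using cover by blast
    then have "f z \<le> ennreal (c k) * indicator (ball 0 (r k)) z" by simp
    also have "\<dots> \<le> (\<Sum>k. ennreal (c k) * indicator (ball 0 (r k)) z)"
      using sum_le_suminf[of "\<lambda>k. ennreal (c k) * indicator (ball 0 (r k)) z" "{k}"]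
      by (simp only: sum.insert sum.empty finite.intros empty_iff not_False_eq_True add_0_right summableI zero_le simp_thms UNIV_I)
    finally show ?thesis .
  qed simp
  then have "(\<integral>\<^sup>+z. f z \<partial>lborel) \<le> (\<integral>\<^sup>+z. (\<Sum>k. ennreal (c k) * indicator (ball (0::'a) (r k)) z) \<partial>lborel)"
    by (intro nn_integral_mono)
  also have "\<dots> = (\<Sum>k. ennreal (c k) * emeasure lborel (ball (0::'a) (r k)))"
    by (subst nn_integral_suminf) (auto simp: nn_integral_cmult_indicator intro!: borel_measurable_times_ennreal borel_measurable_indicator)
  also have "\<dots> = (\<Sum>k. ennreal (unit_ball_vol DIM('a) * (c k * r k ^ DIM('a))))"
    using nonneg by (simp add: emeasure_ball ennreal_mult[symmetric] mult_ac)
  also have "\<dots> = ennreal (\<Sum>k. unit_ball_vol DIM('a) * (c k * r k ^ DIM('a)))"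
    using nonneg sums by (intro suminf_ennreal2 mult_nonneg_nonneg summable_mult) auto
  finally show ?thesis by (auto intro: order.strict_trans1)
qed

section \<open>Finiteness of the Gagliardo energy of test functions\<close>

text \<open>Far out the kernel is \<open>|z|^(-n-\<sigma>)\<close>, integrable because
  \<open>\<sigma> > 0\<close>; near 0 it is \<open>|z|^(p-n-\<sigma>)\<close>, integrable because
  \<open>\<sigma> < p\<close>. With \<open>\<sigma> = s p\<close> these are the conditions
  \<open>s > 0\<close> and \<open>s < 1\<close>.\<close>

lemma gagliardo_kernel_finite:
  fixes p \<sigma> :: real
  assumes "0 < \<sigma>" "\<sigma> < p"
  shows "(\<integral>\<^sup>+z. ennreal (min (norm z powr p) 1 / norm (z::'a::euclidean_space) powr (real DIM('a) + \<sigma>)) \<partial>lborel) < \<infinity>"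
proof -
  let ?n = "real DIM('a)"
  let ?k = "\<lambda>z::'a. min (norm z powr p) 1 / norm z powr (?n + \<sigma>)"
  have n: "?n > 0" by simp
  have dyadic: "\<exists>k::nat. (2::real) powr k \<le> t \<and> t < 2 powr (k + 1)" if "1 \<le> t" for t :: real
  proof -
    define k where "k = nat \<lfloor>log 2 t\<rfloor>"
    have "0 \<le> log 2 t" using that by simp
    then have "real k \<le> log 2 t" "log 2 t < real k + 1" unfolding k_def by linarith+
    then show ?thesis using that by (intro exI[of _ k]) (simp add: le_log_iff log_less_iff)
  qed
  have outer: "(\<integral>\<^sup>+z. ennreal (?k z) * indicator {z. 1 \<le> norm z} z \<partial>lborel) < \<infinity>"
  proof (rule nn_integral_dyadic_finite)
    \<comment> \<open>On the shell \<open>2^k \<le> |z| < 2^(k+1)\<close> the kernel is at most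
      \<open>?c k\<close>; the terms of the series form a geometric progression of ratio
      \<open>2^(-\<sigma>)\<close>.\<close>
    let ?r = "\<lambda>k::nat. (2::real) powr (real k + 1)" and ?c = "\<lambda>k::nat. (2::real) powr (- real k * (?n + \<sigma>))"
    show "\<exists>k::nat. z \<in> ball 0 (?r k) \<and> ennreal (?k z) * indicator {z. 1 \<le> norm z} z \<le> ennreal (?c k)"
      if nz: "ennreal (?k z) * indicator {z. 1 \<le> norm z} z \<noteq> 0" for z :: 'a
    proof -
      have True: "1 \<le> norm z" using nz by (auto simp: indicator_def split: if_splits)
      then obtain k :: nat where k: "2 powr k \<le> norm z" "norm z < 2 powr (real k + 1)"
        using dyadic[of "norm z"] by (auto simp: add.commute)
      have "(2 powr k) powr (?n + \<sigma>) \<le> norm z powr (?n + \<sigma>)"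
        using k(1) n assms by (intro powr_mono2) auto
      then have "?k z \<le> 1 / (2 powr k) powr (?n + \<sigma>)"
        using True by (intro frac_le) auto
      also have "\<dots> = ?c k" by (simp add: powr_powr powr_minus_divide)
      finally show ?thesis using k(2) True by (intro exI[of _ k]) (auto simp: ennreal_leI)
    qed
    have "?c k * ?r k ^ DIM('a) = 2 powr ?n * (2 powr - \<sigma>) ^ k" for k
      by (simp add: powr_powr powr_add[symmetric] powr_realpow[symmetric] algebra_simps)
    moreover have "2 powr - \<sigma> < (1::real)" using assms by (simp add: powr_less_one)
    ultimately show "summable (\<lambda>k. ?c k * ?r k ^ DIM('a))"
      by (simp add: summable_mult summable_geometric)
  qed auto
  have inner: "(\<integral>\<^sup>+z. ennreal (?k z) * indicator {z. norm z < 1} z \<partial>lborel) < \<infinity>"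
  proof (rule nn_integral_dyadic_finite)
    \<comment> \<open>Here \<open>2^(-k-1) < |z| \<le> 2^(-k)\<close>. The radius is doubled because
      the ball is open while the upper bound is not strict. The ratio of the series is
      \<open>2^(-(p-\<sigma>))\<close>.\<close>
    let ?r = "\<lambda>k::nat. (2::real) powr (1 - real k)"
    let ?c = "\<lambda>k::nat. (2::real) powr (?n + \<sigma> + p - real k * (p - \<sigma> - ?n))"
    show "\<exists>k::nat. z \<in> ball 0 (?r k) \<and> ennreal (?k z) * indicator {z. norm z < 1} z \<le> ennreal (?c k)"
      if nz: "ennreal (?k z) * indicator {z. norm z < 1} z \<noteq> 0" for z :: 'a
    proof -
      have True: "norm z < 1 \<and> z \<noteq> 0" using nz by (auto simp: indicator_def split: if_splits)
      then have "norm z > 0" "1 \<le> 1 / norm z" by auto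
      then obtain k :: nat where k: "2 powr k \<le> 1 / norm z" "1 / norm z < 2 powr (real k + 1)"
        using dyadic[of "1 / norm z"] by (auto simp: add.commute)
      have up: "norm z \<le> 2 powr (- real k)"
        using k(1) True by (simp add: powr_minus_divide field_simps)
      have low: "2 powr (- real k - 1) \<le> norm z"
        using k(2) True by (simp add: powr_minus_divide powr_diff powr_add field_simps)
      have "?k z \<le> (2 powr (- real k)) powr p / (2 powr (- real k - 1)) powr (?n + \<sigma>)"
        using up low n assms True by (intro frac_le) (auto intro!: powr_mono2 min.coboundedI1)
      also have "\<dots> = 2 powr (?n + \<sigma> - real k * (p - \<sigma> - ?n))"
        by (simp add: powr_powr powr_diff[symmetric] algebra_simps)
      also have "\<dots> \<le> ?c k" using assms by simp
      finally have "?k z \<le> ?c k" .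
      moreover have "2 powr (- real k) < 2 powr (1 - real k)" by simp
      then have "norm z < 2 powr (1 - real k)" using up by linarith
      ultimately show ?thesis using True by (intro exI[of _ k]) (auto simp: ennreal_leI)
    qed
    have "?c k * ?r k ^ DIM('a) = 2 powr (2 * ?n + \<sigma> + p) * (2 powr - (p - \<sigma>)) ^ k" for k
      by (simp add: powr_powr powr_add[symmetric] powr_realpow[symmetric] algebra_simps)
    moreover have "2 powr - (p - \<sigma>) < (1::real)" using assms by (simp add: powr_less_one)
    ultimately show "summable (\<lambda>k. ?c k * ?r k ^ DIM('a))"
      by (simp add: summable_mult summable_geometric)
  qed auto
  have "(\<integral>\<^sup>+z. ennreal (?k z) \<partial>lborel) = (\<integral>\<^sup>+z. ennreal (?k z) * indicator {z. 1 \<le> norm z} z +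
      ennreal (?k z) * indicator {z. norm z < 1} z \<partial>lborel)"
    by (intro nn_integral_cong) (auto simp: indicator_def)
  also have "\<dots> = (\<integral>\<^sup>+z. ennreal (?k z) * indicator {z. 1 \<le> norm z} z \<partial>lborel) +
      (\<integral>\<^sup>+z. ennreal (?k z) * indicator {z. norm z < 1} z \<partial>lborel)"
    by (intro nn_integral_add) measurable
  also have "\<dots> < \<infinity>" using outer inner by simp
  finally show ?thesis .
qed

lemma nn_integral_lborel_shift:
  fixes f :: "'a::euclidean_space \<Rightarrow> ennreal"
  assumes [measurable]: "f \<in> borel_measurable borel"
  shows "(\<integral>\<^sup>+y. f (y - x) \<partial>lborel) = (\<integral>\<^sup>+z. f z \<partial>lborel)"
proof -
  have "(\<integral>\<^sup>+z. f z \<partial>lborel) = (\<integral>\<^sup>+z. f z \<partial>distr lborel borel ((+) (- x)))"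
    by (simp add: lborel_distr_plus)
  also have "\<dots> = (\<integral>\<^sup>+y. f (- x + y) \<partial>lborel)" by (intro nn_integral_distr) auto
  finally show ?thesis by simp
qed

text \<open>The increment of \<open>f\<close> is at most a constant times
  \<open>min |x - y| 1\<close>, by the Lipschitz bound and by boundedness, and it vanishes unless
  one of the points lies in the support \<open>K\<close>. Fubini leaves the measure of
  \<open>K\<close> times the integral of the kernel, twice.\<close>

lemma test_functions_J_finite:
  fixes f :: "'a::euclidean_space \<Rightarrow> real"
  assumes f: "f \<in> test_functions \<Omega>" and ps: "0 < s" "s < 1" "0 < p"
  shows "J_energy p s f < \<infinity>"
proof -
  define k where "k z = min (norm z powr p) 1 / norm z powr (real DIM('a) + s * p)" for z :: 'a
  have [measurable]: "k \<in> borel_measurable borel" unfolding k_def by measurable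
  define I where "I = (\<integral>\<^sup>+z. ennreal (k z) \<partial>lborel)"
  have I: "I < \<infinity>" unfolding I_def k_def
    using ps by (intro gagliardo_kernel_finite) auto
  have k0: "0 \<le> k z" for z by (simp add: k_def)
  have ksym: "k (x - y) = k (y - x)" for x y by (simp add: k_def norm_minus_commute)
  define K where "K = closure {x. f x \<noteq> 0}"
  have K: "compact K" "\<And>x. x \<notin> K \<Longrightarrow> f x = 0"
    using f closure_subset[of "{x. f x \<noteq> 0}"] by (auto simp: K_def test_functions_def)
  have [measurable]: "K \<in> sets borel" using K(1) by (simp add: compact_imp_closed borel_closed)
  obtain M where M: "0 \<le> M" "\<And>x. \<bar>f x\<bar> \<le> M" by (rule test_functions_bounded[OF f]) blast
  obtain L where L: "0 \<le> L" "\<And>x y. \<bar>f x - f y\<bar> \<le> L * norm (x - y)" by (rule test_functions_lipschitz[OF f]) blast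
  define C where "C = max L (2 * M) powr p"
  have "0 \<le> C" by (simp add: C_def)
  have bound: "ennreal (\<bar>f x - f y\<bar> powr p / norm (x - y) powr (real DIM('a) + s * p)) \<le>
      ennreal C * (indicator K x * ennreal (k (x - y))) + ennreal C * (indicator K y * ennreal (k (x - y)))" for x y
  proof (cases "x \<in> K \<or> y \<in> K")
    case True
    have "\<bar>f x - f y\<bar> \<le> max L (2 * M) * min (norm (x - y)) 1"
    proof -
      have "\<bar>f x - f y\<bar> \<le> max L (2 * M) * norm (x - y)"
        by (rule order.trans[OF L(2)]) (intro mult_right_mono, auto)
      moreover have "\<bar>f x - f y\<bar> \<le> max L (2 * M) * 1" using M(2)[of x] M(2)[of y] by (auto simp: abs_le_iff)
      ultimately show ?thesis by (simp add: min_def)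
    qed
    then have "\<bar>f x - f y\<bar> powr p \<le> (max L (2 * M) * min (norm (x - y)) 1) powr p"
      using ps by (intro powr_mono2) auto
    also have "\<dots> = C * min (norm (x - y)) 1 powr p"
      using L(1) by (simp add: C_def powr_mult)
    also have "min (norm (x - y)) 1 powr p = min (norm (x - y) powr p) 1"
    proof (cases "norm (x - y) \<le> 1")
      case True
      then show ?thesis using ps by (simp add: powr_le1)
    next
      case False
      then have "1 powr p < norm (x - y) powr p" using ps by (intro powr_less_mono2) auto
      with False show ?thesis by simp
    qed
    finally have "\<bar>f x - f y\<bar> powr p / norm (x - y) powr (real DIM('a) + s * p) \<le> C * k (x - y)"
      by (simp add: k_def divide_right_mono)
    then have "ennreal (\<bar>f x - f y\<bar> powr p / norm (x - y) powr (real DIM('a) + s * p)) \<le> ennreal C * ennreal (k (x - y))"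
      using \<open>0 \<le> C\<close> k0 by (simp add: ennreal_mult[symmetric] ennreal_leI)
    also have "\<dots> \<le> ennreal C * (indicator K x * ennreal (k (x - y))) + ennreal C * (indicator K y * ennreal (k (x - y)))"
      using True by (auto simp: indicator_def)
    finally show ?thesis .
  qed (simp add: K)
  have inner: "(\<integral>\<^sup>+y. ennreal (k (x - y)) \<partial>lborel) = I" for x
    unfolding I_def ksym[of x] by (rule nn_integral_lborel_shift) measurable
  have inner': "(\<integral>\<^sup>+x. ennreal (k (x - y)) \<partial>lborel) = I" for y
    unfolding I_def by (rule nn_integral_lborel_shift) measurable
  have "(\<integral>\<^sup>+ x. \<integral>\<^sup>+ y. ennreal (\<bar>f x - f y\<bar> powr p / norm (x - y) powr (real DIM('a) + s * p)) \<partial>lebesgue \<partial>lebesgue)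
     \<le> (\<integral>\<^sup>+ x. \<integral>\<^sup>+ y. ennreal C * (indicator K x * ennreal (k (x - y))) +
         ennreal C * (indicator K y * ennreal (k (x - y))) \<partial>lborel \<partial>lborel)"
    \<comment> \<open>Nonnegative integrals over a measure and over its completion agree; on
      \<open>lborel\<close> the Borel kernel can be treated by Fubini and translation.\<close>
    unfolding nn_integral_completion by (intro nn_integral_mono bound)
  also have "\<dots> = (\<integral>\<^sup>+ x. (\<integral>\<^sup>+ y. ennreal C * (indicator K x * ennreal (k (x - y))) \<partial>lborel) +
         (\<integral>\<^sup>+ y. ennreal C * (indicator K y * ennreal (k (x - y))) \<partial>lborel) \<partial>lborel)"
    by (intro nn_integral_cong nn_integral_add) measurable
  also have "\<dots> = (\<integral>\<^sup>+ x. (\<integral>\<^sup>+ y. ennreal C * (indicator K x * ennreal (k (x - y))) \<partial>lborel) \<partial>lborel) +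
         (\<integral>\<^sup>+ x. (\<integral>\<^sup>+ y. ennreal C * (indicator K y * ennreal (k (x - y))) \<partial>lborel) \<partial>lborel)"
    by (intro nn_integral_add) measurable
  also have "(\<integral>\<^sup>+ x. (\<integral>\<^sup>+ y. ennreal C * (indicator K y * ennreal (k (x - y))) \<partial>lborel) \<partial>lborel) =
      (\<integral>\<^sup>+ y. (\<integral>\<^sup>+ x. ennreal C * (indicator K y * ennreal (k (x - y))) \<partial>lborel) \<partial>lborel)"
    by (intro lborel_pair.Fubini') measurable
  also have "\<dots> = ennreal C * (emeasure lborel K * I)"
    by (simp add: nn_integral_cmult inner' nn_integral_multc)
  also have "(\<integral>\<^sup>+ x. (\<integral>\<^sup>+ y. ennreal C * (indicator K x * ennreal (k (x - y))) \<partial>lborel) \<partial>lborel) =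
      ennreal C * (emeasure lborel K * I)"
    by (simp add: nn_integral_cmult inner nn_integral_multc)
  also have "ennreal C * (emeasure lborel K * I) + ennreal C * (emeasure lborel K * I) < \<infinity>"
    using I emeasure_bounded_finite[OF compact_imp_bounded[OF K(1)]] by (simp add: ennreal_mult_less_top)
  finally show ?thesis unfolding J_energy_def by (simp add: ennreal_mult_less_top)
qed

section \<open>The Sobolev space and the form of the operator\<close>

text \<open>The form is an integral over the product of two copies of \<open>lebesgue\<close>, so
  Fubini needs sigma-finiteness of the completed measure. A cover for \<open>lborel\<close> carries
  over, as the measures agree on Borel sets.\<close>

lemma sigma_finite_lebesgue: "sigma_finite_measure (lebesgue :: 'a::euclidean_space measure)"
proof
  obtain A :: "'a set set" where A: "countable A" "A \<subseteq> sets lborel" "\<Union>A = space lborel"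
    "\<forall>a\<in>A. emeasure lborel a \<noteq> \<infinity>"
    using sigma_finite_lborel unfolding sigma_finite_measure_def by metis
  have "emeasure lebesgue a \<noteq> \<infinity>" if "a \<in> A" for a
    using A(2,4) that by (auto simp: subset_eq)
  then show "\<exists>A::'a set set. countable A \<and> A \<subseteq> sets lebesgue \<and> \<Union>A = space lebesgue \<and>
      (\<forall>a\<in>A. emeasure lebesgue a \<noteq> \<infinity>)"
    using A by (intro exI[of _ A]) (auto simp del: emeasure_completion)
qed

interpretation lebesgue_pair: pair_sigma_finite
  "lebesgue :: 'a::euclidean_space measure" "lebesgue :: 'a::euclidean_space measure"
  by (intro pair_sigma_finite.intro sigma_finite_lebesgue)

text \<open>Turns convergence almost everywhere of functions into convergence almost everywhere of
  their increments on pairs of points.\<close>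

lemma AE_lebesgue_pairI:
  assumes "AE x in lebesgue. P x"
  shows "AE z in lebesgue \<Otimes>\<^sub>M lebesgue. P (fst z) \<and> P (snd (z :: 'a::euclidean_space \<times> 'a))"
proof -
  obtain N where N: "{x. \<not> P x} \<subseteq> N" "N \<in> null_sets lebesgue"
    using assms unfolding eventually_ae_filter by auto
  have "N \<times> UNIV \<in> null_sets (lebesgue \<Otimes>\<^sub>M lebesgue)" "UNIV \<times> N \<in> null_sets (lebesgue \<Otimes>\<^sub>M lebesgue)"
    by (rule lebesgue_pair.M1.times_in_null_sets1[OF N(2)], simp)
      (rule lebesgue_pair.M1.times_in_null_sets2[OF _ N(2)], simp)
  then have "N \<times> UNIV \<union> UNIV \<times> N \<in> null_sets (lebesgue \<Otimes>\<^sub>M lebesgue)" by (rule null_sets.Un)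
  then show ?thesis by (rule AE_I') (use N(1) in auto)
qed

definition gagliardo :: "real \<Rightarrow> real \<Rightarrow> ('a::euclidean_space \<Rightarrow> real) \<Rightarrow> 'a \<times> 'a \<Rightarrow> real" where
  "gagliardo p s u z =
     \<bar>u (fst z) - u (snd z)\<bar> powr p / norm (fst z - snd z) powr (real DIM('a) + s * p)"

lemma gagliardo_nonneg: "0 \<le> gagliardo p s u z"
  by (simp add: gagliardo_def)

lemma id_measurable_lebesgue_borel [measurable]: "(\<lambda>x. x) \<in> lebesgue \<rightarrow>\<^sub>M borel"
  by (rule measurable_completion) simp

lemma norm_diff_measurable_lebesgue_pair [measurable]:
  "(\<lambda>z. norm (fst z - snd z)) \<in> borel_measurable (lebesgue \<Otimes>\<^sub>M (lebesgue :: 'a::euclidean_space measure))"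
proof -
  have f: "fst \<in> lebesgue \<Otimes>\<^sub>M (lebesgue :: 'a measure) \<rightarrow>\<^sub>M (borel :: 'a measure)"
    using measurable_compose[OF measurable_fst id_measurable_lebesgue_borel] .
  have g: "snd \<in> (lebesgue :: 'a measure) \<Otimes>\<^sub>M lebesgue \<rightarrow>\<^sub>M (borel :: 'a measure)"
    using measurable_compose[OF measurable_snd id_measurable_lebesgue_borel] .
  show ?thesis
    by (rule measurable_compose[OF borel_measurable_diff[OF f g] borel_measurable_norm])
qed

lemma gagliardo_measurable [measurable]:
  assumes [measurable]: "u \<in> borel_measurable lebesgue"
  shows "gagliardo p s u \<in> borel_measurable (lebesgue \<Otimes>\<^sub>M lebesgue)"
  unfolding gagliardo_def[abs_def] by measurable

text \<open>The energy is an iterated integral, the form a product integral; on the product a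
  convergence theorem has to be applied only once.\<close>

lemma J_energy_eq_pair:
  assumes [measurable]: "u \<in> borel_measurable lebesgue"
  shows "J_energy p s u = ennreal (1 / p) * (\<integral>\<^sup>+z. ennreal (gagliardo p s u z) \<partial>(lebesgue \<Otimes>\<^sub>M lebesgue))"
proof -
  have "(\<lambda>z. ennreal (gagliardo p s u z)) \<in> borel_measurable (lebesgue \<Otimes>\<^sub>M lebesgue)" by measurable
  from sigma_finite_measure.nn_integral_fst[OF sigma_finite_lebesgue this] show ?thesis
    by (simp add: J_energy_def gagliardo_def)
qed

text \<open>\<open>c\<close> stands for any quantity controlled by \<open>a\<close> and
  \<open>b\<close>, not only their sum, so that truncations are covered. The constant comes from
  \<open>|a| + |b| \<le> 2 * max |a| |b|\<close>.\<close>

lemma abs_add_powr_le: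
  fixes a b p :: real
  assumes "0 \<le> p" "\<bar>c\<bar> \<le> \<bar>a\<bar> + \<bar>b\<bar>"
  shows "\<bar>c\<bar> powr p \<le> 2 powr p * (\<bar>a\<bar> powr p + \<bar>b\<bar> powr p)"
proof -
  have "\<bar>c\<bar> powr p \<le> (2 * max \<bar>a\<bar> \<bar>b\<bar>) powr p" using assms by (intro powr_mono2) auto
  also have "\<dots> = 2 powr p * max \<bar>a\<bar> \<bar>b\<bar> powr p" by (simp add: powr_mult)
  also have "\<dots> \<le> 2 powr p * (\<bar>a\<bar> powr p + \<bar>b\<bar> powr p)"
    by (intro mult_left_mono) (auto simp: max_def)
  finally show ?thesis .
qed

lemma gagliardo_le_add:
  assumes "0 \<le> p" "\<And>x y. \<bar>w x - w y\<bar> \<le> \<bar>u x - u y\<bar> + \<bar>v x - v y\<bar>"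
  shows "gagliardo p s w z \<le> 2 powr p * (gagliardo p s u z + gagliardo p s v z)"
  using divide_right_mono[OF abs_add_powr_le[OF assms(1) assms(2)[of "fst z" "snd z"]]]
  by (simp add: gagliardo_def add_divide_distrib[symmetric])

text \<open>A triangle inequality for the \<open>p\<close>-th power of the norm up to a factor,
  which is harmless for finiteness and for convergence to 0.\<close>

lemma W_norm_pow_le_add:
  fixes u v w :: "'a::euclidean_space \<Rightarrow> real"
  assumes [measurable]: "u \<in> borel_measurable lebesgue" "v \<in> borel_measurable lebesgue"
      "w \<in> borel_measurable lebesgue"
    and "0 \<le> p" "\<And>x y. \<bar>w x - w y\<bar> \<le> \<bar>u x - u y\<bar> + \<bar>v x - v y\<bar>" "\<And>x. \<bar>w x\<bar> \<le> \<bar>u x\<bar> + \<bar>v x\<bar>"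
  shows "W_norm_pow p s w \<le> ennreal (2 powr p) * (W_norm_pow p s u + W_norm_pow p s v)"
proof -
  let ?M = "(lebesgue :: 'a measure) \<Otimes>\<^sub>M lebesgue"
  let ?G = "\<lambda>u. \<integral>\<^sup>+z. ennreal (gagliardo p s u z) \<partial>?M"
  let ?L = "\<lambda>u :: 'a \<Rightarrow> real. \<integral>\<^sup>+x. ennreal (\<bar>u x\<bar> powr p) \<partial>lebesgue"
  have "?G w \<le> (\<integral>\<^sup>+z. ennreal (2 powr p) * (ennreal (gagliardo p s u z) + ennreal (gagliardo p s v z)) \<partial>?M)"
    using gagliardo_le_add[OF assms(4,5)]
    by (intro nn_integral_mono) (simp add: ennreal_mult[symmetric] ennreal_plus[symmetric] gagliardo_nonneg ennreal_leI del: ennreal_plus)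
  also have "\<dots> = ennreal (2 powr p) * (?G u + ?G v)"
    by (subst nn_integral_cmult) (auto simp: nn_integral_add)
  finally have "J_energy p s w \<le> ennreal (1 / p) * (ennreal (2 powr p) * (?G u + ?G v))"
    by (simp add: J_energy_eq_pair mult_left_mono)
  also have "\<dots> = ennreal (2 powr p) * (J_energy p s u + J_energy p s v)"
    by (simp add: J_energy_eq_pair algebra_simps)
  finally have J: "J_energy p s w \<le> ennreal (2 powr p) * (J_energy p s u + J_energy p s v)" .
  have "?L w \<le> (\<integral>\<^sup>+x. ennreal (2 powr p) * (ennreal (\<bar>u x\<bar> powr p) + ennreal (\<bar>v x\<bar> powr p)) \<partial>lebesgue)"
    using abs_add_powr_le[OF assms(4,6)]
    by (intro nn_integral_mono) (simp add: ennreal_mult[symmetric] ennreal_plus[symmetric] ennreal_leI del: ennreal_plus)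
  also have "\<dots> = ennreal (2 powr p) * (?L u + ?L v)"
    by (subst nn_integral_cmult) (auto simp: nn_integral_add)
  finally show ?thesis using J
    unfolding W_norm_pow_def by (auto simp: distrib_left add_ac intro: order.trans[OF add_mono])
qed

lemma W_norm_pow_cmult:
  fixes u :: "'a::euclidean_space \<Rightarrow> real"
  assumes [measurable]: "u \<in> borel_measurable lebesgue"
  shows "W_norm_pow p s (\<lambda>x. c * u x) = ennreal (\<bar>c\<bar> powr p) * W_norm_pow p s u"
proof -
  have "gagliardo p s (\<lambda>x. c * u x) z = \<bar>c\<bar> powr p * gagliardo p s u z" for z
    by (simp add: gagliardo_def right_diff_distrib[symmetric] abs_mult powr_mult)
  then show ?thesis
    by (simp add: W_norm_pow_def J_energy_eq_pair abs_mult powr_mult ennreal_mult gagliardo_nonneg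
        nn_integral_cmult algebra_simps)
qed

lemma test_functions_measurable: "f \<in> test_functions \<Omega> \<Longrightarrow> f \<in> borel_measurable lebesgue"
  using test_functions_continuous[of f \<Omega>]
  by (intro measurable_completion) (simp add: borel_measurable_continuous_onI)

lemma W0_measurable: "u \<in> W0 p s \<Omega> \<Longrightarrow> u \<in> borel_measurable lebesgue"
  by (simp add: W0_def)

lemma test_functions_W_norm_finite:
  fixes f :: "'a::euclidean_space \<Rightarrow> real"
  assumes f: "f \<in> test_functions \<Omega>" and ps: "0 < s" "s < 1" "0 < p"
  shows "W_norm_pow p s f < \<infinity>"
proof -
  define K where "K = closure {x. f x \<noteq> 0}"
  have K: "compact K" "\<And>x. x \<notin> K \<Longrightarrow> f x = 0"
    using f closure_subset[of "{x. f x \<noteq> 0}"] by (auto simp: K_def test_functions_def)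
  have [measurable]: "K \<in> sets borel" using K(1) by (simp add: compact_imp_closed borel_closed)
  obtain M where M: "0 \<le> M" "\<And>x. \<bar>f x\<bar> \<le> M" by (rule test_functions_bounded[OF f]) blast
  have "(\<integral>\<^sup>+x. ennreal (\<bar>f x\<bar> powr p) \<partial>lebesgue) \<le> (\<integral>\<^sup>+x. ennreal (M powr p) * indicator K x \<partial>lborel)"
    unfolding nn_integral_completion
  proof (intro nn_integral_mono)
    fix x show "ennreal (\<bar>f x\<bar> powr p) \<le> ennreal (M powr p) * indicator K x"
      using M K(2)[of x] ps by (cases "x \<in> K") (auto intro!: ennreal_leI powr_mono2)
  qed
  also have "\<dots> = ennreal (M powr p) * emeasure lborel K"
    by (simp add: nn_integral_cmult_indicator)
  also have "\<dots> < \<infinity>"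
    using emeasure_bounded_finite[OF compact_imp_bounded[OF K(1)]] by (simp add: ennreal_mult_less_top)
  finally show ?thesis using test_functions_J_finite[OF f ps] by (simp add: W_norm_pow_def)
qed

text \<open>Convergence to 0 puts \<open>u\<close> at finite distance from some test function, and
  test functions have finite norm.\<close>

lemma W0_W_norm_finite:
  assumes u: "u \<in> W0 p s \<Omega>" and ps: "0 < s" "s < 1" "0 < p"
  shows "W_norm_pow p s u < \<infinity>"
proof -
  obtain \<phi> where \<phi>: "\<And>n. \<phi> n \<in> test_functions \<Omega>"
    and lim: "(\<lambda>n::nat. W_norm_pow p s (\<lambda>x. u x - \<phi> n x)) \<longlonglongrightarrow> 0"
    using u by (auto simp: W0_def)
  obtain n where n: "W_norm_pow p s (\<lambda>x. u x - \<phi> n x) < \<infinity>"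
    using order_tendstoD(2)[OF lim, of \<infinity>] by (auto simp: eventually_sequentially)
  note [measurable] = W0_measurable[OF u] test_functions_measurable[OF \<phi>]
  have "W_norm_pow p s u \<le> ennreal (2 powr p) *
      (W_norm_pow p s (\<lambda>x. u x - \<phi> n x) + W_norm_pow p s (\<phi> n))"
    using ps by (intro W_norm_pow_le_add) auto
  also have "\<dots> < \<infinity>"
    using n test_functions_W_norm_finite[OF \<phi>[of n] ps] by (simp add: ennreal_mult_less_top)
  finally show ?thesis .
qed

lemma W0_add:
  assumes u: "u \<in> W0 p s \<Omega>" and v: "v \<in> W0 p s \<Omega>" and "0 \<le> p"
  shows "(\<lambda>x. u x + v x) \<in> W0 p s \<Omega>"
proof -
  obtain \<phi> \<psi> where \<phi>: "\<And>n. \<phi> n \<in> test_functions \<Omega>" and \<psi>: "\<And>n. \<psi> n \<in> test_functions \<Omega>"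
    and lim: "(\<lambda>n::nat. W_norm_pow p s (\<lambda>x. u x - \<phi> n x)) \<longlonglongrightarrow> 0"
      "(\<lambda>n::nat. W_norm_pow p s (\<lambda>x. v x - \<psi> n x)) \<longlonglongrightarrow> 0"
    using u v by (auto simp: W0_def)
  note [measurable] = W0_measurable[OF u] W0_measurable[OF v] test_functions_measurable[OF \<phi>]
    test_functions_measurable[OF \<psi>]
  have "(\<lambda>n::nat. W_norm_pow p s (\<lambda>x. u x + v x - (\<phi> n x + \<psi> n x))) \<longlonglongrightarrow> 0"
  proof (rule tendsto_sandwich[OF _ _ tendsto_const])
    show "\<forall>\<^sub>F n in sequentially. W_norm_pow p s (\<lambda>x. u x + v x - (\<phi> n x + \<psi> n x)) \<le>
      ennreal (2 powr p) * (W_norm_pow p s (\<lambda>x. u x - \<phi> n x) + W_norm_pow p s (\<lambda>x. v x - \<psi> n x))"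
      using \<open>0 \<le> p\<close> by (intro always_eventually allI W_norm_pow_le_add) auto
    show "(\<lambda>n. ennreal (2 powr p) * (W_norm_pow p s (\<lambda>x. u x - \<phi> n x) +
        W_norm_pow p s (\<lambda>x. v x - \<psi> n x))) \<longlonglongrightarrow> 0"
      using ennreal_tendsto_cmult[OF _ tendsto_add[OF lim], of "ennreal (2 powr p)"] by simp
  qed simp
  then show ?thesis
    using u v \<phi> \<psi> unfolding W0_def
    by (auto intro!: exI[of _ "\<lambda>n x. \<phi> n x + \<psi> n x"] test_functions_add)
qed

lemma W0_cmult:
  assumes u: "u \<in> W0 p s \<Omega>"
  shows "(\<lambda>x. c * u x) \<in> W0 p s \<Omega>"
proof -
  obtain \<phi> where \<phi>: "\<And>n. \<phi> n \<in> test_functions \<Omega>"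
    and lim: "(\<lambda>n::nat. W_norm_pow p s (\<lambda>x. u x - \<phi> n x)) \<longlonglongrightarrow> 0"
    using u by (auto simp: W0_def)
  note [measurable] = W0_measurable[OF u] test_functions_measurable[OF \<phi>]
  have "W_norm_pow p s (\<lambda>x. c * u x - c * \<phi> n x) = ennreal (\<bar>c\<bar> powr p) * W_norm_pow p s (\<lambda>x. u x - \<phi> n x)" for n
    unfolding right_diff_distrib[symmetric] by (rule W_norm_pow_cmult) measurable
  then have "(\<lambda>n::nat. W_norm_pow p s (\<lambda>x. c * u x - c * \<phi> n x)) \<longlonglongrightarrow> 0"
    using ennreal_tendsto_cmult[OF _ lim, of "ennreal (\<bar>c\<bar> powr p)"] by simp
  then show ?thesis
    using u \<phi> unfolding W0_def
    by (auto intro!: exI[of _ "\<lambda>n x. c * \<phi> n x"] test_functions_cmult)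
qed

lemma W0_diff:
  assumes "u \<in> W0 p s \<Omega>" "v \<in> W0 p s \<Omega>" "0 \<le> p"
  shows "(\<lambda>x. u x - v x) \<in> W0 p s \<Omega>"
  using W0_add[OF assms(1) W0_cmult[OF assms(2), of "-1"] assms(3)] by simp

text \<open>The part of \<open>A n\<close> above \<open>C\<close> is at most \<open>B n\<close>,
  whose integral tends to 0; the rest is \<open>min (A n) C\<close>, to which dominated convergence
  applies. This serves when the \<open>B n\<close> have no common integrable bound.\<close>

lemma nn_integral_tendsto_0_dominated:
  fixes A B :: "nat \<Rightarrow> 'a \<Rightarrow> ennreal"
  assumes [measurable]: "\<And>n. A n \<in> borel_measurable M" "\<And>n. B n \<in> borel_measurable M" "C \<in> borel_measurable M"
    and le: "\<And>n x. A n x \<le> C x + B n x"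
    and fin: "(\<integral>\<^sup>+x. C x \<partial>M) < \<infinity>"
    and B: "(\<lambda>n. \<integral>\<^sup>+x. B n x \<partial>M) \<longlonglongrightarrow> 0"
    and A: "AE x in M. (\<lambda>n. A n x) \<longlonglongrightarrow> 0"
  shows "(\<lambda>n. \<integral>\<^sup>+x. A n x \<partial>M) \<longlonglongrightarrow> 0"
proof -
  have "(\<lambda>n. \<integral>\<^sup>+x. min (A n x) (C x) \<partial>M) \<longlonglongrightarrow> (\<integral>\<^sup>+x. 0 \<partial>M)"
  proof (rule nn_integral_dominated_convergence[where w = C])
    show "AE x in M. (\<lambda>n. min (A n x) (C x)) \<longlonglongrightarrow> 0"
      using A
    proof eventually_elim
      case (elim x)
      show ?case
        by (rule tendsto_sandwich[OF _ _ tendsto_const elim]) auto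
    qed
  qed (use fin in auto)
  from tendsto_add[OF this B]
  have lim: "(\<lambda>n. (\<integral>\<^sup>+x. min (A n x) (C x) \<partial>M) + (\<integral>\<^sup>+x. B n x \<partial>M)) \<longlonglongrightarrow> 0" by simp
  have upper: "(\<integral>\<^sup>+x. A n x \<partial>M) \<le> (\<integral>\<^sup>+x. min (A n x) (C x) \<partial>M) + (\<integral>\<^sup>+x. B n x \<partial>M)" for n
  proof -
    have "A n x \<le> min (A n x) (C x) + B n x" for x
      using le[of n x] by (cases "A n x \<le> C x") (auto simp: min_def)
    then have "(\<integral>\<^sup>+x. A n x \<partial>M) \<le> (\<integral>\<^sup>+x. min (A n x) (C x) + B n x \<partial>M)" by (intro nn_integral_mono)
    also have "\<dots> = (\<integral>\<^sup>+x. min (A n x) (C x) \<partial>M) + (\<integral>\<^sup>+x. B n x \<partial>M)" by (intro nn_integral_add) measurable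
    finally show ?thesis .
  qed
  show ?thesis
    by (rule tendsto_sandwich[OF always_eventually always_eventually tendsto_const lim]) (use upper in auto)
qed

lemma nn_integral_tendsto_0_AE_subseq:
  fixes f :: "nat \<Rightarrow> 'a \<Rightarrow> real"
  assumes [measurable]: "\<And>n. f n \<in> borel_measurable M" and nonneg: "\<And>n x. 0 \<le> f n x"
    and lim: "(\<lambda>n. \<integral>\<^sup>+x. ennreal (f n x) \<partial>M) \<longlonglongrightarrow> 0"
  obtains r :: "nat \<Rightarrow> nat" where "strict_mono r" "AE x in M. (\<lambda>n. f (r n) x) \<longlonglongrightarrow> 0"
proof -
  \<comment> \<open>Only finitely many of the integrals can be infinite; the subsequence is taken
    from the tail, where the functions are integrable.\<close>
  obtain N where N: "\<And>n. n \<ge> N \<Longrightarrow> (\<integral>\<^sup>+x. ennreal (f n x) \<partial>M) < \<infinity>"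
    using order_tendstoD(2)[OF lim, of \<infinity>] by (auto simp: eventually_sequentially)
  have int: "integrable M (f (n + N))" for n
    using N[of "n + N"] nonneg by (auto simp: integrable_iff_bounded)
  have "ennreal (LINT x|M. norm (f (n + N) x)) = (\<integral>\<^sup>+x. ennreal (f (n + N) x) \<partial>M)" for n
    using int[of n] nonneg by (simp add: nn_integral_eq_integral)
  then have "(\<lambda>n. ennreal (LINT x|M. norm (f (n + N) x))) \<longlonglongrightarrow> ennreal 0"
    using LIMSEQ_ignore_initial_segment[OF lim, of N] by simp
  then have "(\<lambda>n. LINT x|M. norm (f (n + N) x)) \<longlonglongrightarrow> 0"
    by (rule tendsto_ennrealD) auto
  from tendsto_L1_AE_subseq[OF int this] obtain r :: "nat \<Rightarrow> nat" where
    "strict_mono r" "AE x in M. (\<lambda>n. f (r n + N) x) \<longlonglongrightarrow> 0" by blast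
  then show ?thesis using that[of "\<lambda>n. r n + N"] by (auto simp: strict_mono_def)
qed

lemma tendsto_abs_powr_0:
  fixes f :: "'b \<Rightarrow> real"
  assumes "(f \<longlongrightarrow> 0) F" "0 < p"
  shows "((\<lambda>n. \<bar>f n\<bar> powr p) \<longlongrightarrow> 0) F"
  using tendsto_powr2[OF tendsto_rabs_zero[OF assms(1)] tendsto_const[of p]] assms(2) by simp

text \<open>The approximating test functions are mollified by \<open>soft_pos\<close>. Strong convergence follows by
  dominated convergence with the bound \<open>C + B n\<close>, where only \<open>\<integral> B n \<rightarrow> 0\<close> is known.\<close>

lemma W0_pos_part:
  fixes u :: "'a::euclidean_space \<Rightarrow> real"
  assumes u: "u \<in> W0 p s \<Omega>" and ps: "0 < s" "s < 1" "0 < p"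
  shows "(\<lambda>x. max (u x) 0) \<in> W0 p s \<Omega>"
proof -
  let ?M = "(lebesgue :: 'a measure) \<Otimes>\<^sub>M lebesgue"
  obtain \<phi> where \<phi>: "\<And>n. \<phi> n \<in> test_functions \<Omega>"
    and lim: "(\<lambda>n::nat. W_norm_pow p s (\<lambda>x. u x - \<phi> n x)) \<longlonglongrightarrow> 0"
    using u by (auto simp: W0_def)
  note [measurable] = W0_measurable[OF u] test_functions_measurable[OF \<phi>]
  have limL: "(\<lambda>n. \<integral>\<^sup>+x. ennreal (\<bar>u x - \<phi> n x\<bar> powr p) \<partial>lebesgue) \<longlonglongrightarrow> 0"
    by (rule tendsto_sandwich[OF always_eventually always_eventually tendsto_const lim])
      (auto simp: W_norm_pow_def)
  have limJ: "(\<lambda>n. J_energy p s (\<lambda>x. u x - \<phi> n x)) \<longlonglongrightarrow> 0"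
    by (rule tendsto_sandwich[OF always_eventually always_eventually tendsto_const lim])
      (auto simp: W_norm_pow_def)
  have eqG: "(\<integral>\<^sup>+z. ennreal (gagliardo p s v z) \<partial>?M) = ennreal p * J_energy p s v"
    if "v \<in> borel_measurable lebesgue" for v
    using ps that by (simp add: J_energy_eq_pair mult.assoc[symmetric] ennreal_mult[symmetric])
  obtain r :: "nat \<Rightarrow> nat" where r: "strict_mono r"
    and ae: "AE x in lebesgue. (\<lambda>n. \<bar>u x - \<phi> (r n) x\<bar> powr p) \<longlonglongrightarrow> 0"
    by (rule nn_integral_tendsto_0_AE_subseq[OF _ _ limL]) auto
  \<comment> \<open>The smoothing parameter tends to 0, so the distance of \<open>\<psi> n\<close>
    from the positive part of \<open>\<phi> (r n)\<close> tends to 0 uniformly.\<close>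
  define \<psi> where "\<psi> n x = soft_pos (1 / real (Suc n)) (\<phi> (r n) x)" for n x
  have \<psi>: "\<psi> n \<in> test_functions \<Omega>" for n
    unfolding \<psi>_def by (intro test_functions_soft_pos \<phi>) simp
  note [measurable] = test_functions_measurable[OF \<psi>]
  define v where "v x = max (u x) 0" for x
  have [measurable]: "v \<in> borel_measurable lebesgue" unfolding v_def by measurable
  have conv: "AE x in lebesgue. (\<lambda>n. v x - \<psi> n x) \<longlonglongrightarrow> 0"
    using ae
  proof eventually_elim
    case (elim x)
    have "(\<lambda>n. (\<bar>u x - \<phi> (r n) x\<bar> powr p) powr (1 / p)) \<longlonglongrightarrow> 0"
      using tendsto_abs_powr_0[OF elim, of "1 / p"] ps by simp
    then have "(\<lambda>n. \<bar>u x - \<phi> (r n) x\<bar>) \<longlonglongrightarrow> 0" using ps by (simp add: powr_powr)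
    then have *: "(\<lambda>n. 1 / real (Suc n) + \<bar>u x - \<phi> (r n) x\<bar>) \<longlonglongrightarrow> 0"
      using tendsto_add[OF LIMSEQ_inverse_real_of_nat] by (fastforce simp: inverse_eq_divide)
    show ?case
    proof (rule Lim_null_comparison[OF always_eventually *], rule allI)
      fix n
      have "\<bar>\<psi> n x - max (\<phi> (r n) x) 0\<bar> \<le> 1 / real (Suc n)"
        unfolding \<psi>_def by (rule soft_pos_approx) simp
      then show "norm (v x - \<psi> n x) \<le> 1 / real (Suc n) + \<bar>u x - \<phi> (r n) x\<bar>"
        unfolding v_def real_norm_def by linarith
    qed
  qed
  \<comment> \<open>The factor 2: one copy of \<open>u\<close> bounds the increments of
    \<open>v\<close>, a second one together with \<open>u - \<phi> (r n)\<close> bounds those of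
    \<open>\<phi> (r n)\<close> and hence of \<open>\<psi> n\<close>.\<close>
  have "W_norm_pow p s (\<lambda>x. 2 * u x) < \<infinity>"
    by (intro W0_W_norm_finite[OF W0_cmult[OF u] ps])
  then have fin: "J_energy p s (\<lambda>x. 2 * u x) < \<infinity>" "(\<integral>\<^sup>+x. ennreal (\<bar>2 * u x\<bar> powr p) \<partial>lebesgue) < \<infinity>"
    by (auto simp: W_norm_pow_def)
  have lip: "\<bar>\<psi> n x - \<psi> n y\<bar> \<le> \<bar>\<phi> (r n) x - \<phi> (r n) y\<bar>" for n x y
    unfolding \<psi>_def by (rule soft_pos_lipschitz)
  have "(\<lambda>n. \<integral>\<^sup>+z. ennreal (gagliardo p s (\<lambda>x. v x - \<psi> n x) z) \<partial>?M) \<longlonglongrightarrow> 0"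
  proof (rule nn_integral_tendsto_0_dominated[where C = "\<lambda>z. ennreal (2 powr p) * ennreal (gagliardo p s (\<lambda>x. 2 * u x) z)"
        and B = "\<lambda>n z. ennreal (2 powr p) * ennreal (gagliardo p s (\<lambda>x. u x - \<phi> (r n) x) z)"])
    have diff: "\<bar>v x - \<psi> n x - (v y - \<psi> n y)\<bar> \<le> \<bar>2 * u x - 2 * u y\<bar> + \<bar>u x - \<phi> (r n) x - (u y - \<phi> (r n) y)\<bar>" for n x y
      using lip[of n x y] unfolding v_def by linarith
    show "ennreal (gagliardo p s (\<lambda>x. v x - \<psi> n x) z) \<le> ennreal (2 powr p) * ennreal (gagliardo p s (\<lambda>x. 2 * u x) z) +
        ennreal (2 powr p) * ennreal (gagliardo p s (\<lambda>x. u x - \<phi> (r n) x) z)" for n z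
      using gagliardo_le_add[of p "\<lambda>x. v x - \<psi> n x" "\<lambda>x. 2 * u x" "\<lambda>x. u x - \<phi> (r n) x", OF _ diff] ps
      by (simp add: ennreal_mult[symmetric] ennreal_plus[symmetric] gagliardo_nonneg ennreal_leI distrib_left del: ennreal_plus)
    show "(\<integral>\<^sup>+z. ennreal (2 powr p) * ennreal (gagliardo p s (\<lambda>x. 2 * u x) z) \<partial>?M) < \<infinity>"
      using fin(1) by (simp add: nn_integral_cmult eqG ennreal_mult_less_top)
    have "(\<lambda>n. ennreal (2 powr p) * (ennreal p * J_energy p s (\<lambda>x. u x - \<phi> (r n) x))) \<longlonglongrightarrow>
        ennreal (2 powr p) * (ennreal p * 0)"
      using LIMSEQ_subseq_LIMSEQ[OF limJ r] by (intro ennreal_tendsto_cmult) (auto simp: o_def)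
    then show "(\<lambda>n. \<integral>\<^sup>+z. ennreal (2 powr p) * ennreal (gagliardo p s (\<lambda>x. u x - \<phi> (r n) x) z) \<partial>?M) \<longlonglongrightarrow> 0"
      by (simp add: nn_integral_cmult eqG)
    show "AE z in ?M. (\<lambda>n. ennreal (gagliardo p s (\<lambda>x. v x - \<psi> n x) z)) \<longlonglongrightarrow> 0"
      using AE_lebesgue_pairI[OF conv]
    proof eventually_elim
      case (elim z)
      have "(\<lambda>n. (v (fst z) - \<psi> n (fst z)) - (v (snd z) - \<psi> n (snd z))) \<longlonglongrightarrow> 0"
        using tendsto_diff[of _ 0 sequentially _ 0] elim by fastforce
      from tendsto_divide_zero[OF tendsto_abs_powr_0[OF this \<open>0 < p\<close>]]
      have "(\<lambda>n. gagliardo p s (\<lambda>x. v x - \<psi> n x) z) \<longlonglongrightarrow> 0" by (simp add: gagliardo_def)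
      then show ?case using tendsto_ennrealI by fastforce
    qed
  qed measurable
  then have "(\<lambda>n. ennreal (1 / p) * (\<integral>\<^sup>+z. ennreal (gagliardo p s (\<lambda>x. v x - \<psi> n x) z) \<partial>?M)) \<longlonglongrightarrow> ennreal (1 / p) * 0"
    by (intro ennreal_tendsto_cmult) auto
  then have J0: "(\<lambda>n. J_energy p s (\<lambda>x. v x - \<psi> n x)) \<longlonglongrightarrow> 0"
    by (simp add: J_energy_eq_pair)
  have L0: "(\<lambda>n. \<integral>\<^sup>+x. ennreal (\<bar>v x - \<psi> n x\<bar> powr p) \<partial>lebesgue) \<longlonglongrightarrow> 0"
  proof (rule nn_integral_tendsto_0_dominated[where C = "\<lambda>x. ennreal (2 powr p) * ennreal (\<bar>2 * u x\<bar> powr p)"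
        and B = "\<lambda>n x. ennreal (2 powr p) * ennreal (\<bar>u x - \<phi> (r n) x\<bar> powr p)"])
    show "ennreal (\<bar>v x - \<psi> n x\<bar> powr p) \<le> ennreal (2 powr p) * ennreal (\<bar>2 * u x\<bar> powr p) +
        ennreal (2 powr p) * ennreal (\<bar>u x - \<phi> (r n) x\<bar> powr p)" for n x
    proof -
      have "\<bar>\<psi> n x\<bar> \<le> \<bar>\<phi> (r n) x\<bar>"
        using soft_pos_lipschitz[of "1 / real (Suc n)" "\<phi> (r n) x" 0] by (simp add: \<psi>_def)
      then have "\<bar>v x - \<psi> n x\<bar> \<le> \<bar>2 * u x\<bar> + \<bar>u x - \<phi> (r n) x\<bar>" unfolding v_def by linarith
      from abs_add_powr_le[OF _ this, of p] ps show ?thesis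
        by (simp add: ennreal_mult[symmetric] ennreal_plus[symmetric] ennreal_leI distrib_left del: ennreal_plus)
    qed
    show "(\<integral>\<^sup>+x. ennreal (2 powr p) * ennreal (\<bar>2 * u x\<bar> powr p) \<partial>lebesgue) < \<infinity>"
      using fin(2) by (simp add: nn_integral_cmult ennreal_mult_less_top)
    have "(\<lambda>n. ennreal (2 powr p) * (\<integral>\<^sup>+x. ennreal (\<bar>u x - \<phi> (r n) x\<bar> powr p) \<partial>lebesgue)) \<longlonglongrightarrow>
        ennreal (2 powr p) * 0"
      using LIMSEQ_subseq_LIMSEQ[OF limL r] by (intro ennreal_tendsto_cmult) (auto simp: o_def)
    then show "(\<lambda>n. \<integral>\<^sup>+x. ennreal (2 powr p) * ennreal (\<bar>u x - \<phi> (r n) x\<bar> powr p) \<partial>lebesgue) \<longlonglongrightarrow> 0"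
      by (simp add: nn_integral_cmult)
    show "AE x in lebesgue. (\<lambda>n. ennreal (\<bar>v x - \<psi> n x\<bar> powr p)) \<longlonglongrightarrow> 0"
      using conv
    proof eventually_elim
      case (elim x)
      from tendsto_ennrealI[OF tendsto_abs_powr_0[OF this \<open>0 < p\<close>]] show ?case by simp
    qed
  qed measurable
  have "(\<lambda>n. W_norm_pow p s (\<lambda>x. v x - \<psi> n x)) \<longlonglongrightarrow> 0"
    unfolding W_norm_pow_def using tendsto_add[OF J0 L0] by simp
  then show ?thesis
    using u \<psi> unfolding W0_def v_def by (auto intro!: exI[of _ \<psi>])
qed

section \<open>Integrability and monotonicity of the form\<close>

definition pLap_integrand ::
  "real \<Rightarrow> real \<Rightarrow> ('a::euclidean_space \<Rightarrow> real) \<Rightarrow> ('a \<Rightarrow> real) \<Rightarrow> 'a \<times> 'a \<Rightarrow> real" where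
  "pLap_integrand p s u \<phi> z =
     \<bar>u (fst z) - u (snd z)\<bar> powr (p - 2) * (u (fst z) - u (snd z)) * (\<phi> (fst z) - \<phi> (snd z)) /
       norm (fst z - snd z) powr (real DIM('a) + s * p)"

lemma pLap_form_eq_integrand: "pLap_form p s u \<phi> = (LINT z|(lebesgue \<Otimes>\<^sub>M lebesgue). pLap_integrand p s u \<phi> z)"
  by (simp add: pLap_form_def pLap_integrand_def case_prod_unfold)

text \<open>A crude form of Young's inequality: every factor is bounded by a power of
  \<open>max a b\<close>.\<close>

lemma powr_mult_le_sum_powr:
  fixes a b :: real
  assumes "0 \<le> a" "0 \<le> b" "2 < p"
  shows "a powr (p - 2) * a * b \<le> a powr p + b powr p"
proof (cases "max a b = 0")
  case False
  define m where "m = max a b"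
  have m: "0 < m" "a \<le> m" "b \<le> m" using assms False by (auto simp: m_def)
  have "a powr (p - 2) * a * b \<le> m powr (p - 2) * m * m"
    using m assms by (intro mult_mono powr_mono2) auto
  also have "\<dots> = m powr (p - 2) * m powr 2" using m by (simp add: power2_eq_square)
  also have "\<dots> = m powr p" by (simp add: powr_add[symmetric])
  also have "\<dots> \<le> a powr p + b powr p" by (auto simp: m_def max_def)
  finally show ?thesis .
qed (use assms in \<open>auto simp: max_def split: if_splits\<close>)

text \<open>Excludes that the integral in \<open>pLap_form\<close> is the default value 0 of a
  non-integrable function; only then do pointwise inequalities between integrands pass to the
  form.\<close>

lemma pLap_integrand_integrable:
  fixes u \<phi> :: "'a::euclidean_space \<Rightarrow> real"
  assumes u: "u \<in> W0 p s \<Omega>" and \<phi>: "\<phi> \<in> W0 p s \<Omega>" and ps: "0 < s" "s < 1" "2 < p"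
  shows "integrable (lebesgue \<Otimes>\<^sub>M lebesgue) (pLap_integrand p s u \<phi>)"
proof (rule Bochner_Integration.integrable_bound)
  note [measurable] = W0_measurable[OF u] W0_measurable[OF \<phi>]
  have int: "integrable (lebesgue \<Otimes>\<^sub>M lebesgue) (gagliardo p s w)" if w: "w \<in> W0 p s \<Omega>" for w :: "'a \<Rightarrow> real"
  proof -
    note [measurable] = W0_measurable[OF w]
    have "J_energy p s w < \<infinity>" using W0_W_norm_finite[OF w] ps by (simp add: W_norm_pow_def)
    then show ?thesis
      using ps gagliardo_nonneg[of p s w]
      by (auto simp: J_energy_eq_pair integrable_iff_bounded ennreal_mult_less_top)
  qed
  show "integrable (lebesgue \<Otimes>\<^sub>M lebesgue) (\<lambda>z. gagliardo p s u z + gagliardo p s \<phi> z)"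
    by (intro Bochner_Integration.integrable_add int u \<phi>)
  show "pLap_integrand p s u \<phi> \<in> borel_measurable (lebesgue \<Otimes>\<^sub>M lebesgue)"
    unfolding pLap_integrand_def[abs_def] by measurable
  show "AE z in lebesgue \<Otimes>\<^sub>M lebesgue. norm (pLap_integrand p s u \<phi> z) \<le> norm (gagliardo p s u z + gagliardo p s \<phi> z)"
  proof (rule AE_I2)
    fix z :: "'a \<times> 'a"
    have "norm (pLap_integrand p s u \<phi> z) \<le> gagliardo p s u z + gagliardo p s \<phi> z"
      using powr_mult_le_sum_powr[of "\<bar>u (fst z) - u (snd z)\<bar>" "\<bar>\<phi> (fst z) - \<phi> (snd z)\<bar>" p] ps
      by (simp add: pLap_integrand_def gagliardo_def abs_mult add_divide_distrib[symmetric] divide_right_mono)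
    then show "norm (pLap_integrand p s u \<phi> z) \<le> norm (gagliardo p s u z + gagliardo p s \<phi> z)"
      by (simp add: gagliardo_nonneg)
  qed
qed

lemma abs_powr_mult_mono:
  fixes a b q :: real
  assumes "a \<le> b" "0 \<le> q"
  shows "\<bar>a\<bar> powr q * a \<le> \<bar>b\<bar> powr q * b"
proof -
  have nonneg: "\<bar>x\<bar> powr q * x \<le> \<bar>y\<bar> powr q * y" if "0 \<le> x" "x \<le> y" for x y :: real
    using that assms(2) by (intro mult_mono powr_mono2) auto
  consider "0 \<le> a" | "a \<le> 0" "0 \<le> b" | "b \<le> 0" using assms(1) by linarith
  then show ?thesis
  proof cases
    case 2
    then have "\<bar>a\<bar> powr q * a \<le> 0" "0 \<le> \<bar>b\<bar> powr q * b"
      by (auto simp: mult_nonneg_nonpos)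
    then show ?thesis by linarith
  next
    case 3
    then show ?thesis using nonneg[of "- b" "- a"] assms(1) by simp
  qed (use nonneg assms in auto)
qed

text \<open>The increment of the truncated difference is nonnegative where the increment of
  \<open>u\<close> is at least that of \<open>v\<close>, and nonpositive elsewhere. As
  \<open>|y|^(p-2) y\<close> is nondecreasing, the difference of the integrands is a product of two
  factors that never have opposite signs.\<close>

lemma pLap_form_pos_part_mono:
  fixes u v :: "'a::euclidean_space \<Rightarrow> real"
  assumes u: "u \<in> W0 p s \<Omega>" and v: "v \<in> W0 p s \<Omega>" and ps: "0 < s" "s < 1" "2 < p"
  shows "pLap_form p s v (\<lambda>x. max (u x - v x) 0) \<le> pLap_form p s u (\<lambda>x. max (u x - v x) 0)"
proof -
  let ?\<phi> = "\<lambda>x. max (u x - v x) 0"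
  have \<phi>: "?\<phi> \<in> W0 p s \<Omega>"
    using W0_pos_part[OF W0_diff[OF u v]] ps by simp
  have "pLap_integrand p s v ?\<phi> z \<le> pLap_integrand p s u ?\<phi> z" for z
  proof -
    define a b d where "a = u (fst z) - u (snd z)" and "b = v (fst z) - v (snd z)"
      and "d = ?\<phi> (fst z) - ?\<phi> (snd z)"
    have "\<bar>b\<bar> powr (p - 2) * b * d \<le> \<bar>a\<bar> powr (p - 2) * a * d"
    proof (cases "b \<le> a")
      case True
      then have "0 \<le> d" unfolding a_def b_def d_def by linarith
      then show ?thesis using abs_powr_mult_mono[OF True, of "p - 2"] ps by (intro mult_right_mono) auto
    next
      case False
      then have "d \<le> 0" unfolding a_def b_def d_def by linarith
      then show ?thesis using abs_powr_mult_mono[of a b "p - 2"] ps False by (intro mult_right_mono_neg) auto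
    qed
    then show ?thesis
      unfolding pLap_integrand_def a_def b_def d_def by (intro divide_right_mono) auto
  qed
  then show ?thesis
    unfolding pLap_form_eq_integrand
    by (intro integral_mono pLap_integrand_integrable[OF _ \<phi>] u v ps)
qed

section \<open>Comparison of strong solutions\<close>

lemma strong_solutionD:
  assumes "strong_solution p s \<Omega> v"
  shows strong_solution_L2: "0 \<le> t \<Longrightarrow> L2_on lebesgue (v t)"
    and strong_solution_zero: "0 \<le> t \<Longrightarrow> x \<notin> \<Omega> \<Longrightarrow> v t x = 0"
    and strong_solution_continuous:
      "0 \<le> t \<Longrightarrow> ((\<lambda>r. L2norm lebesgue (\<lambda>x. v r x - v t x)) \<longlongrightarrow> 0) (at t within {0..})"
    and strong_solution_abs_continuous: "0 < a \<Longrightarrow> a < b \<Longrightarrow> L2_abs_continuous_on a b v"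
  using assms by (auto simp: strong_solution_def L2_on_lebesgue_iff_Lspace L2_continuous_def Lnorm_2_eq_L2norm)

lemma strong_solution_derivative_null_setE:
  assumes "strong_solution p s \<Omega> v"
  obtains N where "N \<in> null_sets lebesgue" "\<And>t. t \<notin> N \<Longrightarrow> 0 < t \<Longrightarrow>
    \<exists>w. pLap p s \<Omega> (v t) w \<and> L2_has_time_derivative v (\<lambda>x. - w x) t"
proof -
  have "AE t in lebesgue. 0 < t \<longrightarrow>
      (\<exists>w. pLap p s \<Omega> (v t) w \<and> L2_has_time_derivative v (\<lambda>x. - w x) t)"
    using assms by (simp add: strong_solution_def)
  then obtain N where "N \<in> null_sets lebesgue" "{t \<in> space lebesgue. \<not> (0 < t \<longrightarrow>
      (\<exists>w. pLap p s \<Omega> (v t) w \<and> L2_has_time_derivative v (\<lambda>x. - w x) t))} \<subseteq> N"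
    unfolding eventually_ae_filter by blast
  then show ?thesis by (intro that[of N]) auto
qed

lemma L2_abs_continuous_onE:
  assumes "L2_abs_continuous_on a b u" "0 < \<epsilon>"
  obtains \<delta> where "\<delta> > 0" "\<And>P. finite P \<Longrightarrow> (\<forall>(l, r)\<in>P. a \<le> l \<and> l \<le> r \<and> r \<le> b) \<Longrightarrow>
    disjoint_family_on (\<lambda>(l, r). {l<..<r}) P \<Longrightarrow> (\<Sum>(l, r)\<in>P. r - l) < \<delta> \<Longrightarrow>
    (\<Sum>(l, r)\<in>P. Lnorm 2 (\<lambda>x. u r x - u l x)) < \<epsilon>"
proof -
  obtain \<delta> where "\<delta> > 0" and \<delta>: "\<forall>P. finite P \<and> (\<forall>(l, r)\<in>P. a \<le> l \<and> l \<le> r \<and> r \<le> b) \<and>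
    disjoint_family_on (\<lambda>(l, r). {l<..<r}) P \<and> (\<Sum>(l, r)\<in>P. r - l) < \<delta> \<longrightarrow>
    (\<Sum>(l, r)\<in>P. Lnorm 2 (\<lambda>x. u r x - u l x)) < \<epsilon>"
    using mp[OF spec[OF assms(1)[unfolded L2_abs_continuous_on_def], of \<epsilon>] assms(2)] by blast
  show ?thesis
  proof (rule that[OF \<open>\<delta> > 0\<close>])
    fix P assume "finite P" "\<forall>(l, r)\<in>P. a \<le> l \<and> l \<le> r \<and> r \<le> b"
      "disjoint_family_on (\<lambda>(l, r). {l<..<r}) P" "(\<Sum>(l, r)\<in>P. r - l) < \<delta>"
    then show "(\<Sum>(l, r)\<in>P. Lnorm 2 (\<lambda>x. u r x - u l x)) < \<epsilon>"
      by (intro mp[OF spec[OF \<delta>, of P]] conjI)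
  qed
qed

section \<open>Positive parts and time derivatives of square integrable functions\<close>

lemma L2_on_pos_part: "L2_on M f \<Longrightarrow> L2_on M (\<lambda>x. max (f x) 0)"
  by (rule L2_on_bound) (auto dest: L2_onD)

text \<open>Truncation is 1-Lipschitz. This transfers continuity and absolute continuity of orbits
  to the norm of the truncated difference.\<close>

lemma L2norm_pos_part_le:
  assumes f: "L2_on M f" and g: "L2_on M g"
  shows "L2norm M (\<lambda>x. max (f x) 0) \<le> L2norm M (\<lambda>x. max (g x) 0) + L2norm M (\<lambda>x. f x - g x)"
proof -
  note [measurable] = L2_onD[OF f] L2_onD[OF g]
  have "L2norm M (\<lambda>x. max (f x) 0) = L2norm M (\<lambda>x. max (g x) 0 + (max (f x) 0 - max (g x) 0))" by simp
  also have "\<dots> \<le> L2norm M (\<lambda>x. max (g x) 0) + L2norm M (\<lambda>x. max (f x) 0 - max (g x) 0)"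
    by (intro L2norm_triangle L2_on_diff L2_on_pos_part f g)
  also have "L2norm M (\<lambda>x. max (f x) 0 - max (g x) 0) \<le> L2norm M (\<lambda>x. f x - g x)"
    by (intro L2norm_mono L2_on_diff f g AE_I2) (auto simp: max_def)
  finally show ?thesis by simp
qed

lemma L2norm_commute_diff: "L2norm M (\<lambda>x. f x - g x) = L2norm M (\<lambda>x. g x - f x)"
  by (simp add: L2norm_def power2_commute)

text \<open>Taylor expansion of \<open>(max y 0)^2\<close>, a convex function with derivative
  \<open>2 * max y 0\<close>: the remainder lies pointwise between 0 and the square of the
  increment, and this is integrated.\<close>

lemma L2norm_square_pos_part_expansion:
  assumes f: "L2_on M f" and g: "L2_on M g"
  shows "\<bar>(L2norm M (\<lambda>x. max (f x) 0))\<^sup>2 - (L2norm M (\<lambda>x. max (g x) 0))\<^sup>2 -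
      2 * (LINT x|M. max (g x) 0 * (f x - g x))\<bar> \<le> (L2norm M (\<lambda>x. f x - g x))\<^sup>2"
proof -
  let ?R = "\<lambda>x. (max (f x) 0)\<^sup>2 - (max (g x) 0)\<^sup>2 - 2 * (max (g x) 0 * (f x - g x))"
  have R: "0 \<le> ?R x \<and> ?R x \<le> (f x - g x)\<^sup>2" for x
  proof -
    \<comment> \<open>With the products abbreviated, each sign case is linear arithmetic; in the
      mixed cases \<open>C \<le> 0\<close> decides.\<close>
    define A B C where "A = f x * f x" and "B = g x * g x" and "C = f x * g x"
    have "0 \<le> A" "0 \<le> B" "0 \<le> A - 2 * C + B"
      using sum_squares_ge_zero[of "f x - g x" 0] by (simp_all add: A_def B_def C_def algebra_simps)
    moreover have "C \<le> 0" if "0 \<le> f x \<and> g x < 0 \<or> 0 \<le> g x \<and> f x < 0"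
      using that by (auto simp: C_def mult_nonneg_nonpos mult_nonpos_nonneg)
    moreover have "(max (f x) 0)\<^sup>2 = (if 0 \<le> f x then A else 0)" "(max (g x) 0)\<^sup>2 = (if 0 \<le> g x then B else 0)"
      "max (g x) 0 * (f x - g x) = (if 0 \<le> g x then C - B else 0)" "(f x - g x)\<^sup>2 = A - 2 * C + B"
      by (simp_all add: A_def B_def C_def power2_eq_square algebra_simps)
    ultimately show ?thesis by (cases "0 \<le> f x"; cases "0 \<le> g x") simp_all
  qed
  have int: "integrable M (\<lambda>x. (max (f x) 0)\<^sup>2)" "integrable M (\<lambda>x. (max (g x) 0)\<^sup>2)"
    "integrable M (\<lambda>x. max (g x) 0 * (f x - g x))" "integrable M (\<lambda>x. (f x - g x)\<^sup>2)"
    using f g by (auto intro!: L2_on_integrable_square L2_on_mult_integrable L2_on_pos_part L2_on_diff)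
  have eq: "(L2norm M (\<lambda>x. max (f x) 0))\<^sup>2 - (L2norm M (\<lambda>x. max (g x) 0))\<^sup>2 -
      2 * (LINT x|M. max (g x) 0 * (f x - g x)) = (LINT x|M. ?R x)"
    using int by (simp add: L2norm_square)
  have "0 \<le> (LINT x|M. ?R x)" using R by (intro integral_nonneg_AE AE_I2) auto
  moreover have "(LINT x|M. ?R x) \<le> (LINT x|M. (f x - g x)\<^sup>2)"
    using int R by (intro integral_mono) auto
  ultimately show ?thesis unfolding eq L2norm_square[of M "\<lambda>x. f x - g x"] by linarith
qed

text \<open>By the expansion, the difference quotient is the linear term up to \<open>|h|\<close>
  times the squared norm of the quotient of \<open>w\<close>, which stays bounded because that
  quotient converges to \<open>v\<close>. The linear term converges by Cauchy-Schwarz.\<close>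

lemma L2norm_square_pos_part_has_derivative:
  assumes L2: "\<And>r. 0 \<le> r \<Longrightarrow> L2_on lebesgue (w r)" and v: "L2_on lebesgue v" and "0 < t"
    and deriv: "L2_has_time_derivative w v t"
  shows "((\<lambda>r. (L2norm lebesgue (\<lambda>x. max (w r x) 0))\<^sup>2) has_real_derivative
      2 * (LINT x|lebesgue. max (w t x) 0 * v x)) (at t)"
proof -
  let ?N = "L2norm lebesgue"
  let ?g = "\<lambda>r. (?N (\<lambda>x. max (w r x) 0))\<^sup>2"
  let ?\<phi> = "\<lambda>x. max (w t x) 0"
  let ?D = "2 * (LINT x|lebesgue. ?\<phi> x * v x)"
  define \<rho> where "\<rho> h = ?N (\<lambda>x. (w (t + h) x - w t x) / h - v x)" for h
  have \<rho>: "(\<rho> \<longlongrightarrow> 0) (at 0)"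
    using deriv by (simp add: \<rho>_def[abs_def] L2_has_time_derivative_def Lnorm_2_eq_L2norm)
  have wt: "L2_on lebesgue (w t)" using L2 \<open>0 < t\<close> by simp
  have est: "\<bar>(?g (t + h) - ?g t) / h - ?D\<bar> \<le> \<bar>h\<bar> * (\<rho> h + ?N v)\<^sup>2 + 2 * (?N ?\<phi> * \<rho> h)"
    if h: "h \<noteq> 0" "\<bar>h\<bar> < t" for h
  proof -
    have wh: "L2_on lebesgue (w (t + h))" using L2 h by simp
    have d: "L2_on lebesgue (\<lambda>x. w (t + h) x - w t x)" by (intro L2_on_diff wh wt)
    have q: "L2_on lebesgue (\<lambda>x. (w (t + h) x - w t x) / h)"
      using L2_on_cmult[OF d, of "1 / h"] by simp
    have Nd: "?N (\<lambda>x. w (t + h) x - w t x) = \<bar>h\<bar> * ?N (\<lambda>x. (w (t + h) x - w t x) / h)"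
      using L2norm_cmult[of lebesgue h "\<lambda>x. (w (t + h) x - w t x) / h"] h by simp
    have "?N (\<lambda>x. (w (t + h) x - w t x) / h) \<le> \<rho> h + ?N v"
      using L2norm_triangle[OF L2_on_diff[OF q v] v] by (simp add: \<rho>_def)
    then have "?N (\<lambda>x. w (t + h) x - w t x) \<le> \<bar>h\<bar> * (\<rho> h + ?N v)"
      unfolding Nd by (intro mult_left_mono) auto
    then have "(?N (\<lambda>x. w (t + h) x - w t x))\<^sup>2 \<le> (\<bar>h\<bar> * (\<rho> h + ?N v))\<^sup>2"
      by (intro power_mono) auto
    with L2norm_square_pos_part_expansion[OF wh wt]
    have 1: "\<bar>?g (t + h) - ?g t - 2 * (LINT x|lebesgue. ?\<phi> x * (w (t + h) x - w t x))\<bar> \<le> h\<^sup>2 * (\<rho> h + ?N v)\<^sup>2"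
      by (simp add: power_mult_distrib)
    have I: "(LINT x|lebesgue. ?\<phi> x * (w (t + h) x - w t x)) = h * (LINT x|lebesgue. ?\<phi> x * ((w (t + h) x - w t x) / h))"
      using h by (subst integral_mult_right_zero[symmetric]) (simp add: mult.left_commute)
    have "\<bar>LINT x|lebesgue. ?\<phi> x * ((w (t + h) x - w t x) / h - v x)\<bar> \<le> ?N ?\<phi> * \<rho> h"
      unfolding \<rho>_def by (intro Cauchy_Schwarz_integral L2_on_pos_part wt L2_on_diff q v)
    moreover have "(LINT x|lebesgue. ?\<phi> x * ((w (t + h) x - w t x) / h - v x)) =
        (LINT x|lebesgue. ?\<phi> x * ((w (t + h) x - w t x) / h)) - (LINT x|lebesgue. ?\<phi> x * v x)"
      unfolding right_diff_distrib
      by (intro Bochner_Integration.integral_diff L2_on_mult_integrable L2_on_pos_part wt q v)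
    ultimately have 2: "\<bar>2 * (LINT x|lebesgue. ?\<phi> x * ((w (t + h) x - w t x) / h)) - ?D\<bar> \<le> 2 * (?N ?\<phi> * \<rho> h)"
      by linarith
    have "\<bar>(?g (t + h) - ?g t) / h - 2 * (LINT x|lebesgue. ?\<phi> x * ((w (t + h) x - w t x) / h))\<bar> =
        \<bar>?g (t + h) - ?g t - 2 * (LINT x|lebesgue. ?\<phi> x * (w (t + h) x - w t x))\<bar> / \<bar>h\<bar>"
      unfolding I abs_divide[symmetric] using h by (simp add: diff_divide_distrib)
    also have "\<dots> \<le> h\<^sup>2 * (\<rho> h + ?N v)\<^sup>2 / \<bar>h\<bar>" by (intro divide_right_mono 1) auto
    also have "\<dots> = \<bar>h\<bar> * (\<rho> h + ?N v)\<^sup>2"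
    proof -
      have "k * k * c / k = k * c" if "k \<noteq> 0" for k c :: real using that by simp
      from this[of "\<bar>h\<bar>" "(\<rho> h + ?N v)\<^sup>2"] show ?thesis using h by (simp add: power2_eq_square[of h])
    qed
    finally show ?thesis using 2 by linarith
  qed
  have "((\<lambda>h. \<bar>h\<bar> * (\<rho> h + ?N v)\<^sup>2 + 2 * (?N ?\<phi> * \<rho> h)) \<longlongrightarrow> \<bar>0\<bar> * (0 + ?N v)\<^sup>2 + 2 * (?N ?\<phi> * 0)) (at 0)"
    by (intro tendsto_intros \<rho>)
  then have lim: "((\<lambda>h. \<bar>h\<bar> * (\<rho> h + ?N v)\<^sup>2 + 2 * (?N ?\<phi> * \<rho> h)) \<longlongrightarrow> 0) (at 0)" by simp
  have "((\<lambda>h. (?g (t + h) - ?g t) / h - ?D) \<longlongrightarrow> 0) (at 0)"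
  proof (rule Lim_null_comparison[OF _ lim])
    show "\<forall>\<^sub>F h in at 0. norm ((?g (t + h) - ?g t) / h - ?D) \<le> \<bar>h\<bar> * (\<rho> h + ?N v)\<^sup>2 + 2 * (?N ?\<phi> * \<rho> h)"
      unfolding eventually_at using est \<open>0 < t\<close> by (intro exI[of _ t]) (auto simp: dist_real_def)
  qed
  then show ?thesis unfolding DERIV_def using Lim_null by blast
qed

lemma L2_has_time_derivative_diff:
  assumes u: "\<And>r. 0 \<le> r \<Longrightarrow> L2_on lebesgue (u r)" and v: "\<And>r. 0 \<le> r \<Longrightarrow> L2_on lebesgue (v r)"
    and "L2_on lebesgue u'" "L2_on lebesgue v'" and "0 < t"
    and du: "L2_has_time_derivative u u' t" and dv: "L2_has_time_derivative v v' t"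
  shows "L2_has_time_derivative (\<lambda>r x. u r x - v r x) (\<lambda>x. u' x - v' x) t"
proof -
  let ?N = "L2norm lebesgue"
  have lim: "((\<lambda>h. ?N (\<lambda>x. (u (t + h) x - u t x) / h - u' x) + ?N (\<lambda>x. (v (t + h) x - v t x) / h - v' x)) \<longlongrightarrow> 0) (at 0)"
    using tendsto_add[OF du[unfolded L2_has_time_derivative_def] dv[unfolded L2_has_time_derivative_def]]
    by (simp add: Lnorm_2_eq_L2norm)
  \<comment> \<open>The restriction on \<open>h\<close> keeps \<open>t + h\<close> among the
    nonnegative times, where square integrability is known.\<close>
  have q: "L2_on lebesgue (\<lambda>x. (z (t + h) x - z t x) / h - z' x)"
    if "\<And>r. 0 \<le> r \<Longrightarrow> L2_on lebesgue (z r)" "L2_on lebesgue z'" "\<bar>h\<bar> < t" for z h and z' :: "'a \<Rightarrow> real"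
    using L2_on_diff[OF L2_on_cmult[OF L2_on_diff[OF that(1)[of "t + h"] that(1)[of t]], of "1 / h"] that(2)] that(3) by simp
  show ?thesis
    unfolding L2_has_time_derivative_def Lnorm_2_eq_L2norm
  proof (rule Lim_null_comparison[OF _ lim])
    have "norm (?N (\<lambda>x. (u (t + h) x - v (t + h) x - (u t x - v t x)) / h - (u' x - v' x))) \<le>
        ?N (\<lambda>x. (u (t + h) x - u t x) / h - u' x) + ?N (\<lambda>x. (v (t + h) x - v t x) / h - v' x)"
      if "\<bar>h\<bar> < t" for h
    proof -
      have "?N (\<lambda>x. (u (t + h) x - v (t + h) x - (u t x - v t x)) / h - (u' x - v' x)) =
          ?N (\<lambda>x. ((u (t + h) x - u t x) / h - u' x) - ((v (t + h) x - v t x) / h - v' x))"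
        by (intro arg_cong[where f = ?N] ext) (simp add: diff_divide_distrib)
      also have "\<dots> \<le> ?N (\<lambda>x. (u (t + h) x - u t x) / h - u' x) + ?N (\<lambda>x. (v (t + h) x - v t x) / h - v' x)"
        by (intro L2norm_triangle_diff; rule q) (use u v assms(3,4) that in auto)
      finally show ?thesis by simp
    qed
    then show "\<forall>\<^sub>F h in at 0. norm (?N (\<lambda>x. (u (t + h) x - v (t + h) x - (u t x - v t x)) / h - (u' x - v' x))) \<le>
        ?N (\<lambda>x. (u (t + h) x - u t x) / h - u' x) + ?N (\<lambda>x. (v (t + h) x - v t x) / h - v' x)"
      unfolding eventually_at using \<open>0 < t\<close> by (intro exI[of _ t]) (auto simp: dist_real_def)
  qed
qed

lemma set_integral_eq_integral_zero_outside:
  fixes f :: "'a \<Rightarrow> real"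
  assumes "\<And>x. x \<notin> A \<Longrightarrow> f x = 0"
  shows "(LINT x:A|M. f x) = (LINT x|M. f x)"
  unfolding set_lebesgue_integral_def
  using assms by (intro Bochner_Integration.integral_cong) (auto simp: indicator_def)

text \<open>If \<open>u' = - w\<close> and \<open>v' = - z\<close>, the integral is half the
  derivative of the squared norm of the positive part of \<open>u - v\<close>; its sign is the
  monotonicity of the form, read in terms of the values of the operator.\<close>

lemma pLap_pos_part_mono:
  fixes u v :: "'a::euclidean_space \<Rightarrow> real"
  assumes u: "pLap p s \<Omega> u w" and v: "pLap p s \<Omega> v z" and ps: "0 < s" "s < 1" "2 < p"
    and L2: "L2_on lebesgue u" "L2_on lebesgue v"
  shows "(LINT x|lebesgue. max (u x - v x) 0 * (z x - w x)) \<le> 0"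
proof -
  let ?\<phi> = "\<lambda>x. max (u x - v x) 0"
  have uv: "u \<in> W0 p s \<Omega>" "v \<in> W0 p s \<Omega>" using u v by (auto simp: pLap_def)
  have \<phi>: "?\<phi> \<in> W0 p s \<Omega>"
    using W0_pos_part[OF W0_diff[OF uv]] ps by simp
  have wz: "L2_on lebesgue w" "L2_on lebesgue z" "\<And>x. x \<notin> \<Omega> \<Longrightarrow> w x = 0" "\<And>x. x \<notin> \<Omega> \<Longrightarrow> z x = 0"
    using u v by (auto simp: pLap_def L2_on_lebesgue_iff_Lspace)
  have \<phi>2: "L2_on lebesgue ?\<phi>" by (intro L2_on_pos_part L2_on_diff L2)
  have "pLap_form p s u ?\<phi> = (LINT x|lebesgue. w x * ?\<phi> x)" "pLap_form p s v ?\<phi> = (LINT x|lebesgue. z x * ?\<phi> x)"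
    using u v \<phi> wz by (auto simp: pLap_def set_integral_eq_integral_zero_outside)
  then have "(LINT x|lebesgue. z x * ?\<phi> x) \<le> (LINT x|lebesgue. w x * ?\<phi> x)"
    using pLap_form_pos_part_mono[OF uv ps] by simp
  moreover have "(LINT x|lebesgue. ?\<phi> x * (z x - w x)) = (LINT x|lebesgue. ?\<phi> x * z x) - (LINT x|lebesgue. ?\<phi> x * w x)"
    unfolding right_diff_distrib
    by (intro Bochner_Integration.integral_diff L2_on_mult_integrable \<phi>2 wz)
  ultimately show ?thesis by (simp add: mult.commute)
qed

lemma L2_on_uminus: "L2_on M f \<Longrightarrow> L2_on M (\<lambda>x. - f x)"
  using L2_on_cmult[of M f "-1"] by simp

text \<open>The squared norm is differentiated because, unlike the norm, it causes no trouble where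
  it vanishes. Absolute continuity is available only on compact intervals of positive times, so
  \<open>a = 0\<close> is reached by continuity.\<close>

theorem strong_solution_contraction:
  fixes u v :: "real \<Rightarrow> 'a::euclidean_space \<Rightarrow> real"
  assumes u: "strong_solution p s \<Omega> u" and v: "strong_solution p s \<Omega> v"
    and ps: "0 < s" "s < 1" "2 < p" and "0 \<le> a" "a \<le> b"
  shows "L2norm lebesgue (\<lambda>x. max (u b x - v b x) 0) \<le> L2norm lebesgue (\<lambda>x. max (u a x - v a x) 0)"
proof -
  let ?L = "L2_on lebesgue"
  define w where "w r x = u r x - v r x" for r x
  define N where "N r = L2norm lebesgue (\<lambda>x. max (w r x) 0)" for r
  define d where "d r t = L2norm lebesgue (\<lambda>x. u r x - u t x) + L2norm lebesgue (\<lambda>x. v r x - v t x)" for r t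
  have uL: "?L (u r)" and vL: "?L (v r)" if "0 \<le> r" for r
    using strong_solution_L2[OF u that] strong_solution_L2[OF v that] by auto
  have wL: "?L (w r)" if "0 \<le> r" for r unfolding w_def by (intro L2_on_diff uL vL that)
  have N0: "0 \<le> N r" for r by (simp add: N_def)
  have N_diff: "N r \<le> N t + d r t" if "0 \<le> r" "0 \<le> t" for r t
  proof -
    have "N r \<le> N t + L2norm lebesgue (\<lambda>x. w r x - w t x)"
      unfolding N_def by (intro L2norm_pos_part_le wL that)
    also have "L2norm lebesgue (\<lambda>x. w r x - w t x) = L2norm lebesgue (\<lambda>x. (u r x - u t x) - (v r x - v t x))"
      by (simp add: w_def algebra_simps)
    also have "\<dots> \<le> d r t"
      unfolding d_def by (intro L2norm_triangle_diff L2_on_diff uL vL that)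
    finally show ?thesis by simp
  qed
  have d_commute: "d r t = d t r" for r t
    by (simp add: d_def L2norm_commute_diff[of _ "u r"] L2norm_commute_diff[of _ "v r"])
  have d_lim: "((\<lambda>r. d r t) \<longlongrightarrow> 0) (at t within {0..})" if "0 \<le> t" for t
    unfolding d_def using tendsto_add[OF strong_solution_continuous[OF u that] strong_solution_continuous[OF v that]] by simp
  have N_cont: "(N \<longlongrightarrow> N t) (at t within {0..})" if "0 \<le> t" for t
  proof (rule LIM_zero_cancel)
    show "((\<lambda>r. N r - N t) \<longlongrightarrow> 0) (at t within {0..})"
    proof (rule Lim_null_comparison[OF _ d_lim[OF that]])
      have "\<bar>N r - N t\<bar> \<le> d r t" if "0 \<le> r" for r
        using N_diff[OF that \<open>0 \<le> t\<close>] N_diff[OF \<open>0 \<le> t\<close> that] d_commute[of r t] by linarith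
      then show "\<forall>\<^sub>F r in at t within {0..}. norm (N r - N t) \<le> d r t"
        by (auto simp: eventually_at_filter)
    qed
  qed
  have decreasing: "N b \<le> N a" if ab: "0 < a" "a < b" for a b
  proof -
    have "continuous_on {a..b} N"
      unfolding continuous_on_def using N_cont ab
      by (auto intro: tendsto_within_subset[where T = "{a..b}" and S = "{0..}"])
    then have "compact (N ` {a..b})" by (intro compact_continuous_image) auto
    \<comment> \<open>A bound for the norms on \<open>{a..b}\<close> makes squaring Lipschitz there,
      with constant \<open>2 * R\<close>; this carries absolute continuity over to the
      squares.\<close>
    then obtain R where R: "0 < R" "\<And>r. r \<in> {a..b} \<Longrightarrow> N r \<le> R"
      using compact_imp_bounded bounded_pos by (metis abs_le_D1 imageI real_norm_def)
    have sq: "\<bar>(N r)\<^sup>2 - (N l)\<^sup>2\<bar> \<le> 2 * R * d r l" if "l \<in> {a..b}" "r \<in> {a..b}" for l r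
    proof -
      have "\<bar>(N r)\<^sup>2 - (N l)\<^sup>2\<bar> = (N r + N l) * \<bar>N r - N l\<bar>"
        using N0[of r] N0[of l] by (simp add: power2_eq_square square_diff_square_factored abs_mult)
      also have "\<dots> \<le> (2 * R) * d r l"
        using R(2)[OF that(1)] R(2)[OF that(2)] N0 R(1) N_diff[of r l] N_diff[of l r] d_commute[of r l] that ab
        by (intro mult_mono) (auto simp: abs_le_iff)
      finally show ?thesis .
    qed
    obtain N1 where N1: "N1 \<in> null_sets lebesgue" "\<And>t. t \<notin> N1 \<Longrightarrow> 0 < t \<Longrightarrow>
        \<exists>w. pLap p s \<Omega> (u t) w \<and> L2_has_time_derivative u (\<lambda>x. - w x) t"
      by (rule strong_solution_derivative_null_setE[OF u]) blast
    obtain N2 where N2: "N2 \<in> null_sets lebesgue" "\<And>t. t \<notin> N2 \<Longrightarrow> 0 < t \<Longrightarrow>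
        \<exists>w. pLap p s \<Omega> (v t) w \<and> L2_has_time_derivative v (\<lambda>x. - w x) t"
      by (rule strong_solution_derivative_null_setE[OF v]) blast
    have "(N b)\<^sup>2 \<le> (N a)\<^sup>2"
    proof (rule abs_continuous_deriv_nonpos_imp_le[where g = "\<lambda>r. (N r)\<^sup>2" and N = "N1 \<union> N2"])
      show "N1 \<union> N2 \<in> null_sets lebesgue" using N1 N2 by (intro null_sets.Un)
      fix t assume t: "t \<in> {a..b}" "t \<notin> N1 \<union> N2"
      then have "0 < t" using ab by auto
      obtain f where f: "pLap p s \<Omega> (u t) f" "L2_has_time_derivative u (\<lambda>x. - f x) t"
        using N1(2) t \<open>0 < t\<close> by blast
      obtain g where g: "pLap p s \<Omega> (v t) g" "L2_has_time_derivative v (\<lambda>x. - g x) t"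
        using N2(2) t \<open>0 < t\<close> by blast
      have fg: "?L f" "?L g" using f(1) g(1) by (auto simp: pLap_def L2_on_lebesgue_iff_Lspace)
      have "L2_has_time_derivative w (\<lambda>x. - f x - - g x) t"
        unfolding w_def by (intro L2_has_time_derivative_diff uL vL L2_on_uminus fg \<open>0 < t\<close> f g)
      then have "L2_has_time_derivative w (\<lambda>x. g x - f x) t" by (simp add: add.commute)
      then have "((\<lambda>r. (N r)\<^sup>2) has_real_derivative 2 * (LINT x|lebesgue. max (w t x) 0 * (g x - f x))) (at t)"
        unfolding N_def by (intro L2norm_square_pos_part_has_derivative wL L2_on_diff fg \<open>0 < t\<close>)
      moreover have "(LINT x|lebesgue. max (w t x) 0 * (g x - f x)) \<le> 0"
        unfolding w_def using \<open>0 < t\<close> by (intro pLap_pos_part_mono[OF f(1) g(1) ps] uL vL) auto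
      ultimately show "\<exists>D\<le>0. ((\<lambda>r. (N r)\<^sup>2) has_real_derivative D) (at t)"
        by (intro exI[of _ "2 * (LINT x|lebesgue. max (w t x) 0 * (g x - f x))"]) auto
    next
      fix \<epsilon> :: real assume "0 < \<epsilon>"
      \<comment> \<open>Two orbits and the factor \<open>2 * R\<close> share the tolerance:
        \<open>2 * R * (\<epsilon>' + \<epsilon>') = \<epsilon>\<close>.\<close>
      define \<epsilon>' where "\<epsilon>' = \<epsilon> / (4 * R)"
      have "0 < \<epsilon>'" using \<open>0 < \<epsilon>\<close> R by (simp add: \<epsilon>'_def)
      obtain \<delta>1 where \<delta>1: "\<delta>1 > 0" "\<And>P. finite P \<Longrightarrow> (\<forall>(l, r)\<in>P. a \<le> l \<and> l \<le> r \<and> r \<le> b) \<Longrightarrow>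
          disjoint_family_on (\<lambda>(l, r). {l<..<r}) P \<Longrightarrow> (\<Sum>(l, r)\<in>P. r - l) < \<delta>1 \<Longrightarrow>
          (\<Sum>(l, r)\<in>P. Lnorm 2 (\<lambda>x. u r x - u l x)) < \<epsilon>'"
        by (rule L2_abs_continuous_onE[OF strong_solution_abs_continuous[OF u ab] \<open>0 < \<epsilon>'\<close>]) blast
      obtain \<delta>2 where \<delta>2: "\<delta>2 > 0" "\<And>P. finite P \<Longrightarrow> (\<forall>(l, r)\<in>P. a \<le> l \<and> l \<le> r \<and> r \<le> b) \<Longrightarrow>
          disjoint_family_on (\<lambda>(l, r). {l<..<r}) P \<Longrightarrow> (\<Sum>(l, r)\<in>P. r - l) < \<delta>2 \<Longrightarrow>
          (\<Sum>(l, r)\<in>P. Lnorm 2 (\<lambda>x. v r x - v l x)) < \<epsilon>'"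
        by (rule L2_abs_continuous_onE[OF strong_solution_abs_continuous[OF v ab] \<open>0 < \<epsilon>'\<close>]) blast
      show "\<exists>\<delta>>0. \<forall>P. finite P \<and> (\<forall>(l, r)\<in>P. a \<le> l \<and> l \<le> r \<and> r \<le> b) \<and>
          disjoint_family_on (\<lambda>(l, r). {l<..<r}) P \<and> (\<Sum>(l, r)\<in>P. r - l) < \<delta> \<longrightarrow>
          (\<Sum>(l, r)\<in>P. \<bar>(N r)\<^sup>2 - (N l)\<^sup>2\<bar>) < \<epsilon>"
      proof (intro exI[of _ "min \<delta>1 \<delta>2"] conjI allI impI, goal_cases)
        case 1
        then show ?case using \<delta>1(1) \<delta>2(1) by simp
      next
        case (2 P)
        have "(\<Sum>(l, r)\<in>P. \<bar>(N r)\<^sup>2 - (N l)\<^sup>2\<bar>) \<le> (\<Sum>(l, r)\<in>P. 2 * R * d r l)"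
          using 2 by (intro sum_mono) (auto intro!: sq)
        also have "\<dots> = 2 * R * ((\<Sum>(l, r)\<in>P. Lnorm 2 (\<lambda>x. u r x - u l x)) + (\<Sum>(l, r)\<in>P. Lnorm 2 (\<lambda>x. v r x - v l x)))"
          by (simp add: d_def Lnorm_2_eq_L2norm sum_distrib_left sum.distrib case_prod_unfold distrib_left)
        also have "\<dots> < 2 * R * (\<epsilon>' + \<epsilon>')"
          using R(1) 2 by (intro mult_strict_left_mono add_strict_mono \<delta>1(2) \<delta>2(2)) auto
        also have "\<dots> = \<epsilon>" using R(1) by (simp add: \<epsilon>'_def)
        finally show ?case .
      qed
    qed (use ab in auto)
    then show ?thesis using N0 power2_le_imp_le by blast
  qed
  have "N b \<le> N a"
  proof (cases "0 < a \<or> a = b")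
    case True
    then show ?thesis using decreasing[of a b] \<open>a \<le> b\<close> by (cases "a = b") auto
  next
    case False
    then have "a = 0" "0 < b" using \<open>0 \<le> a\<close> \<open>a \<le> b\<close> by auto
    have "(N \<longlongrightarrow> N 0) (at_right 0)"
      using N_cont[of 0] by (rule tendsto_within_subset) auto
    moreover have "\<forall>\<^sub>F r in at_right 0. N b \<le> N r"
      unfolding eventually_at_right_field using \<open>0 < b\<close> decreasing by blast
    ultimately show ?thesis
      using \<open>a = 0\<close> tendsto_lowerbound[of N "N 0" "at_right 0" "N b"] by simp
  qed
  then show ?thesis by (simp add: N_def w_def)
qed

section \<open>Comparison with the friendly giant\<close>

text \<open>The form is homogeneous of degree \<open>p - 1\<close> in its first argument, which
  makes separation of variables produce the friendly giant.\<close>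

lemma pLap_cmult:
  assumes u: "pLap p s \<Omega> u w" and "0 < c"
  shows "pLap p s \<Omega> (\<lambda>x. c * u x) (\<lambda>x. c powr (p - 1) * w x)"
  unfolding pLap_def
proof (intro conjI ballI)
  show "(\<lambda>x. c * u x) \<in> W0 p s \<Omega>" using u by (auto simp: pLap_def intro: W0_cmult)
  show "(\<lambda>x. c powr (p - 1) * w x) \<in> Lspace 2 \<Omega>"
    using u by (auto simp: pLap_def L2_on_lebesgue_iff_Lspace intro: L2_on_cmult)
  fix \<phi> assume "\<phi> \<in> W0 p s \<Omega>"
  then have eq: "pLap_form p s u \<phi> = (LINT x:\<Omega>|lebesgue. w x * \<phi> x)" using u by (auto simp: pLap_def)
  have c: "c powr (p - 2) * c = c powr (p - 1)"
    using powr_add[of c "p - 2" 1] \<open>0 < c\<close> by simp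
  have "pLap_integrand p s (\<lambda>x. c * u x) \<phi> z = c powr (p - 1) * pLap_integrand p s u \<phi> z" for z
    using \<open>0 < c\<close>
    by (simp add: pLap_integrand_def right_diff_distrib[symmetric] abs_mult powr_mult c[symmetric] mult_ac)
  then have "pLap_form p s (\<lambda>x. c * u x) \<phi> = c powr (p - 1) * pLap_form p s u \<phi>"
    by (simp add: pLap_form_eq_integrand)
  then show "pLap_form p s (\<lambda>x. c * u x) \<phi> = (LINT x:\<Omega>|lebesgue. c powr (p - 1) * w x * \<phi> x)"
    by (simp add: eq set_lebesgue_integral_def mult.assoc mult.left_commute[of _ "c powr (p - 1)"])
qed

text \<open>The form is odd in its first argument, so every upper bound for strong solutions yields
  a lower one.\<close>

lemma pLap_uminus:
  assumes u: "pLap p s \<Omega> u w"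
  shows "pLap p s \<Omega> (\<lambda>x. - u x) (\<lambda>x. - w x)"
  unfolding pLap_def
proof (intro conjI ballI)
  show "(\<lambda>x. - u x) \<in> W0 p s \<Omega>" using u W0_cmult[of u p s \<Omega> "-1"] by (auto simp: pLap_def)
  show "(\<lambda>x. - w x) \<in> Lspace 2 \<Omega>"
    using u by (auto simp: pLap_def L2_on_lebesgue_iff_Lspace intro: L2_on_uminus)
  fix \<phi> assume "\<phi> \<in> W0 p s \<Omega>"
  then have eq: "pLap_form p s u \<phi> = (LINT x:\<Omega>|lebesgue. w x * \<phi> x)" using u by (auto simp: pLap_def)
  have neg: "- u x - - u y = - (u x - u y)" for x y by simp
  have "pLap_integrand p s (\<lambda>x. - u x) \<phi> z = - pLap_integrand p s u \<phi> z" for z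
    unfolding pLap_integrand_def neg
    by (simp only: abs_minus_cancel mult_minus_right mult_minus_left minus_divide_left)
  then have "pLap_form p s (\<lambda>x. - u x) \<phi> = - pLap_form p s u \<phi>"
    by (simp add: pLap_form_eq_integrand)
  then show "pLap_form p s (\<lambda>x. - u x) \<phi> = (LINT x:\<Omega>|lebesgue. - w x * \<phi> x)"
    by (simp add: eq set_lebesgue_integral_def)
qed

lemma L2norm_uminus: "L2norm M (\<lambda>x. - f x) = L2norm M f"
  by (simp add: L2norm_def)

lemma strong_solution_uminus:
  assumes v: "strong_solution p s \<Omega> v"
  shows "strong_solution p s \<Omega> (\<lambda>t x. - v t x)"
proof -
  have diff: "L2norm lebesgue (\<lambda>x. - v r x - - v t x) = L2norm lebesgue (\<lambda>x. v r x - v t x)" for r t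
    by (simp add: L2norm_def power2_commute)
  have deriv: "L2_has_time_derivative (\<lambda>t x. - v t x) (\<lambda>x. - w x) t"
    if "L2_has_time_derivative v w t" for w t
  proof -
    have "(- v (t + h) x - - v t x) / h - - w x = - ((v (t + h) x - v t x) / h - w x)" for h x
      by (simp add: diff_divide_distrib)
    then show ?thesis
      using that by (simp only: L2_has_time_derivative_def Lnorm_2_eq_L2norm L2norm_uminus)
  qed
  have neg: "\<exists>z. pLap p s \<Omega> (\<lambda>x. - v t x) z \<and> L2_has_time_derivative (\<lambda>t x. - v t x) (\<lambda>x. - z x) t"
    if "\<exists>w. pLap p s \<Omega> (v t) w \<and> L2_has_time_derivative v (\<lambda>x. - w x) t" for t
    using that deriv pLap_uminus by blast
  have "AE t in lebesgue. 0 < t \<longrightarrow>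
      (\<exists>z. pLap p s \<Omega> (\<lambda>x. - v t x) z \<and> L2_has_time_derivative (\<lambda>t x. - v t x) (\<lambda>x. - z x) t)"
    using v neg unfolding strong_solution_def by (auto elim!: AE_mp)
  moreover have "\<exists>z. pLap p s \<Omega> (\<lambda>x. - v t x) z" if "0 < t" for t
    using v that pLap_uminus unfolding strong_solution_def by blast
  moreover have "L2_continuous (\<lambda>t x. - v t x)"
    unfolding L2_continuous_def Lnorm_2_eq_L2norm diff using strong_solution_continuous[OF v] by blast
  moreover have "L2_abs_continuous_on a b (\<lambda>t x. - v t x)" if "0 < a" "a < b" for a b
    using strong_solution_abs_continuous[OF v that]
    by (simp only: L2_abs_continuous_on_def Lnorm_2_eq_L2norm diff)
  moreover have "(\<lambda>x. - v t x) \<in> Lspace 2 \<Omega>" if "0 \<le> t" for t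
    using strong_solution_L2[OF v that] strong_solution_zero[OF v that]
    by (auto simp: L2_on_lebesgue_iff_Lspace intro: L2_on_uminus)
  ultimately show ?thesis unfolding strong_solution_def by blast
qed

lemma positive_profile_L2:
  assumes "positive_profile p s \<Omega> F" "2 < p"
  shows "L2_on lebesgue F"
proof -
  have "L2_on lebesgue (\<lambda>x. F x / (p - 2))"
    using assms by (auto simp: positive_profile_def pLap_def L2_on_lebesgue_iff_Lspace)
  from L2_on_cmult[OF this, of "p - 2"] show ?thesis using assms(2) by simp
qed

text \<open>The shift moves the singularity of the giant to the negative time \<open>- T\<close>, so
  that the orbit starts from square integrable data.\<close>

lemma friendly_giant_strong_solution:
  fixes F :: "'a::euclidean_space \<Rightarrow> real"
  assumes F: "positive_profile p s \<Omega> F" and p: "2 < p" and "0 < T"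
  shows "strong_solution p s \<Omega> (\<lambda>t x. friendly_giant p F x (t + T))"
proof -
  let ?N = "L2norm lebesgue"
  let ?U = "\<lambda>t x. friendly_giant p F x (t + T)"
  define a where "a = 1 / (p - 2)"
  have a: "0 < a" "a * (p - 2) = 1" using p by (auto simp: a_def)
  define c where "c t = (t + T) powr (- a)" for t
  have U: "?U t = (\<lambda>x. c t * F x)" for t by (simp add: friendly_giant_def c_def a_def)
  have cpos: "0 < c t" if "0 \<le> t" for t using that \<open>0 < T\<close> by (simp add: c_def)
  have FL: "L2_on lebesgue F" by (rule positive_profile_L2[OF F p])
  have dc: "(c has_real_derivative - a * (t + T) powr (- a - 1)) (at t)" if "0 \<le> t" for t
    unfolding c_def using that \<open>0 < T\<close> by (auto intro!: derivative_eq_intros)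
  have diff: "?N (\<lambda>x. c r * F x - c t * F x) = \<bar>c r - c t\<bar> * ?N F" for r t
    using L2norm_cmult[of lebesgue "c r - c t" F] by (simp add: left_diff_distrib)
  have pL: "pLap p s \<Omega> (\<lambda>x. c t * F x) (\<lambda>x. c t powr (p - 1) * (F x / (p - 2)))" if "0 \<le> t" for t
    using F cpos[OF that] by (intro pLap_cmult) (auto simp: positive_profile_def)
  \<comment> \<open>Separation of variables asks for \<open>c' = - c^(p-1) / (p-2)\<close>. It holds
    because \<open>a * (p - 2) = 1\<close> turns the exponent \<open>- a * (p - 1)\<close> into
    \<open>- a - 1\<close>.\<close>
  have cpow: "c t powr (p - 1) / (p - 2) = a * (t + T) powr (- a - 1)" for t
  proof -
    have "- a * (p - 1) = - a - 1" using a(2) by (simp add: algebra_simps)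
    then show ?thesis by (simp add: c_def powr_powr a_def)
  qed
  have "L2_has_time_derivative (\<lambda>t x. c t * F x) (\<lambda>x. - (c t powr (p - 1) * (F x / (p - 2)))) t" if "0 < t" for t
  proof -
    have "(c (t + h) * F x - c t * F x) / h - - (c t powr (p - 1) * (F x / (p - 2))) =
        ((c (t + h) - c t) / h - - (c t powr (p - 1) / (p - 2))) * F x" for h x
      by (simp add: algebra_simps diff_divide_distrib)
    then have "?N (\<lambda>x. (c (t + h) * F x - c t * F x) / h - - (c t powr (p - 1) * (F x / (p - 2)))) =
        \<bar>(c (t + h) - c t) / h - - (c t powr (p - 1) / (p - 2))\<bar> * ?N F" for h
      by (simp only: L2norm_cmult)
    moreover have "((\<lambda>h. (c (t + h) - c t) / h) \<longlongrightarrow> - (c t powr (p - 1) / (p - 2))) (at 0)"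
      using dc[of t] that unfolding cpow DERIV_def by simp
    then have "((\<lambda>h. \<bar>(c (t + h) - c t) / h - - (c t powr (p - 1) / (p - 2))\<bar> * ?N F) \<longlongrightarrow> 0) (at 0)"
      by (intro tendsto_mult_left_zero tendsto_rabs_zero) (use LIM_zero in blast)
    ultimately show ?thesis
      by (simp only: L2_has_time_derivative_def Lnorm_2_eq_L2norm)
  qed
  then have "AE t in lebesgue. 0 < t \<longrightarrow>
      (\<exists>w. pLap p s \<Omega> (\<lambda>x. c t * F x) w \<and> L2_has_time_derivative (\<lambda>t x. c t * F x) (\<lambda>x. - w x) t)"
    using pL[OF less_imp_le] by (intro AE_I2 impI exI conjI) auto
  moreover have "\<exists>w. pLap p s \<Omega> (\<lambda>x. c t * F x) w" if "0 < t" for t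
    using pL[of t] that by auto
  moreover have "L2_continuous (\<lambda>t x. c t * F x)"
    unfolding L2_continuous_def Lnorm_2_eq_L2norm diff
  proof (intro allI impI tendsto_mult_left_zero tendsto_rabs_zero)
    fix t :: real assume "0 \<le> t"
    have "(c \<longlongrightarrow> c t) (at t)" using DERIV_isCont[OF dc[OF \<open>0 \<le> t\<close>]] by (simp add: isCont_def)
    then have "(c \<longlongrightarrow> c t) (at t within {0..})" by (rule tendsto_within_subset) auto
    then show "((\<lambda>r. c r - c t) \<longlongrightarrow> 0) (at t within {0..})" by (rule LIM_zero)
  qed
  moreover have "L2_abs_continuous_on a' b (\<lambda>t x. c t * F x)" if "0 < a'" "a' < b" for a' b
    unfolding L2_abs_continuous_on_def Lnorm_2_eq_L2norm diff
  proof (intro allI impI)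
    fix \<epsilon> :: real assume "0 < \<epsilon>"
    \<comment> \<open>The largest value of \<open>|c'|\<close> on the nonnegative times, attained at
      0; it is a Lipschitz constant of \<open>c\<close>.\<close>
    define K where "K = a * T powr (- a - 1)"
    have K: "0 \<le> K" using a by (simp add: K_def)
    have lip: "\<bar>c r - c l\<bar> \<le> K * (r - l)" if "0 \<le> l" "l \<le> r" for l r
    proof -
      have "norm (c r - c l) \<le> K * norm (r - l)"
      proof (rule field_differentiable_bound[of "{0..}" c "\<lambda>t. - a * (t + T) powr (- a - 1)"])
        show "(c has_field_derivative - a * (z + T) powr (- a - 1)) (at z within {0..})" if "z \<in> {0..}" for z
          using dc[of z] that by (auto intro: has_field_derivative_at_within)
        show "norm (- a * (z + T) powr (- a - 1)) \<le> K" if "z \<in> {0..}" for z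
          using that a \<open>0 < T\<close> unfolding K_def by (auto simp: abs_mult intro!: mult_left_mono powr_mono2')
      qed (use that in auto)
      then show ?thesis using that by simp
    qed
    show "\<exists>\<delta>>0. \<forall>P. finite P \<and> (\<forall>(l, r)\<in>P. a' \<le> l \<and> l \<le> r \<and> r \<le> b) \<and>
        disjoint_family_on (\<lambda>(l, r). {l<..<r}) P \<and> (\<Sum>(l, r)\<in>P. r - l) < \<delta> \<longrightarrow>
        (\<Sum>(l, r)\<in>P. \<bar>c r - c l\<bar> * ?N F) < \<epsilon>"
    \<comment> \<open>The summand 1 rules out division by 0.\<close>
    proof (intro exI[of _ "\<epsilon> / (K * ?N F + 1)"] conjI allI impI, goal_cases)
      case 1
      then show ?case using \<open>0 < \<epsilon>\<close> K by (intro divide_pos_pos add_nonneg_pos mult_nonneg_nonneg) auto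
    next
      case (2 P)
      have pos: "0 < K * ?N F + 1" using K by (intro add_nonneg_pos mult_nonneg_nonneg) auto
      have nn: "0 \<le> (\<Sum>(l, r)\<in>P. r - l)" using 2 by (intro sum_nonneg) auto
      have "(\<Sum>(l, r)\<in>P. \<bar>c r - c l\<bar> * ?N F) \<le> (\<Sum>(l, r)\<in>P. K * ?N F * (r - l))"
      proof (intro sum_mono, clarify)
        fix l r assume "(l, r) \<in> P"
        then have "0 \<le> l" "l \<le> r" using 2 that by fastforce+
        from mult_right_mono[OF lip[OF this], of "?N F"] show "\<bar>c r - c l\<bar> * ?N F \<le> K * ?N F * (r - l)"
          by (simp add: mult_ac)
      qed
      also have "\<dots> = K * ?N F * (\<Sum>(l, r)\<in>P. r - l)"
        by (simp add: sum_distrib_left case_prod_unfold)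
      also have "\<dots> \<le> (K * ?N F + 1) * (\<Sum>(l, r)\<in>P. r - l)" using nn by (simp add: distrib_right)
      also have "\<dots> < \<epsilon>" using 2 pos by (simp add: pos_less_divide_eq mult.commute)
      finally show ?case .
    qed
  qed
  moreover have "(\<lambda>x. c t * F x) \<in> Lspace 2 \<Omega>" if "0 \<le> t" for t
    using FL F by (auto simp: L2_on_lebesgue_iff_Lspace positive_profile_def intro: L2_on_cmult)
  ultimately show ?thesis unfolding strong_solution_def U by blast
qed

lemma friendly_giant_antimono:
  assumes "2 < p" "0 < t" "t \<le> r" "0 \<le> F x"
  shows "friendly_giant p F x r \<le> friendly_giant p F x t"
  unfolding friendly_giant_def using assms
  by (intro mult_right_mono powr_mono2') (auto simp: divide_nonneg_pos)

lemma L2norm_pos_part_0_imp_AE_le: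
  assumes "L2_on M f" "L2_on M g" "L2norm M (\<lambda>x. max (f x - g x) 0) = 0"
  shows "AE x in M. f x \<le> g x"
proof -
  have "(LINT x|M. (max (f x - g x) 0)\<^sup>2) = 0" using assms(3) by (simp add: L2norm_square[symmetric])
  then have "AE x in M. (max (f x - g x) 0)\<^sup>2 = 0"
    using integral_nonneg_eq_0_iff_AE[OF L2_on_integrable_square[OF L2_on_pos_part[OF L2_on_diff[OF assms(1,2)]]]]
    by simp
  then show ?thesis by eventually_elim (auto simp: max_def split: if_splits)
qed

lemma strong_solution_le_friendly_giant:
  fixes v :: "real \<Rightarrow> 'a::euclidean_space \<Rightarrow> real"
  assumes v: "strong_solution p s \<Omega> v" and F: "positive_profile p s \<Omega> F"
    and ps: "0 < s" "s < 1" "2 < p" and "0 < t"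
  shows "AE x in lebesgue. v t x \<le> friendly_giant p F x t"
proof -
  let ?N = "L2norm lebesgue"
  have FL: "L2_on lebesgue F" by (rule positive_profile_L2[OF F ps(3)])
  have UL: "L2_on lebesgue (\<lambda>x. friendly_giant p F x t)" for t
    unfolding friendly_giant_def by (rule L2_on_cmult[OF FL])
  have vL: "L2_on lebesgue (v r)" if "0 \<le> r" for r by (rule strong_solution_L2[OF v that])
  have F0: "0 \<le> F x" for x using F by (cases "x \<in> \<Omega>") (auto simp: positive_profile_def less_imp_le)
  \<comment> \<open>Chosen so that the giant at time \<open>\<epsilon> n\<close> is exactly
    \<open>real (Suc n) * F\<close>.\<close>
  define \<epsilon> where "\<epsilon> n = real (Suc n) powr - (p - 2)" for n
  have \<epsilon>: "0 < \<epsilon> n" for n by (simp add: \<epsilon>_def)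
  have U\<epsilon>: "friendly_giant p F x (\<epsilon> n) = real (Suc n) * F x" for n x
  proof -
    have "- (p - 2) * (- 1 / (p - 2)) = 1" using ps by (simp add: field_simps)
    then show ?thesis by (simp only: friendly_giant_def \<epsilon>_def powr_powr) simp
  qed
  have bound: "?N (\<lambda>x. max (v t x - friendly_giant p F x t) 0) \<le> ?N (\<lambda>x. max (v 0 x - real (Suc n) * F x) 0)" for n
  proof -
    \<comment> \<open>The giant decreases in time, so the delay only enlarges the positive part, and
      the delayed giant can be compared with \<open>v\<close> from time 0 on.\<close>
    have "?N (\<lambda>x. max (v t x - friendly_giant p F x t) 0) \<le> ?N (\<lambda>x. max (v t x - friendly_giant p F x (t + \<epsilon> n)) 0)"
    proof (rule L2norm_mono)
      show "L2_on lebesgue (\<lambda>x. max (v t x - friendly_giant p F x (t + \<epsilon> n)) 0)"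
        using \<open>0 < t\<close> by (intro L2_on_pos_part L2_on_diff vL UL) auto
      show "(\<lambda>x. max (v t x - friendly_giant p F x t) 0) \<in> borel_measurable lebesgue"
        using \<open>0 < t\<close> by (intro L2_onD L2_on_pos_part L2_on_diff vL UL) auto
      show "AE x in lebesgue. \<bar>max (v t x - friendly_giant p F x t) 0\<bar> \<le> \<bar>max (v t x - friendly_giant p F x (t + \<epsilon> n)) 0\<bar>"
      proof (rule AE_I2)
        fix x
        have "friendly_giant p F x (t + \<epsilon> n) \<le> friendly_giant p F x t"
          using ps \<open>0 < t\<close> \<epsilon>[of n] F0 by (intro friendly_giant_antimono) auto
        then show "\<bar>max (v t x - friendly_giant p F x t) 0\<bar> \<le> \<bar>max (v t x - friendly_giant p F x (t + \<epsilon> n)) 0\<bar>"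
          by linarith
      qed
    qed
    also have "\<dots> \<le> ?N (\<lambda>x. max (v 0 x - friendly_giant p F x (0 + \<epsilon> n)) 0)"
      using \<open>0 < t\<close> by (intro strong_solution_contraction[OF v friendly_giant_strong_solution[OF F ps(3) \<epsilon>] ps]) auto
    finally show ?thesis by (simp only: add_0 U\<epsilon>)
  qed
  \<comment> \<open>Inside the domain \<open>F > 0\<close>, so the integrand is eventually 0 at each
    point; outside, both functions vanish. The square of the data dominates.\<close>
  have "(\<lambda>n. LINT x|lebesgue. (max (v 0 x - real (Suc n) * F x) 0)\<^sup>2) \<longlonglongrightarrow> (LINT x|(lebesgue :: 'a measure). (0::real))"
  proof (rule integral_dominated_convergence[where w = "\<lambda>x. (v 0 x)\<^sup>2"])
    note [measurable] = L2_onD[OF FL] L2_onD[OF vL[OF order_refl]]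
    show "(\<lambda>x. (max (v 0 x - real (Suc n) * F x) 0)\<^sup>2) \<in> borel_measurable lebesgue" for n by measurable
    show "integrable lebesgue (\<lambda>x. (v 0 x)\<^sup>2)" by (rule L2_on_integrable_square[OF vL]) simp
    show "AE x in lebesgue. norm ((max (v 0 x - real (Suc n) * F x) 0)\<^sup>2) \<le> (v 0 x)\<^sup>2" for n
    proof (rule AE_I2)
      fix x
      have "0 \<le> real (Suc n) * F x" using F0 by (intro mult_nonneg_nonneg) auto
      then have "\<bar>max (v 0 x - real (Suc n) * F x) 0\<bar> \<le> \<bar>v 0 x\<bar>" by linarith
      then show "norm ((max (v 0 x - real (Suc n) * F x) 0)\<^sup>2) \<le> (v 0 x)\<^sup>2" unfolding abs_le_square_iff by simp
    qed
    show "AE x in lebesgue. (\<lambda>n. (max (v 0 x - real (Suc n) * F x) 0)\<^sup>2) \<longlonglongrightarrow> 0"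
    proof (rule AE_I2)
      fix x
      show "(\<lambda>n. (max (v 0 x - real (Suc n) * F x) 0)\<^sup>2) \<longlonglongrightarrow> 0"
      proof (cases "x \<in> \<Omega>")
        case True
        then have "0 < F x" using F by (auto simp: positive_profile_def)
        obtain m :: nat where m: "v 0 x / F x < real m" using reals_Archimedean2 by blast
        have "max (v 0 x - real (Suc n) * F x) 0 = 0" if "m \<le> n" for n
        proof -
          have "v 0 x < real m * F x" using m \<open>0 < F x\<close> by (simp add: pos_divide_less_eq)
          also have "\<dots> \<le> real (Suc n) * F x" using that \<open>0 < F x\<close> by (intro mult_right_mono) auto
          finally show ?thesis by simp
        qed
        then show ?thesis
          by (intro tendsto_eventually) (auto simp: eventually_sequentially)
      next
        case False
        then show ?thesis using F strong_solution_zero[OF v order_refl] by (simp add: positive_profile_def)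
      qed
    qed
  qed simp
  then have "(\<lambda>n. sqrt (LINT x|lebesgue. (max (v 0 x - real (Suc n) * F x) 0)\<^sup>2)) \<longlonglongrightarrow> sqrt 0"
    by (intro tendsto_real_sqrt) simp
  then have "(\<lambda>n. ?N (\<lambda>x. max (v 0 x - real (Suc n) * F x) 0)) \<longlonglongrightarrow> 0"
    by (simp only: L2norm_def real_sqrt_zero)
  then have "?N (\<lambda>x. max (v t x - friendly_giant p F x t) 0) \<le> 0"
    using bound by (intro LIMSEQ_le_const) auto
  then have "?N (\<lambda>x. max (v t x - friendly_giant p F x t) 0) = 0" by (intro antisym) auto
  then show ?thesis using \<open>0 < t\<close> by (intro L2norm_pos_part_0_imp_AE_le vL UL) auto
qed

lemma strong_solution_abs_le_friendly_giant:
  fixes v :: "real \<Rightarrow> 'a::euclidean_space \<Rightarrow> real"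
  assumes v: "strong_solution p s \<Omega> v" and F: "positive_profile p s \<Omega> F"
    and ps: "0 < s" "s < 1" "2 < p" and "0 < t"
  shows "AE x in lebesgue. \<bar>v t x\<bar> \<le> friendly_giant p F x t"
  using strong_solution_le_friendly_giant[OF v F ps \<open>0 < t\<close>]
    strong_solution_le_friendly_giant[OF strong_solution_uminus[OF v] F ps \<open>0 < t\<close>]
  by eventually_elim auto

section \<open>Solutions with integrable data\<close>

text \<open>A violation would fill a nonempty open set, which is not a null set. This turns bounds
  almost everywhere into bounds at every point of the domain.\<close>

lemma continuous_AE_le_imp_le:
  fixes f g :: "'a::euclidean_space \<Rightarrow> real"
  assumes "open S" "continuous_on S f" "continuous_on S g" and ae: "AE x in lebesgue. f x \<le> g x"
    and "x \<in> S"
  shows "f x \<le> g x"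
proof (rule ccontr)
  let ?V = "S \<inter> (\<lambda>x. f x - g x) -` {0<..}"
  assume "\<not> f x \<le> g x"
  then have "?V \<noteq> {}" using \<open>x \<in> S\<close> by auto
  moreover have "open ?V"
    using assms by (intro continuous_open_preimage continuous_on_diff) auto
  ultimately have "\<not> negligible ?V" using open_not_negligible by blast
  moreover have "negligible ?V"
  proof -
    obtain N where "N \<in> null_sets lebesgue" "{x \<in> space lebesgue. \<not> f x \<le> g x} \<subseteq> N"
      using ae unfolding eventually_ae_filter by blast
    then have "negligible N" "?V \<subseteq> N" by (auto simp only: negligible_iff_null_sets) auto
    then show ?thesis by (rule negligible_subset)
  qed
  ultimately show False by simp
qed

text \<open>The function is its own product with the indicator of the domain, which is square
  integrable because the domain is bounded.\<close>

lemma L2_on_integrable_of_bounded_support: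
  fixes f :: "'a::euclidean_space \<Rightarrow> real"
  assumes f: "L2_on lebesgue f" and "\<And>x. x \<notin> \<Omega> \<Longrightarrow> f x = 0" and "open \<Omega>" "bounded \<Omega>"
  shows "integrable lebesgue f"
proof -
  have "\<Omega> \<in> lmeasurable" using assms by (intro lmeasurable_open)
  then have "integrable lebesgue (indicator \<Omega> :: 'a \<Rightarrow> real)"
    using lmeasurable_iff_integrable by blast
  then have "L2_on lebesgue (indicator \<Omega> :: 'a \<Rightarrow> real)"
    unfolding L2_on_def
    by (auto simp: power2_eq_square indicator_inter_arith[symmetric] borel_measurable_integrable)
  from L2_on_mult_integrable[OF f this] show ?thesis
    by (rule Bochner_Integration.integrable_cong[THEN iffD1, rotated 2])
      (use assms(2) in \<open>auto simp: indicator_def\<close>)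
qed

lemma Lspace_1_integrable: "f \<in> Lspace 1 \<Omega> \<Longrightarrow> integrable lebesgue f"
  by (auto simp: Lspace_def intro: integrable_abs_cancel)

lemma Lnorm_1_eq: "Lnorm 1 f = (LINT x|lebesgue. \<bar>f x\<bar>)"
  by (simp add: Lnorm_def)

lemma approximation_AE_subseq:
  fixes v :: "nat \<Rightarrow> 'a::euclidean_space \<Rightarrow> real"
  assumes "\<And>n. integrable lebesgue (v n)" "integrable lebesgue u"
    and lim: "(\<lambda>n. Lnorm 1 (\<lambda>x. v n x - u x)) \<longlonglongrightarrow> 0"
  obtains r :: "nat \<Rightarrow> nat" where "strict_mono r" "AE x in lebesgue. (\<lambda>n. v (r n) x) \<longlonglongrightarrow> u x"
proof -
  have "\<exists>r::nat \<Rightarrow> nat. strict_mono r \<and> (AE x in lebesgue. (\<lambda>n. v (r n) x - u x) \<longlonglongrightarrow> 0)"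
    using assms by (intro tendsto_L1_AE_subseq) (auto simp: Lnorm_1_eq)
  then obtain r :: "nat \<Rightarrow> nat" where r: "strict_mono r"
    and ae: "AE x in lebesgue. (\<lambda>n. v (r n) x - u x) \<longlonglongrightarrow> 0" by blast
  have "AE x in lebesgue. (\<lambda>n. v (r n) x) \<longlonglongrightarrow> u x"
    using ae by eventually_elim (rule LIM_zero_cancel)
  then show ?thesis using r that by blast
qed

text \<open>Approximations of a solution are only known to converge in \<open>L^1\<close>. A common
  square integrable bound \<open>b\<close>, later the friendly giant, upgrades convergence almost
  everywhere to convergence of these norms.\<close>

lemma L2norm_pos_part_tendsto:
  assumes [measurable]: "\<And>n. v n \<in> borel_measurable M" "u \<in> borel_measurable M" and z: "L2_on M z" and b: "L2_on M b"
    and le: "\<And>n. AE x in M. \<bar>v n x\<bar> \<le> b x" and lim: "AE x in M. (\<lambda>n. v n x) \<longlonglongrightarrow> u x"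
  shows "(\<lambda>n. L2norm M (\<lambda>x. max (z x - v n x) 0)) \<longlonglongrightarrow> L2norm M (\<lambda>x. max (z x - u x) 0)"
  unfolding L2norm_def
proof (intro tendsto_real_sqrt integral_dominated_convergence[where w = "\<lambda>x. (\<bar>z x\<bar> + \<bar>b x\<bar>)\<^sup>2"])
  note [measurable] = L2_onD[OF z] L2_onD[OF b]
  have abs: "L2_on M (\<lambda>x. \<bar>f x\<bar>)" if "L2_on M f" for f using that by (auto simp: L2_on_def)
  show "integrable M (\<lambda>x. (\<bar>z x\<bar> + \<bar>b x\<bar>)\<^sup>2)"
    by (intro L2_on_integrable_square L2_on_add abs z b)
  show "(\<lambda>x. (max (z x - u x) 0)\<^sup>2) \<in> borel_measurable M" by measurable
  show "(\<lambda>x. (max (z x - v n x) 0)\<^sup>2) \<in> borel_measurable M" for n by measurable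
  show "AE x in M. (\<lambda>n. (max (z x - v n x) 0)\<^sup>2) \<longlonglongrightarrow> (max (z x - u x) 0)\<^sup>2"
    using lim by eventually_elim (intro tendsto_intros)
  show "AE x in M. norm ((max (z x - v n x) 0)\<^sup>2) \<le> (\<bar>z x\<bar> + \<bar>b x\<bar>)\<^sup>2" for n
    using le[of n]
  proof eventually_elim
    case (elim x)
    then have "\<bar>max (z x - v n x) 0\<bar> \<le> \<bar>\<bar>z x\<bar> + \<bar>b x\<bar>\<bar>" by linarith
    then show ?case unfolding abs_le_square_iff by simp
  qed
qed

text \<open>Bernoulli's inequality for an integer exponent \<open>k \<ge> a\<close>, together with
  \<open>(1 - y)^k \<le> (1 - y)^a\<close>.\<close>

lemma one_minus_powr_le:
  fixes a :: real
  assumes "0 \<le> a"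
  obtains k :: nat where "\<And>y. 0 \<le> y \<Longrightarrow> y < 1 \<Longrightarrow> 1 - (1 - y) powr a \<le> real k * y"
proof -
  obtain k :: nat where k: "a \<le> real k" using real_arch_simple by blast
  have "1 - (1 - y) powr a \<le> real k * y" if "0 \<le> y" "y < 1" for y
  proof -
    have "1 + real k * (- y) \<le> (1 + (- y)) ^ k" using that by (intro Bernoulli_inequality) auto
    also have "\<dots> = (1 - y) powr real k" using that by (simp add: powr_realpow)
    also have "\<dots> \<le> (1 - y) powr a" using that k by (intro powr_mono') auto
    finally show ?thesis by simp
  qed
  then show ?thesis using that by blast
qed

lemma bdist_bounded:
  assumes "bounded \<Omega>"
  obtains D where "\<And>x. x \<in> \<Omega> \<Longrightarrow> bdist \<Omega> x \<le> D"
proof (cases "frontier \<Omega> = {}")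
  case True
  \<comment> \<open>By convention \<open>infdist\<close> to the empty set is 0.\<close>
  then show ?thesis using that[of 0] by (simp add: bdist_def infdist_def)
next
  case False
  then obtain y where y: "y \<in> frontier \<Omega>" by blast
  obtain R where R: "\<And>x. x \<in> \<Omega> \<Longrightarrow> dist y x \<le> R" using assms bounded_any_center[of \<Omega> y] by auto
  have "bdist \<Omega> x \<le> R" if "x \<in> \<Omega>" for x
    unfolding bdist_def using infdist_le[OF y, of x] R[OF that] by (simp add: dist_commute)
  then show ?thesis using that by blast
qed

lemma boundary_behaviourE:
  assumes "boundary_behaviour p s \<Omega>" "nonneg_nontrivial_DP_solution p s \<Omega> u0 u" "0 < t"
  obtains c C where "0 < c" "c \<le> C" "\<And>x. x \<in> \<Omega> \<Longrightarrow> c * bdist \<Omega> x powr s \<le> u t x"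
    "\<And>x. x \<in> \<Omega> \<Longrightarrow> u t x \<le> C * bdist \<Omega> x powr s"
proof -
  have "\<exists>c C. 0 < c \<and> c \<le> C \<and>
      (\<forall>x\<in>\<Omega>. c * bdist \<Omega> x powr s \<le> u t x \<and> u t x \<le> C * bdist \<Omega> x powr s)"
    using assms unfolding boundary_behaviour_def by simp
  then show ?thesis using that by blast
qed

section \<open>Solutions of the Dirichlet problem against a fixed profile\<close>

locale dirichlet_profile =
  fixes \<Omega> :: "'a::euclidean_space set" and s p :: real and F :: "'a \<Rightarrow> real"
  assumes s: "0 < s" "s < 1" and p: "2 < p"
    and \<Omega>: "open \<Omega>" "bounded \<Omega>" "\<Omega> \<noteq> {}"
    and F: "positive_profile p s \<Omega> F"
begin

lemmas ps = s p

lemma profile_nonneg: "0 \<le> F x"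
  using F by (cases "x \<in> \<Omega>") (auto simp: positive_profile_def less_imp_le)

lemma friendly_giant_L2: "L2_on lebesgue (\<lambda>x. friendly_giant p F x t)"
  unfolding friendly_giant_def by (intro L2_on_cmult positive_profile_L2[OF F ps(3)])

lemma friendly_giant_continuous: "continuous_on \<Omega> (\<lambda>x. friendly_giant p F x t)"
  using F unfolding friendly_giant_def positive_profile_def by (auto intro: continuous_on_mult_left)

lemma friendly_giant_outside: "x \<notin> \<Omega> \<Longrightarrow> friendly_giant p F x t = 0"
  using F by (simp add: friendly_giant_def positive_profile_def)

lemma friendly_giant_nonneg: "0 \<le> friendly_giant p F x t"
  by (simp add: friendly_giant_def profile_nonneg)

text \<open>Makes the boundary hypothesis applicable to the giant. The delay avoids the singularity
  at time 0, the data is written with \<open>0 + 1\<close> so that it is literally the orbit at time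
  0, and a constant sequence serves as the approximation.\<close>

lemma friendly_giant_DP_solution:
  "nonneg_nontrivial_DP_solution p s \<Omega> (\<lambda>x. friendly_giant p F x (0 + 1)) (\<lambda>t x. friendly_giant p F x (t + 1))"
proof -
  have int: "integrable lebesgue (\<lambda>x. friendly_giant p F x t)" for t
    using \<Omega> by (intro L2_on_integrable_of_bounded_support friendly_giant_L2 friendly_giant_outside)
  have "(\<lambda>x. friendly_giant p F x t) \<in> Lspace 1 \<Omega>" for t
    using int[of t] friendly_giant_outside by (auto simp: Lspace_def)
  moreover have "\<not> (AE x in lebesgue. friendly_giant p F x 1 = 0)"
  proof
    assume "AE x in lebesgue. friendly_giant p F x 1 = 0"
    then have ae: "AE x in lebesgue. F x \<le> 0" by eventually_elim (simp add: friendly_giant_def)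
    obtain x where "x \<in> \<Omega>" using \<Omega> by blast
    have "F x \<le> 0"
      using F ae \<open>x \<in> \<Omega>\<close> \<Omega>
      by (intro continuous_AE_le_imp_le[of \<Omega> F "\<lambda>_. 0"]) (auto simp: positive_profile_def)
    then show False using F \<open>x \<in> \<Omega>\<close> by (fastforce simp: positive_profile_def)
  qed
  moreover have "\<exists>v. (\<forall>n::nat. strong_solution p s \<Omega> (v n)) \<and>
      (\<forall>t\<ge>0. (\<lambda>n. Lnorm 1 (\<lambda>x. v n t x - friendly_giant p F x (t + 1))) \<longlonglongrightarrow> 0)"
    using friendly_giant_strong_solution[OF F ps(3), of 1]
    by (intro exI[of _ "\<lambda>n t x. friendly_giant p F x (t + 1)"]) (simp add: Lnorm_1_eq)
  ultimately show ?thesis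
    unfolding nonneg_nontrivial_DP_solution_def DP_solution_def
    using friendly_giant_continuous friendly_giant_nonneg by auto
qed

text \<open>At time 1 the delayed giant is the giant at time 2, a constant multiple of
  \<open>F\<close>.\<close>

lemma profile_le_bdist_powr:
  assumes "boundary_behaviour p s \<Omega>"
  obtains C where "0 < C" "\<And>x. x \<in> \<Omega> \<Longrightarrow> F x \<le> C * bdist \<Omega> x powr s"
proof -
  obtain c C where "0 < c" "c \<le> C" and C: "\<And>x. x \<in> \<Omega> \<Longrightarrow> friendly_giant p F x (1 + 1) \<le> C * bdist \<Omega> x powr s"
    by (rule boundary_behaviourE[OF assms friendly_giant_DP_solution zero_less_one]) blast
  have pos: "(0::real) < 2 powr (- 1 / (p - 2))" by simp
  have "F x \<le> C / 2 powr (- 1 / (p - 2)) * bdist \<Omega> x powr s" if "x \<in> \<Omega>" for x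
    using C[OF that] pos by (simp add: friendly_giant_def field_simps)
  moreover have "0 < C / 2 powr (- 1 / (p - 2))" using \<open>0 < c\<close> \<open>c \<le> C\<close> pos by (intro divide_pos_pos) auto
  ultimately show ?thesis using that by blast
qed

text \<open>Convergence is offered along a refinement of any given subsequence \<open>r\<close>, so
  that a single subsequence can be made to converge almost everywhere at two different
  times.\<close>

lemma DP_solution_approximation:
  assumes u: "DP_solution p s \<Omega> u0 u"
  obtains v where "\<And>n::nat. strong_solution p s \<Omega> (v n)"
    "\<And>r t. strict_mono r \<Longrightarrow> 0 \<le> t \<Longrightarrow>
      \<exists>q::nat \<Rightarrow> nat. strict_mono q \<and> (AE x in lebesgue. (\<lambda>n. v (r (q n)) t x) \<longlonglongrightarrow> u t x)"
proof -
  obtain v where v: "\<And>n::nat. strong_solution p s \<Omega> (v n)"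
    and lim: "\<And>t. 0 \<le> t \<Longrightarrow> (\<lambda>n. Lnorm 1 (\<lambda>x. v n t x - u t x)) \<longlonglongrightarrow> 0"
    using u by (auto simp: DP_solution_def)
  have "\<exists>q::nat \<Rightarrow> nat. strict_mono q \<and> (AE x in lebesgue. (\<lambda>n. v (r (q n)) t x) \<longlonglongrightarrow> u t x)"
    if "strict_mono r" "0 \<le> t" for r :: "nat \<Rightarrow> nat" and t
  proof -
    have "integrable lebesgue (v (r n) t)" for n
      using strong_solution_L2[OF v \<open>0 \<le> t\<close>] strong_solution_zero[OF v \<open>0 \<le> t\<close>] \<Omega>
      by (intro L2_on_integrable_of_bounded_support)
    moreover have "integrable lebesgue (u t)"
      using u \<open>0 \<le> t\<close> by (intro Lspace_1_integrable[of _ \<Omega>]) (simp add: DP_solution_def)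
    moreover have "(\<lambda>n. Lnorm 1 (\<lambda>x. v (r n) t x - u t x)) \<longlonglongrightarrow> 0"
      using LIMSEQ_subseq_LIMSEQ[OF lim[OF \<open>0 \<le> t\<close>] \<open>strict_mono r\<close>] by (simp add: o_def)
    ultimately show ?thesis by (rule approximation_AE_subseq) blast
  qed
  then show ?thesis using v that by blast
qed

lemma DP_solution_measurable: "DP_solution p s \<Omega> u0 u \<Longrightarrow> 0 \<le> t \<Longrightarrow> u t \<in> borel_measurable lebesgue"
  by (simp add: DP_solution_def Lspace_def)

text \<open>The bound is independent of the data, so it holds for all approximations at once, off
  one null set, and survives the limit.\<close>

lemma DP_solution_abs_le_friendly_giant:
  assumes u: "DP_solution p s \<Omega> u0 u" and "0 < t"
  shows "AE x in lebesgue. \<bar>u t x\<bar> \<le> friendly_giant p F x t"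
proof -
  obtain v where v: "\<And>n::nat. strong_solution p s \<Omega> (v n)"
    and sub: "\<And>r t. strict_mono r \<Longrightarrow> 0 \<le> t \<Longrightarrow>
      \<exists>q::nat \<Rightarrow> nat. strict_mono q \<and> (AE x in lebesgue. (\<lambda>n. v (r (q n)) t x) \<longlonglongrightarrow> u t x)"
    using DP_solution_approximation[OF u] by blast
  obtain q :: "nat \<Rightarrow> nat" where q: "AE x in lebesgue. (\<lambda>n. v (q n) t x) \<longlonglongrightarrow> u t x"
    using sub[of "\<lambda>n. n" t] \<open>0 < t\<close> by (auto simp: strict_mono_def)
  have "AE x in lebesgue. \<forall>n. \<bar>v n t x\<bar> \<le> friendly_giant p F x t"
    unfolding AE_all_countable using strong_solution_abs_le_friendly_giant[OF v F ps \<open>0 < t\<close>] by blast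
  with q show ?thesis
    by eventually_elim (intro LIMSEQ_le_const2[OF tendsto_rabs], auto)
qed

text \<open>At both times the giant bounds the approximations, so their contraction estimate passes
  to the limit; \<open>0 < a\<close> makes this bound available at the initial time. By
  \<open>le\<close> the norm at time \<open>a\<close> is then 0.\<close>

lemma friendly_giant_le_DP_solution:
  assumes u: "DP_solution p s \<Omega> u0 u" and T: "0 < T" and a: "0 < a" "a \<le> t"
    and le: "\<And>x. friendly_giant p F x (a + T) \<le> u a x"
  shows "AE x in lebesgue. friendly_giant p F x (t + T) \<le> u t x"
proof -
  let ?U = "\<lambda>t x. friendly_giant p F x t" and ?N = "L2norm lebesgue"
  have t: "0 < t" using a by simp
  obtain v where v: "\<And>n::nat. strong_solution p s \<Omega> (v n)"
    and sub: "\<And>r t. strict_mono r \<Longrightarrow> 0 \<le> t \<Longrightarrow>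
      \<exists>q::nat \<Rightarrow> nat. strict_mono q \<and> (AE x in lebesgue. (\<lambda>n. v (r (q n)) t x) \<longlonglongrightarrow> u t x)"
    using DP_solution_approximation[OF u] by blast
  obtain r :: "nat \<Rightarrow> nat" where r: "strict_mono r" and ra: "AE x in lebesgue. (\<lambda>n. v (r n) a x) \<longlonglongrightarrow> u a x"
    using sub[of "\<lambda>n. n" a] a by (auto simp: strict_mono_def)
  obtain q :: "nat \<Rightarrow> nat" where q: "strict_mono q" and qt: "AE x in lebesgue. (\<lambda>n. v (r (q n)) t x) \<longlonglongrightarrow> u t x"
    using sub[OF r, of t] t by auto
  have qa: "AE x in lebesgue. (\<lambda>n. v (r (q n)) a x) \<longlonglongrightarrow> u a x"
    using ra by eventually_elim (use LIMSEQ_subseq_LIMSEQ[OF _ q] in \<open>fastforce simp: o_def\<close>)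
  have lim: "(\<lambda>n. ?N (\<lambda>x. max (?U (r' + T) x - v (r (q n)) r' x) 0)) \<longlonglongrightarrow> ?N (\<lambda>x. max (?U (r' + T) x - u r' x) 0)"
    if "0 < r'" "AE x in lebesgue. (\<lambda>n. v (r (q n)) r' x) \<longlonglongrightarrow> u r' x" for r'
  proof (rule L2norm_pos_part_tendsto[OF _ _ friendly_giant_L2 friendly_giant_L2 _ that(2)])
    show "v (r (q n)) r' \<in> borel_measurable lebesgue" for n
      using strong_solution_L2[OF v, of r'] that by (intro L2_onD) auto
    show "u r' \<in> borel_measurable lebesgue" using DP_solution_measurable[OF u] that by simp
    show "AE x in lebesgue. \<bar>v (r (q n)) r' x\<bar> \<le> ?U r' x" for n
      by (rule strong_solution_abs_le_friendly_giant[OF v F ps that(1)])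
  qed
  have "?N (\<lambda>x. max (?U (t + T) x - u t x) 0) \<le> ?N (\<lambda>x. max (?U (a + T) x - u a x) 0)"
  proof (rule LIMSEQ_le[OF lim[OF t qt] lim[OF a(1) qa]], intro exI allI impI)
    fix n
    show "?N (\<lambda>x. max (?U (t + T) x - v (r (q n)) t x) 0) \<le> ?N (\<lambda>x. max (?U (a + T) x - v (r (q n)) a x) 0)"
      using a by (intro strong_solution_contraction[OF friendly_giant_strong_solution[OF F ps(3) T] v ps]) auto
  qed
  also have "(\<lambda>x. max (?U (a + T) x - u a x) 0) = (\<lambda>x. 0)"
    using le by (auto simp: max_def fun_eq_iff intro: antisym)
  also have "?N (\<lambda>x. 0) = 0" by (simp add: L2norm_def)
  finally have "?N (\<lambda>x. max (?U (t + T) x - u t x) 0) = 0" by (intro antisym) auto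
  moreover have "L2_on lebesgue (u t)"
  proof (rule L2_on_bound[OF friendly_giant_L2])
    show "AE x in lebesgue. \<bar>u t x\<bar> \<le> \<bar>?U t x\<bar>"
      using DP_solution_abs_le_friendly_giant[OF u t] by (simp add: friendly_giant_nonneg)
  qed (use DP_solution_measurable[OF u] t in simp)
  ultimately show ?thesis by (intro L2norm_pos_part_0_imp_AE_le friendly_giant_L2)
qed

end

theorem theorem6p1:
  fixes \<Omega> :: "'a::euclidean_space set" and s p :: real
    and F u0 :: "'a \<Rightarrow> real" and u :: "real \<Rightarrow> 'a \<Rightarrow> real"
  assumes "0 < s" "s < 1" "2 < p"
    and "smooth_bounded_domain \<Omega>"
    and "positive_profile p s \<Omega> F"
    and "boundary_behaviour p s \<Omega>"
    and "nonneg_nontrivial_DP_solution p s \<Omega> u0 u"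
  shows "(\<exists>T>0. \<forall>\<^sub>F t in at_top. \<forall>x\<in>\<Omega>.
            friendly_giant p F x (t + T) \<le> u t x \<and> u t x \<le> friendly_giant p F x t) \<and>
         (\<exists>C. \<forall>\<^sub>F t in at_top. \<forall>x\<in>\<Omega>. \<bar>t powr (1 / (p - 2)) * u t x - F x\<bar> \<le> C / t)"
proof -
  have \<Omega>: "open \<Omega>" "bounded \<Omega>" "\<Omega> \<noteq> {}" using assms(4) by (auto simp: smooth_bounded_domain_def)
  have u: "DP_solution p s \<Omega> u0 u" and u0: "\<And>t x. 0 < t \<Longrightarrow> 0 \<le> u t x"
    using assms(7) by (auto simp: nonneg_nontrivial_DP_solution_def)
  interpret dirichlet_profile \<Omega> s p F
    using assms \<Omega> by unfold_locales
  define a where "a = 1 / (p - 2)"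
  have a: "0 < a" using ps by (simp add: a_def)
  have U: "friendly_giant p F x t = t powr (- a) * F x" for x t
    by (simp add: friendly_giant_def a_def)
  obtain C where C: "0 < C" "\<And>x. x \<in> \<Omega> \<Longrightarrow> F x \<le> C * bdist \<Omega> x powr s"
    using profile_le_bdist_powr[OF assms(6)] by blast
  obtain c where c: "0 < c" "\<And>x. x \<in> \<Omega> \<Longrightarrow> c * bdist \<Omega> x powr s \<le> u 1 x"
    by (rule boundary_behaviourE[OF assms(6,7) zero_less_one]) blast
  \<comment> \<open>Then \<open>T powr a = C / c\<close>, which gives
    \<open>(1 + T) powr (- a) * C \<le> c\<close>: the giant delayed by \<open>T\<close> lies below
    \<open>u\<close> at time 1.\<close>
  define T where "T = (C / c) powr (1 / a)"
  have T: "0 < T" using C c by (simp add: T_def)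
  have "(1 + T) powr (- a) * C \<le> c"
  proof -
    have "C / c = T powr a" using C(1) c(1) a by (simp add: T_def powr_powr)
    also have "\<dots> \<le> (1 + T) powr a" using T a by (intro powr_mono2) auto
    finally have "C \<le> c * (1 + T) powr a" using c(1) by (simp add: field_simps)
    then show ?thesis using T by (simp add: powr_minus field_simps)
  qed
  have initial: "friendly_giant p F x (1 + T) \<le> u 1 x" for x
  proof (cases "x \<in> \<Omega>")
    case True
    have "friendly_giant p F x (1 + T) \<le> (1 + T) powr (- a) * (C * bdist \<Omega> x powr s)"
      unfolding U by (intro mult_left_mono C(2) True) auto
    also have "\<dots> \<le> c * bdist \<Omega> x powr s"
      using \<open>(1 + T) powr (- a) * C \<le> c\<close> by (simp add: mult.assoc[symmetric] mult_right_mono)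
    also have "\<dots> \<le> u 1 x" by (rule c(2)[OF True])
    finally show ?thesis .
  next
    case False
    then show ?thesis using u0[of 1 x] F by (simp add: U positive_profile_def)
  qed
  have cont: "continuous_on \<Omega> (u t)" if "0 < t" for t using u that by (simp add: DP_solution_def)
  have bounds: "friendly_giant p F x (t + T) \<le> u t x \<and> u t x \<le> friendly_giant p F x t"
    if "1 \<le> t" "x \<in> \<Omega>" for t x
  proof
    have t: "0 < t" using that by simp
    have "AE x in lebesgue. friendly_giant p F x (t + T) \<le> u t x"
      by (rule friendly_giant_le_DP_solution[OF u T _ \<open>1 \<le> t\<close> initial]) simp
    then show "friendly_giant p F x (t + T) \<le> u t x"
      by (intro continuous_AE_le_imp_le[OF \<Omega>(1) friendly_giant_continuous cont[OF t] _ that(2)])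
    have "AE x in lebesgue. u t x \<le> friendly_giant p F x t"
      using DP_solution_abs_le_friendly_giant[OF u t] by eventually_elim simp
    then show "u t x \<le> friendly_giant p F x t"
      by (intro continuous_AE_le_imp_le[OF \<Omega>(1) cont[OF t] friendly_giant_continuous _ that(2)])
  qed
  obtain D where D: "\<And>x. x \<in> \<Omega> \<Longrightarrow> bdist \<Omega> x \<le> D" using bdist_bounded[OF \<Omega>(2)] by blast
  \<comment> \<open>Boundedness of \<open>F\<close> is read off from its bound by a power of the
    distance, which is bounded on the domain.\<close>
  define B where "B = C * D powr s"
  have B: "F x \<le> B" if "x \<in> \<Omega>" for x
  proof -
    have "0 \<le> bdist \<Omega> x" by (simp add: bdist_def infdist_nonneg)
    then have "bdist \<Omega> x powr s \<le> D powr s" using D[OF that] ps by (intro powr_mono2) auto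
    then show ?thesis using C(2)[OF that] C(1) unfolding B_def
      by (meson mult_left_mono less_imp_le order.trans)
  qed
  obtain k :: nat where k: "\<And>y. 0 \<le> y \<Longrightarrow> y < 1 \<Longrightarrow> 1 - (1 - y) powr a \<le> real k * y"
    by (rule one_minus_powr_le[of a]) (use a in auto)
  have rate: "\<bar>t powr a * u t x - F x\<bar> \<le> real k * T * B / t" if t: "1 \<le> t" and x: "x \<in> \<Omega>" for t x
  proof -
    have "t powr a * u t x \<le> t powr a * (t powr (- a) * F x)"
      using bounds[OF that] unfolding U by (intro mult_left_mono) auto
    also have "\<dots> = F x" using t by (simp add: mult.assoc[symmetric] powr_add[symmetric])
    finally have upper: "t powr a * u t x \<le> F x" .
    \<comment> \<open>Then \<open>1 - y = t / (t + T)\<close>, so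
      \<open>(1 - y) powr a * F x\<close> is \<open>t powr a\<close> times the lower bound for
      \<open>u t x\<close>.\<close>
    define y where "y = T / (t + T)"
    have y: "0 \<le> y" "y < 1" "y \<le> T / t" using t T by (auto simp: y_def field_simps)
    have "1 - y = t / (t + T)" using t T by (simp add: y_def field_simps)
    then have "(1 - y) powr a = t powr a * (t + T) powr (- a)"
      using t T by (simp add: powr_divide powr_minus_divide)
    then have "(1 - y) powr a * F x \<le> t powr a * u t x"
      using bounds[OF that] unfolding U by (simp add: mult.assoc mult_left_mono)
    then have "F x - t powr a * u t x \<le> (1 - (1 - y) powr a) * F x" by (simp add: left_diff_distrib)
    also have "\<dots> \<le> (real k * y) * F x" by (intro mult_right_mono k y profile_nonneg)
    \<comment> \<open>\<open>y \<le> T / t\<close> gives the decay, \<open>F x \<le> B\<close> the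
      uniformity in \<open>x\<close>.\<close>
    also have "\<dots> \<le> (real k * (T / t)) * B" using y t T profile_nonneg B[OF x] by (intro mult_mono) auto
    finally show ?thesis using upper by (simp add: abs_le_iff)
  qed
  show ?thesis
    using T bounds rate unfolding a_def eventually_at_top_linorder by blast
qed

end
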